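(* Let $n\ge 1$ and let $A,B\subseteq[1;n]$ with $B\subseteq A$. Then $\Lambda_A$ and $\Lambda_B$ commute in $U_q(\mathfrak{sl}_2)^{\otimes n}$: $\Lambda_A\Lambda_B=\Lambda_B\Lambda_A$.
   Context: Let $\mathbb{K}$ be a field and $q\in\mathbb{K}$ not a root of unity. $U_q(\mathfrak{sl}_2)$ is the associative $\mathbb{K}$-algebra with generators $E,F,K,K^{-1}$ and relations $KK^{-1}=K^{-1}K=1$, $KE=q^2EK$, $KF=q^{-2}FK$, $EF-FE=\frac{K-K^{-1}}{q-q^{-1}}$. Its Casimir element is $\Lambda=(q-q^{-1})^2EF+q^{-1}K+qK^{-1}$. The coproduct is the algebra morphism $\Delta:U_q(\mathfrak{sl}_2)\to U_q(\mathfrak{sl}_2)^{\otimes2}$ with $\Delta(E)=E\otimes1+K\otimes E$, $\Delta(F)=F\otimes K^{-1}+1\otimes F$, $\Delta(K^{\pm1})=K^{\pm1}\otimes K^{\pm1}$. Let $\mathcal{I}_R$ be the subalgebra generated by $EK^{-1},F,K^{-1},\Lambda$, and $\tau_R:\mathcal{I}_R\to U_q(\mathfrak{sl}_2)\otimes\mathcal{I}_R$ the algebra morphism with $\tau_R(EK^{-1})=K^{-1}\otimes EK^{-1}$, $\tau_R(F)=K\otimes F-q^{-3}(q-q^{-1})^2F^2K\otimes EK^{-1}+q^{-1}(q+q^{-1})FK\otimes K^{-1}-q^{-1}FK\otimes\Lambda$, $\tau_R(K^{-1})=1\otimes K^{-1}-q^{-1}(q-q^{-1})^2F\otimes EK^{-1}$,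 $\tau_R(\Lambda)=1\otimes\Lambda$. For integers $i\le j$, $[i;j]=\{i,i+1,\dots,j\}$. For a map $\varphi$ and $\ell,m\ge0$, $1^{\otimes\ell}\otimes\varphi\otimes1^{\otimes m}$ applies $\varphi$ to tensor position $\ell+1$ and the identity elsewhere. Define $\Lambda_\varnothing=q+q^{-1}$ (a scalar), and for $A=\{a_1<\dots<a_m\}\subseteq[1;n]$ define $\Lambda_A=1^{\otimes(a_1-1)}\otimes(\mu_m\circ\cdots\circ\mu_2)(\Lambda)\otimes1^{\otimes(n-a_m)}\in U_q(\mathfrak{sl}_2)^{\otimes n}$, where $\mu_i=(1^{\otimes(a_i-a_1-1)}\otimes\tau_R)\circ\cdots\circ(1^{\otimes(a_{i-1}-a_1+1)}\otimes\tau_R)\circ(1^{\otimes(a_{i-1}-a_1)}\otimes\Delta)$ (the $\tau_R$ factors being absent when $a_i=a_{i-1}+1$); these compositions are well defined. In particular $\Lambda_{\{i\}}=1^{\otimes(i-1)}\otimes\Lambda\otimes1^{\otimes(n-i)}$. *)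

theory Defs
  imports Main
begin

datatype ('l, 'k) expr = Gen 'l | Scal 'k | Add "('l,'k) expr" "('l,'k) expr"
  | Mul "('l,'k) expr" "('l,'k) expr"

text \<open>The congruence generated by the axioms of a unital associative K-algebra and the
  relations R; expressions modulo alg_eq R form the K-algebra with generators 'l and relations R.\<close>
inductive alg_eq :: "(('l,'k) expr \<times> ('l,'k) expr) set \<Rightarrow> ('l,'k::field) expr \<Rightarrow> ('l,'k) expr \<Rightarrow> bool"
  for R where
  rel: "(x, y) \<in> R \<Longrightarrow> alg_eq R x y"
| refl: "alg_eq R x x"
| sym: "alg_eq R x y \<Longrightarrow> alg_eq R y x"
| trans: "alg_eq R x y \<Longrightarrow> alg_eq R y z \<Longrightarrow> alg_eq R x z"
| add_cong: "alg_eq R x x' \<Longrightarrow> alg_eq R y y' \<Longrightarrow> alg_eq R (Add x y) (Add x' y')"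
| mul_cong: "alg_eq R x x' \<Longrightarrow> alg_eq R y y' \<Longrightarrow> alg_eq R (Mul x y) (Mul x' y')"
| add_assoc: "alg_eq R (Add (Add x y) z) (Add x (Add y z))"
| add_comm: "alg_eq R (Add x y) (Add y x)"
| add_zero: "alg_eq R (Add (Scal 0) x) x"
| add_neg: "alg_eq R (Add x (Mul (Scal (-1)) x)) (Scal 0)"
| mul_assoc: "alg_eq R (Mul (Mul x y) z) (Mul x (Mul y z))"
| mul_one_l: "alg_eq R (Mul (Scal 1) x) x"
| mul_one_r: "alg_eq R (Mul x (Scal 1)) x"
| distrib_l: "alg_eq R (Mul x (Add y z)) (Add (Mul x y) (Mul x z))"
| distrib_r: "alg_eq R (Mul (Add x y) z) (Add (Mul x z) (Mul y z))"
| scal_add: "alg_eq R (Add (Scal a) (Scal b)) (Scal (a + b))"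
| scal_mul: "alg_eq R (Mul (Scal a) (Scal b)) (Scal (a * b))"
| scal_central: "alg_eq R (Mul (Scal a) x) (Mul x (Scal a))"

definition sub :: "('l,'k::field) expr \<Rightarrow> ('l,'k) expr \<Rightarrow> ('l,'k) expr" where
  "sub x y = Add x (Mul (Scal (-1)) y)"

definition smul :: "'k \<Rightarrow> ('l,'k) expr \<Rightarrow> ('l,'k) expr" where
  "smul c x = Mul (Scal c) x"

primrec subst :: "('l \<Rightarrow> ('m,'k) expr) \<Rightarrow> ('l,'k) expr \<Rightarrow> ('m,'k) expr" where
  "subst f (Gen l) = f l"
| "subst f (Scal c) = Scal c"
| "subst f (Add x y) = Add (subst f x) (subst f y)"
| "subst f (Mul x y) = Mul (subst f x) (subst f y)"

primrec letters :: "('l,'k) expr \<Rightarrow> 'l set" where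
  "letters (Gen l) = {l}"
| "letters (Scal c) = {}"
| "letters (Add x y) = letters x \<union> letters y"
| "letters (Mul x y) = letters x \<union> letters y"

datatype gen = E | F | K | Ki

text \<open>Letter (i, g): generator g in tensor position i (positions 1..n).\<close>
abbreviation G :: "nat \<Rightarrow> gen \<Rightarrow> (nat \<times> gen, 'k) expr" where
  "G i g \<equiv> Gen (i, g)"

inductive_set uq_rels :: "'k::field \<Rightarrow> nat \<Rightarrow> ((nat \<times> gen, 'k) expr \<times> (nat \<times> gen, 'k) expr) set"
  for q n where
  KKi: "i \<in> {1..n} \<Longrightarrow> (Mul (G i K) (G i Ki), Scal 1) \<in> uq_rels q n"
| KiK: "i \<in> {1..n} \<Longrightarrow> (Mul (G i Ki) (G i K), Scal 1) \<in> uq_rels q n"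
| KE: "i \<in> {1..n} \<Longrightarrow> (Mul (G i K) (G i E), smul (q^2) (Mul (G i E) (G i K))) \<in> uq_rels q n"
| KF: "i \<in> {1..n} \<Longrightarrow> (Mul (G i K) (G i F), smul (inverse q ^ 2) (Mul (G i F) (G i K))) \<in> uq_rels q n"
| EF: "i \<in> {1..n} \<Longrightarrow> (sub (Mul (G i E) (G i F)) (Mul (G i F) (G i E)),
          smul (inverse (q - inverse q)) (sub (G i K) (G i Ki))) \<in> uq_rels q n"
| comm: "i \<in> {1..n} \<Longrightarrow> j \<in> {1..n} \<Longrightarrow> i \<noteq> j \<Longrightarrow>
          (Mul (G i g) (G j h), Mul (G j h) (G i g)) \<in> uq_rels q n"

definition Cas :: "'k::field \<Rightarrow> nat \<Rightarrow> (nat \<times> gen, 'k) expr" where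
  "Cas q i = Add (Add (smul ((q - inverse q)^2) (Mul (G i E) (G i F))) (smul (inverse q) (G i K)))
                 (smul q (G i Ki))"

definition EKi :: "nat \<Rightarrow> (nat \<times> gen, 'k) expr" where
  "EKi i = Mul (G i E) (G i Ki)"

text \<open>1^{(p-1)} tensor Delta tensor 1^{...}: coproduct applied at position p.\<close>
fun delta_letter :: "nat \<Rightarrow> nat \<times> gen \<Rightarrow> (nat \<times> gen, 'k) expr" where
  "delta_letter p (i, g) =
     (if i < p then G i g else if p < i then G (i + 1) g else
      (case g of
         E \<Rightarrow> Add (G p E) (Mul (G p K) (G (p+1) E))
       | F \<Rightarrow> Add (Mul (G p F) (G (p+1) Ki)) (G (p+1) F)
       | K \<Rightarrow> Mul (G p K) (G (p+1) K)
       | Ki \<Rightarrow> Mul (G p Ki) (G (p+1) Ki)))"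

definition Delta_at :: "nat \<Rightarrow> (nat \<times> gen, 'k) expr \<Rightarrow> (nat \<times> gen, 'k) expr" where
  "Delta_at p = subst (delta_letter p)"

text \<open>Generators of the subalgebra I_R: E K^{-1}, F, K^{-1}, Lambda.\<close>
datatype irgen = IEKi | IF | IKi | IL

fun ir_eval :: "'k::field \<Rightarrow> nat \<Rightarrow> (nat \<times> gen) + irgen \<Rightarrow> (nat \<times> gen, 'k) expr" where
  "ir_eval q p (Inl (i, g)) = G i g"
| "ir_eval q p (Inr IEKi) = EKi p"
| "ir_eval q p (Inr IF) = G p F"
| "ir_eval q p (Inr IKi) = G p Ki"
| "ir_eval q p (Inr IL) = Cas q p"

text \<open>1^{(p-1)} tensor tau_R tensor 1^{...} on generators (first factor of tau_R in
  position p, second in position p+1).\<close>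
fun tau_letter :: "'k::field \<Rightarrow> nat \<Rightarrow> (nat \<times> gen) + irgen \<Rightarrow> (nat \<times> gen, 'k) expr" where
  "tau_letter q p (Inl (i, g)) = (if i < p then G i g else G (i + 1) g)"
| "tau_letter q p (Inr IEKi) = Mul (G p Ki) (EKi (p+1))"
| "tau_letter q p (Inr IF) =
     sub (Add (sub (Mul (G p K) (G (p+1) F))
                   (smul (inverse q ^ 3 * (q - inverse q)^2)
                         (Mul (Mul (Mul (G p F) (G p F)) (G p K)) (EKi (p+1)))))
              (smul (inverse q * (q + inverse q)) (Mul (Mul (G p F) (G p K)) (G (p+1) Ki))))
         (smul (inverse q) (Mul (Mul (G p F) (G p K)) (Cas q (p+1))))"
| "tau_letter q p (Inr IKi) =
     sub (G (p+1) Ki) (smul (inverse q * (q - inverse q)^2) (Mul (G p F) (EKi (p+1))))"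
| "tau_letter q p (Inr IL) = Cas q (p+1)"

text \<open>The map 1^{(p-1)} tensor tau_R tensor 1^{(n-p)} applied to an element x of U^{n}
  lying in U^{(p-1)} tensor I_R tensor U^{(n-p)}: write x (modulo the relations of U^{n})
  as a noncommutative polynomial in the generators at positions other than p and the
  generators of I_R at position p, and substitute the images.\<close>
definition tau_at :: "'k::field \<Rightarrow> nat \<Rightarrow> nat \<Rightarrow> (nat \<times> gen, 'k) expr \<Rightarrow> (nat \<times> gen, 'k) expr" where
  "tau_at q n p x = (SOME y. \<exists>e.
      (\<forall>l \<in> letters e. case l of Inl (i, g) \<Rightarrow> i \<in> {1..n} \<and> i \<noteq> p | Inr _ \<Rightarrow> True)
      \<and> alg_eq (uq_rels q n) (subst (ir_eval q p) e) x
      \<and> y = subst (tau_letter q p) e)"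

text \<open>Apply tau_R successively at positions p, p+1, ..., p+j-1 (the current number of
  tensor factors being equal to the position each time).\<close>
fun taus :: "'k::field \<Rightarrow> nat \<Rightarrow> nat \<Rightarrow> (nat \<times> gen, 'k) expr \<Rightarrow> (nat \<times> gen, 'k) expr" where
  "taus q p 0 x = x"
| "taus q p (Suc j) x = taus q (Suc p) j (tau_at q p p x)"

text \<open>lam_go q k prev bs x: x in U^{k}, where k = prev - a_1 + 1 and prev is the last
  element processed; bs the remaining elements of A (increasing). Each step is mu_i.\<close>
fun lam_go :: "'k::field \<Rightarrow> nat \<Rightarrow> nat \<Rightarrow> nat list \<Rightarrow> (nat \<times> gen, 'k) expr \<Rightarrow> (nat \<times> gen, 'k) expr" where
  "lam_go q k prev [] x = x"
| "lam_go q k prev (b # bs) x =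
     lam_go q (k + (b - prev)) b bs (taus q (k + 1) (b - prev - 1) (Delta_at k x))"

definition shift :: "nat \<Rightarrow> (nat \<times> gen, 'k) expr \<Rightarrow> (nat \<times> gen, 'k) expr" where
  "shift s = subst (\<lambda>(i, g). G (i + s) g)"

definition Lam :: "'k::field \<Rightarrow> nat set \<Rightarrow> (nat \<times> gen, 'k) expr" where
  "Lam q A = (if A = {} then Scal (q + inverse q)
     else shift (Min A - 1) (lam_go q 1 (Min A) (tl (sorted_list_of_set A)) (Cas q 1)))"

end

theory Submission
  imports Defs "HOL-Computational_Algebra.Formal_Power_Series"
begin

text \<open>The map \<open>\<tau>\<^sub>R\<close> is conjugation by the universal R-matrix. Hence \<open>\<Lambda>\<^sub>A\<close> is the image of a total Casimir
  element under a braid which moves the strands outside \<open>A\<close> behind those in \<open>A\<close>, and a strand outside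
  \<open>A \<supseteq> B\<close> can be removed from \<open>\<Lambda>\<^sub>A\<close> and \<open>\<Lambda>\<^sub>B\<close> at the same time. This reduces the claim to an interval
  \<open>A\<close>, for which \<open>\<Lambda>\<^sub>A\<close> lies in the image of the iterated coproduct, and that image commutes with every \<open>\<Lambda>\<^sub>B\<close>.

  The R-matrix is avoided as follows. In the strand over which the conjugation passes, \<open>F\<close> is
  replaced by \<open>t F\<close> for a central indeterminate \<open>t\<close>. Then
  \<open>\<tau>\<^sub>R(K\<^sup>-\<^sup>1) = (1 - q\<^sup>-\<^sup>1 (q - q\<^sup>-\<^sup>1)\<^sup>2 t F \<otimes> E) (1 \<otimes> K\<^sup>-\<^sup>1)\<close> is invertible over power series in \<open>t\<close>, so
  \<open>\<tau>\<^sub>R\<close> extends from \<open>I\<^sub>R\<close> to an algebra morphism on all of \<open>U\<^sub>q(sl\<^sub>2)\<close>. Identities between elements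
  polynomial in \<open>t\<close> are then specialised to \<open>t = 1\<close>.\<close>

section \<open>Passing a tensor factor over a strand\<close>

text \<open>The image of the coproduct commutes with \<open>\<Lambda>\<close> of any subset because
  the R-matrix intertwines the coproduct with its opposite: the coproduct of (strand, factor) equals
  the coproduct, in exchanged order, of their conjugates. So the coproduct of \<open>m + 1\<close>
  factors is a polynomial in the coproduct of \<open>m\<close> factors, the last of them conjugated,
  and in the conjugates of the strand, which commute with everything that enters the value. Removing
  a strand rests on two further R-matrix identities: the Yang-Baxter equation
  (\<open>tau_tau\<close>) and the hexagon relation (\<open>tau_delta\<close>). Both are needed for
  matrices acting on arbitrary tuples. Conjugated generators live over power series and not in the
  presented algebra. Statements used inductively are therefore kept as congruences
  \<open>alg_eq\<close>, that is, as universal identities: they may be evaluated at every family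
  satisfying the relations, in particular at a conjugated one. Conversely, a congruence follows from
  the equality of values at one generic family.\<close>

lemma assoc_rule: "a * b = c \<Longrightarrow> a * (b * z) = c * (z::'a::ring_1)"
  by (simp add: mult.assoc[symmetric])

lemma commute_inverse:
  fixes u v a b :: "'a::ring_1"
  assumes "u * v = 1" "v * u = 1" "u * a = b * u"
  shows "a * v = v * b"
proof -
  have "v * (u * a) * v = v * (b * u) * v" using assms(3) by simp
  moreover have "v * (u * a) * v = (v * u) * (a * v)" by (simp only: mult.assoc)
  moreover have "v * (b * u) * v = v * b * (u * v)" by (simp only: mult.assoc)
  ultimately show ?thesis using assms by simp
qed

text \<open>Here \<open>q\<close> and \<open>p = q\<^sup>-\<^sup>1\<close> are central ring elements, and \<open>e\<close> stands for \<open>(q - q\<^sup>-\<^sup>1)\<^sup>2 E\<close>: with this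
  rescaling no denominators occur.\<close>

definition uq_quad :: "'a::ring_1 \<Rightarrow> 'a \<Rightarrow> 'a \<Rightarrow> 'a \<Rightarrow> 'a \<Rightarrow> 'a \<Rightarrow> bool" where
  "uq_quad q p e f k l \<longleftrightarrow> k * l = 1 \<and> l * k = 1 \<and> k * e = q * q * e * k \<and> k * f = p * p * f * k
     \<and> e * f - f * e = (q - p) * (k - l)"

locale scalars =
  fixes q p :: "'a::ring_1"
  assumes q_central: "x * q = q * x" and p_central: "x * p = p * x" and qp: "q * p = 1"
begin

lemma pq: "p * q = 1" using q_central[of p] qp by simp

lemmas scalar_cancel = qp pq qp[THEN assoc_rule] pq[THEN assoc_rule]
end

locale quad = scalars q p for q p :: "'a::ring_1" +
  fixes e f k l :: 'a
  assumes uq: "uq_quad q p e f k l"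
begin

lemma kl: "k * l = 1" "l * k = 1" using uq by (auto simp: uq_quad_def)
lemma ke: "k * e = q * (q * (e * k))" using uq by (auto simp: uq_quad_def mult.assoc)
lemma kf: "k * f = p * (p * (f * k))" using uq by (auto simp: uq_quad_def mult.assoc)
lemma fe: "f * e = e * f - (q - p) * (k - l)" using uq by (auto simp: uq_quad_def algebra_simps)

lemma le: "l * e = p * (p * (e * l))"
proof -
  have "e * l = l * (q * q * e)"
    by (rule commute_inverse[OF kl]) (simp add: ke mult.assoc)
  also have "\<dots> = q * (q * (l * e))"
    by (metis mult.assoc q_central)
  finally show ?thesis
    by (simp add: scalar_cancel)
qed

lemma lf: "l * f = q * (q * (f * l))"
proof -
  have "f * l = l * (p * p * f)"
    by (rule commute_inverse[OF kl]) (simp add: kf mult.assoc)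
  also have "\<dots> = p * (p * (l * f))"
    by (metis mult.assoc p_central)
  finally show ?thesis
    by (simp add: scalar_cancel)
qed

text \<open>These rules are oriented towards the PBW order: scalars, \<open>e\<close>,
  \<open>f\<close>, then a power of \<open>k\<close> or \<open>l\<close>. Most occur a second time
  through \<open>assoc_rule\<close>, to act inside right-nested products. With the rules for strand
  letters, which move to the left of the factor, polynomial identities become comparisons of normal
  forms.\<close>

lemmas quad_order =
  kl kl[THEN assoc_rule] ke ke[THEN assoc_rule] kf kf[THEN assoc_rule]
  le le[THEN assoc_rule] lf lf[THEN assoc_rule] fe fe[THEN assoc_rule]
  q_central[of e] q_central[of f] q_central[of k] q_central[of l]
  p_central[of e] p_central[of f] p_central[of k] p_central[of l]
  q_central[of e, THEN assoc_rule] q_central[of f, THEN assoc_rule] q_central[of k, THEN assoc_rule] q_central[of l, THEN assoc_rule]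
  p_central[of e, THEN assoc_rule] p_central[of f, THEN assoc_rule] p_central[of k, THEN assoc_rule] p_central[of l, THEN assoc_rule]

end

locale strand = scalars q p for q p :: "'a::ring_1" +
  fixes g h s :: 'a
  assumes gh: "g * h = 1" "h * g = 1" and gs0: "g * s = p * p * s * g"
begin
lemma gs: "g * s = p * (p * (s * g))" using gs0 by (simp add: mult.assoc)

lemma hs: "h * s = q * (q * (s * h))"
proof -
  have "s * h = h * (p * p * s)"
    by (rule commute_inverse[OF gh]) (simp add: gs mult.assoc)
  also have "\<dots> = p * (p * (h * s))"
    by (metis mult.assoc p_central)
  finally show ?thesis
    by (simp add: scalar_cancel)
qed

lemmas strand_order =
  gh gh[THEN assoc_rule] gs gs[THEN assoc_rule] hs hs[THEN assoc_rule]
  q_central[of g] q_central[of h] q_central[of s]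
  p_central[of g] p_central[of h] p_central[of s]
  q_central[of g, THEN assoc_rule] q_central[of h, THEN assoc_rule] q_central[of s, THEN assoc_rule]
  p_central[of g, THEN assoc_rule] p_central[of h, THEN assoc_rule] p_central[of s, THEN assoc_rule]
end

text \<open>\<open>(g, h, s)\<close> are \<open>K\<close>, \<open>K\<^sup>-\<^sup>1\<close>, \<open>F\<close> of the strand over which the tensor factor \<open>(e, f, k, l)\<close> passes.
  Primed elements are R-matrix conjugates; \<open>x'\<close>, \<open>f'\<close>, \<open>l'\<close> are the values of \<open>\<tau>\<^sub>R\<close> at \<open>E K\<^sup>-\<^sup>1\<close>, \<open>F\<close>,
  \<open>K\<^sup>-\<^sup>1\<close>, whereas \<open>e'\<close>, \<open>k'\<close> and the strand conjugates \<open>g'\<close>, \<open>h'\<close>, \<open>s'\<close> only exist once \<open>u\<close> is invertible.\<close>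

locale pass = quad q p e f k l + strand q p g h s for q p e f k l g h s :: "'a::ring_1" +
  assumes cross: "e * g = g * e" "e * h = h * e" "e * s = s * e"
    "f * g = g * f" "f * h = h * f" "f * s = s * f"
    "k * g = g * k" "k * h = h * k" "k * s = s * k"
    "l * g = g * l" "l * h = h * l" "l * s = s * l"
begin

lemmas order = scalar_cancel quad_order strand_order cross cross[THEN assoc_rule]

definition "C = e * f + p * k + q * l"
definition "u = 1 - p * s * e"
definition "f' = g * f - p * p * p * s * s * g * e * l + (1 + p * p) * s * g * l - p * s * g * C"
definition "x' = h * e * l"
definition "l' = u * l"

lemmas defs = C_def u_def f'_def x'_def l'_def

text \<open>This is the coproduct identity \<open>f + s * l = s' + f' * h'\<close> multiplied by
  \<open>g'\<close> on the right, where no inverse of \<open>u\<close> remains.\<close>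

lemma f'_eq: "f' = (f + s * l) * u * g - s * k * g"
  unfolding defs by (simp add: algebra_simps order)

lemma l'x': "l' * x' = p * (p * (x' * l'))"
  unfolding defs by (simp add: algebra_simps order)

lemma l'f': "l' * f' = q * (q * (f' * l'))"
  unfolding defs by (simp add: algebra_simps order)

text \<open>Inside I_R the letter K is missing, so the relation between E and F takes the form of
  \<open>e * f = C - p * k - q * l\<close> multiplied by the inverse of K. The next lemma does the
  same for \<open>f * e = C - q * k - p * l\<close>.\<close>

lemma x'f': "x' * f' = q * (q * (C * l' - p - q * l' * l'))"
  unfolding defs by (simp add: algebra_simps order)

lemma f'x': "f' * x' = C * l' - q - p * l' * l'"
  unfolding defs by (simp add: algebra_simps order)

lemma sf': "s * f' = q * (q * (f' * s))"
  unfolding defs by (simp add: algebra_simps order)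

lemma kg_l': "k * g * l' = l' * (k * g)"
  unfolding defs by (simp add: algebra_simps order)
lemma kg_x': "k * g * x' = q * (q * (x' * (k * g)))"
  unfolding defs by (simp add: algebra_simps order)
lemma kg_f': "k * g * f' = p * (p * (f' * (k * g)))"
  unfolding defs by (simp add: algebra_simps order)

end

locale pass_e = pass q p e f k l g h s for q p e f k l g h s :: "'a::ring_1" +
  fixes d t :: 'a
  assumes ge: "g * d = q * q * d * g" and ds: "s * d = d * s - t * (q - p) * (g - h)"
   and cross_d: "e * d = d * e" "f * d = d * f" "k * d = d * k" "l * d = d * l"
   and t_central: "x * t = t * x"
begin
lemma gd: "g * d = q * (q * (d * g))" using ge by (simp add: mult.assoc)
lemma hd': "h * d = p * (p * (d * h))"
proof -
  have "d * h = h * (q * q * d)"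
    by (rule commute_inverse[OF gh]) (simp add: gd mult.assoc)
  also have "\<dots> = q * (q * (h * d))"
    by (metis mult.assoc q_central)
  finally show ?thesis
    by (simp add: scalar_cancel)
qed

lemmas order_d = order gd gd[THEN assoc_rule] hd' hd'[THEN assoc_rule] ds ds[THEN assoc_rule] cross_d cross_d[THEN assoc_rule]
  q_central[of d] p_central[of d]
  q_central[of d, THEN assoc_rule] p_central[of d, THEN assoc_rule]
  t_central[of q] t_central[of p]  t_central[of d] t_central[of e] t_central[of f] t_central[of k] t_central[of l] 
  t_central[of g] t_central[of h] t_central[of s]
  t_central[of q, THEN assoc_rule] t_central[of p, THEN assoc_rule] t_central[of d, THEN assoc_rule] t_central[of e, THEN assoc_rule] t_central[of f, THEN assoc_rule] t_central[of k, THEN assoc_rule] t_central[of l, THEN assoc_rule] 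
  t_central[of g, THEN assoc_rule] t_central[of h, THEN assoc_rule] t_central[of s, THEN assoc_rule]

text \<open>\<open>d\<close> is the generator \<open>E\<close> of the strand and \<open>s = t F\<close>. \<open>S\<close> is the conjugate of \<open>d\<close>; unlike \<open>e'\<close>
  it is a polynomial.\<close>

definition "S = d * l - p * s * d * e * l + p * p * t * (g - h) * e * l - p * t * g * s * e * e * l"

lemma Sl': "S * l' = l' * S"
  unfolding defs S_def by (simp add: algebra_simps order_d)
lemma Sx': "S * x' = x' * S"
  unfolding defs S_def by (simp add: algebra_simps order_d)
lemma Sf': "S * f' = f' * S"
  unfolding defs S_def by (simp add: algebra_simps order_d)
end

text \<open>The images of \<open>E K\<^sup>-\<^sup>1\<close>, \<open>F\<close>, \<open>K\<^sup>-\<^sup>1\<close>, \<open>\<Lambda>\<close> under \<open>\<tau>\<^sub>R\<close> and \<open>\<Delta>\<close> are linear in the corresponding elements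
  \<open>x\<close>, \<open>y\<close>, \<open>z\<close>, \<open>w\<close> of the second factor, so a composite of these maps is a product of matrices over the
  first factors and may be evaluated at arbitrary ring elements.\<close>

fun tau_tup :: "'a::ring_1 \<Rightarrow> 'a \<Rightarrow> 'a \<Rightarrow> 'a \<Rightarrow> 'a \<times> 'a \<times> 'a \<times> 'a \<Rightarrow> 'a \<times> 'a \<times> 'a \<times> 'a" where
  "tau_tup p g h s (x, y, z, w) =
     (h * x, g * y - p * p * p * s * s * g * x + (1 + p * p) * s * g * z - p * s * g * w, z - p * s * x, w)"

fun delta_tup :: "'a::ring_1 \<Rightarrow> 'a \<Rightarrow> 'a \<Rightarrow> 'a \<Rightarrow> 'a \<Rightarrow> 'a \<times> 'a \<times> 'a \<times> 'a \<Rightarrow> 'a \<times> 'a \<times> 'a \<times> 'a" where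
  "delta_tup q e f k l (x, y, z, w) =
     (e * l * z + x, f * z + y, l * z, (e * f - q * k + q * l) * z + k * w + e * y + k * f * x)"

locale pass_inv = pass q p e f k l g h s for q p e f k l g h s :: "'a::ring_1" +
  fixes v :: 'a
  assumes uv: "(1 - p * s * e) * v = 1" "v * (1 - p * s * e) = 1"
begin

text \<open>All five are forced: \<open>k'\<close> inverts \<open>l'\<close>, and
  \<open>e' * l' = x'\<close> gives \<open>e'\<close>. Invariance of the coproduct of K,
  \<open>k' * g' = k * g\<close>, gives \<open>g'\<close> and its inverse \<open>h'\<close>, and
  that of F gives \<open>s'\<close>.\<close>

definition "k' = k * v"
definition "e' = h * e * v"
definition "g' = u * g"
definition "h' = h * v"
definition "s' = s * k * v"

lemma uv': "u * v = 1" "v * u = 1" using uv by (auto simp: u_def)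

lemma l'k': "l' * k' = 1" "k' * l' = 1"
proof -
  have "l' * k' = u * ((l * k) * v)" by (simp only: l'_def k'_def mult.assoc)
  then show "l' * k' = 1" using uv' kl by simp
  have "k' * l' = k * ((v * u) * l)" by (simp only: l'_def k'_def mult.assoc)
  then show "k' * l' = 1" using uv' kl by simp
qed

lemma s_v: "s * v = v * s"
  by (rule commute_inverse[OF uv']) (simp add: u_def algebra_simps order)
lemma e_v: "e * v = v * e"
  by (rule commute_inverse[OF uv']) (simp add: u_def algebra_simps order)
lemma kg_v: "k * g * v = v * (k * g)"
  by (rule commute_inverse[OF uv']) (simp add: u_def algebra_simps order)
lemma lh_v: "l * h * v = v * (l * h)"
  by (rule commute_inverse[OF uv']) (simp add: u_def algebra_simps order)

lemma s'_eq: "s' = s * k'" by (simp add: s'_def k'_def mult.assoc)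

lemma g'_eq: "g' = l' * (k * g)"
  unfolding g'_def l'_def by (metis kl(2) mult.assoc mult.right_neutral mult_1)

lemma e'l': "e' * l' = x'"
  unfolding e'_def l'_def x'_def by (metis uv'(2) mult.assoc mult_1)

lemma e'_eq: "e' = x' * k'"
  by (metis e'l' l'k'(1) mult.assoc mult.right_neutral)

lemma g'h': "g' * h' = 1" "h' * g' = 1"
proof -
  have "g' * h' = u * ((g * h) * v)" by (simp only: g'_def h'_def mult.assoc)
  then show "g' * h' = 1" using uv' gh by simp
  have "h' * g' = h * ((v * u) * g)" by (simp only: g'_def h'_def mult.assoc)
  then show "h' * g' = 1" using uv' gh by simp
qed

lemma k'x': "k' * x' = q * (q * (x' * k'))"
proof -
  have "x' * k' = k' * (p * p * x')"
    by (rule commute_inverse[OF l'k']) (simp add: l'x' mult.assoc)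
  also have "\<dots> = p * (p * (k' * x'))" by (metis mult.assoc p_central)
  finally show ?thesis by (simp add: scalar_cancel)
qed

lemma k'f': "k' * f' = p * (p * (f' * k'))"
proof -
  have "f' * k' = k' * (q * q * f')"
    by (rule commute_inverse[OF l'k']) (simp add: l'f' mult.assoc)
  also have "\<dots> = q * (q * (k' * f'))" by (metis mult.assoc q_central)
  finally show ?thesis by (simp add: scalar_cancel)
qed

lemma k'e': "k' * e' = q * (q * (e' * k'))"
  unfolding e'_eq by (simp add: k'x'[THEN assoc_rule] mult.assoc)

lemma e'f': "e' * f' = C - p * k' - q * l'"
proof -
  have "e' * f' = x' * (p * (p * (f' * k')))" by (simp add: e'_eq mult.assoc k'f')
  also have "\<dots> = p * (p * (x' * f' * k'))" by (metis mult.assoc p_central)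
  also have "\<dots> = C * (l' * k') - p * k' - q * (l' * (l' * k'))"
    by (simp add: x'f' scalar_cancel left_diff_distrib mult.assoc)
  finally show ?thesis by (simp add: l'k')
qed

lemma f'e': "f' * e' = C - q * k' - p * l'"
proof -
  have "f' * e' = f' * x' * k'" by (simp add: e'_eq mult.assoc)
  also have "\<dots> = C * (l' * k') - q * k' - p * (l' * (l' * k'))"
    by (simp add: f'x' scalar_cancel left_diff_distrib mult.assoc)
  finally show ?thesis by (simp add: l'k')
qed

lemma quad': "uq_quad q p e' f' k' l'"
  unfolding uq_quad_def
  by (auto simp: l'k' k'e' k'f' mult.assoc e'f' f'e' algebra_simps)

lemma C'_eq: "e' * f' + p * k' + q * l' = C" by (simp add: e'f')

lemma s_l': "l' * s = s * l'"
  unfolding l'_def u_def by (simp add: algebra_simps order)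
lemma s_k': "s * k' = k' * s"
  by (rule commute_inverse[OF l'k' s_l'])

lemma s_x': "s * x' = p * (p * (x' * s))"
  unfolding x'_def by (simp add: algebra_simps order)

lemma s'_cross: "l' * s' = s' * l'" "k' * s' = s' * k'" "e' * s' = s' * e'" "f' * s' = s' * f'"
proof -
  show "l' * s' = s' * l'" unfolding s'_eq by (metis s_l' l'k' mult.assoc mult.right_neutral mult_1)
  show k: "k' * s' = s' * k'" unfolding s'_eq by (metis s_k' mult.assoc)
  have "s' * x' = x' * s'"
  proof -
    have "s' * x' = s * (q * (q * (x' * k')))" by (simp add: s'_eq mult.assoc k'x')
    also have "\<dots> = q * (q * (s * x' * k'))" by (metis mult.assoc q_central)
    also have "\<dots> = x' * s'" by (simp add: s_x' scalar_cancel mult.assoc s'_eq)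
    finally show ?thesis .
  qed
  then show "e' * s' = s' * e'" unfolding e'_eq using k by (metis mult.assoc)
  have "s' * f' = s * (p * (p * (f' * k')))" by (simp add: s'_eq mult.assoc k'f')
  also have "\<dots> = p * (p * (s * f' * k'))" by (metis mult.assoc p_central)
  also have "\<dots> = f' * s'" by (simp add: sf' scalar_cancel mult.assoc s'_eq)
  finally show "f' * s' = s' * f'" by simp
qed

lemma g'_cross: "l' * g' = g' * l'" "k' * g' = g' * k'" "e' * g' = g' * e'" "f' * g' = g' * f'"
proof -
  show l: "l' * g' = g' * l'" unfolding g'_eq using kg_l' by (metis mult.assoc)
  show k: "k' * g' = g' * k'"
    using commute_inverse[OF l'k' l] by simp
  have "g' * x' = l' * (q * (q * (x' * (k * g))))" by (simp add: g'_eq mult.assoc kg_x'[simplified mult.assoc])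
  also have "\<dots> = q * (q * (l' * x' * (k * g)))" by (metis mult.assoc q_central)
  also have "\<dots> = x' * g'" by (simp add: l'x' scalar_cancel mult.assoc g'_eq)
  finally have x: "g' * x' = x' * g'" .
  then show "e' * g' = g' * e'" unfolding e'_eq using k by (metis mult.assoc)
  have "g' * f' = l' * (p * (p * (f' * (k * g))))" by (simp add: g'_eq mult.assoc kg_f'[simplified mult.assoc])
  also have "\<dots> = p * (p * (l' * f' * (k * g)))" by (metis mult.assoc p_central)
  also have "\<dots> = f' * g'" by (simp add: l'f' scalar_cancel mult.assoc g'_eq)
  finally show "f' * g' = g' * f'" by simp
qed

lemma h'_cross: "l' * h' = h' * l'" "k' * h' = h' * k'" "e' * h' = h' * e'" "f' * h' = h' * f'"
  using commute_inverse[OF g'h', of l' l'] commute_inverse[OF g'h', of k' k']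
    commute_inverse[OF g'h', of e' e'] commute_inverse[OF g'h', of f' f'] g'_cross by auto

lemma g's': "g' * s' = p * p * s' * g'"
proof -
  have u_s: "u * s = s * u" by (simp add: u_def algebra_simps order)
  have "g' * s' = u * (g * s) * k'" by (simp add: g'_def s'_eq mult.assoc)
  also have "\<dots> = u * (p * (p * (s * g))) * k'" by (simp only: gs)
  also have "\<dots> = p * (p * (u * s * g * k'))" by (metis mult.assoc p_central)
  also have "\<dots> = p * (p * (s * (g' * k')))" by (simp add: u_s g'_def mult.assoc)
  also have "\<dots> = p * (p * (s * (k' * g')))" by (simp only: g'_cross)
  finally show ?thesis by (simp add: s'_eq mult.assoc)
qed

lemma s'g': "s' * g' = s * k * g"
proof -
  have "s' * g' = s * k * ((v * u) * g)" by (simp only: s'_def g'_def mult.assoc)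
  then show ?thesis using uv' by simp
qed

text \<open>The two sides are the coproduct of F for (strand, factor) and for (conjugated factor,
  conjugated strand): the R-matrix exchanges the coproduct and its opposite. \<open>l'h'\<close> and
  \<open>k'g'\<close> are the same fact for the inverse of K and for K.\<close>

lemma coproduct_F_pass: "f + s * l = s' + f' * h'"
proof -
  have "f' = (f + s * l) * g' - s' * g'"
    unfolding f'_eq s'g' by (simp add: g'_def mult.assoc)
  then have "f' * h' = (f + s * l) * (g' * h') - s' * (g' * h')"
    by (simp add: left_diff_distrib mult.assoc)
  then show ?thesis by (simp add: g'h')
qed

lemma l'h': "l' * h' = h * l"
proof -
  have "l' * h' = u * (l * h * v)" by (simp add: l'_def h'_def mult.assoc)
  also have "\<dots> = (u * v) * (l * h)" by (metis lh_v mult.assoc)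
  finally show ?thesis by (simp add: uv' cross)
qed

lemma k'g': "k' * g' = k * g"
proof -
  have "k' * g' = k * ((v * u) * g)" by (simp add: k'_def g'_def mult.assoc)
  then show ?thesis by (simp add: uv')
qed

interpretation P: pass q p e' f' k' l' g' h' s'
  using quad' g'h' g's' s'_cross g'_cross h'_cross by unfold_locales auto

lemmas order' = P.order

lemma tau_tau_coeff_L: "g * f * k + s * g = k' * s' * g' + f' * k'"
proof -
  have "(f + s * l) * (k * g) = (s' + f' * h') * (k' * g')"
    by (simp only: coproduct_F_pass k'g')
  moreover have "(f + s * l) * (k * g) = g * f * k + s * g"
    by (simp add: algebra_simps order)
  moreover have "(s' + f' * h') * (k' * g') = k' * s' * g' + f' * k'"
    by (simp add: algebra_simps order')
  ultimately show ?thesis by simp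
qed

lemma tau_tau_coeff_X: "p * p * p * g * f * f * k + p * p * p * s * s * g * l + (1 + p * p) * p * s * g * f
  = p * p * p * k' * s' * s' * g' + p * p * p * f' * f' * k' * h' + (1 + p * p) * p * f' * k' * s'"
proof -
  have "p * p * p * ((f + s * l) * (f + s * l) * (k * g)) = p * p * p * ((s' + f' * h') * (s' + f' * h') * (k' * g'))"
    by (simp only: coproduct_F_pass k'g')
  moreover have "p * p * p * ((f + s * l) * (f + s * l) * (k * g)) = 
     p * p * p * g * f * f * k + p * p * p * s * s * g * l + (1 + p * p) * p * s * g * f"
    by (simp add: algebra_simps order)
  moreover have "p * p * p * ((s' + f' * h') * (s' + f' * h') * (k' * g')) =
     p * p * p * k' * s' * s' * g' + p * p * p * f' * f' * k' * h' + (1 + p * p) * p * f' * k' * s'"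
    by (simp add: algebra_simps order')
  ultimately show ?thesis by simp
qed

text \<open>Yang-Baxter equation. Applying \<open>tau_tup\<close> for two adjacent positions amounts
  to applying it once with their coproduct, whose F is \<open>f + s * l\<close> and whose K is
  \<open>k * g\<close>. The exchanged conjugates have the same coproduct, so both sides agree
  coefficient by coefficient.\<close>

lemma tau_tau: "tau_tup p g h s (tau_tup p k l f T) = tau_tup p k' l' f' (tau_tup p g' h' s' T)"
proof -
  obtain x y z w where T: "T = (x, y, z, w)" by (cases T)
  have X: "h * (l * x) = l' * (h' * x)"
    by (simp add: l'h' mult.assoc[symmetric])
  have "(f + s * l) * x = (s' + f' * h') * x" by (simp only: coproduct_F_pass)
  then have Z: "z - p * f * x - p * s * (l * x) = z - p * s' * x - p * f' * (h' * x)"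
    by (simp add: algebra_simps flip: distrib_left)
  have "g * (k * y - p * p * p * f * f * k * x + (1 + p * p) * f * k * z - p * f * k * w)
      - p * p * p * s * s * g * (l * x) + (1 + p * p) * s * g * (z - p * f * x) - p * s * g * w
    = (k * g) * y - (p * p * p * g * f * f * k + p * p * p * s * s * g * l + (1 + p * p) * p * s * g * f) * x
     + (1 + p * p) * (g * f * k + s * g) * z - p * (g * f * k + s * g) * w"
    by (simp add: algebra_simps order)
  also have "\<dots> = (k' * g') * y - (p * p * p * k' * s' * s' * g' + p * p * p * f' * f' * k' * h' + (1 + p * p) * p * f' * k' * s') * x
     + (1 + p * p) * (k' * s' * g' + f' * k') * z - p * (k' * s' * g' + f' * k') * w"
    by (simp only: tau_tau_coeff_L tau_tau_coeff_X k'g')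
  also have "\<dots> = k' * (g' * y - p * p * p * s' * s' * g' * x + (1 + p * p) * s' * g' * z - p * s' * g' * w)
      - p * p * p * f' * f' * k' * (h' * x) + (1 + p * p) * f' * k' * (z - p * s' * x) - p * f' * k' * w"
    by (simp add: algebra_simps order')
  finally show ?thesis using X Z by (simp add: T)
qed

lemma p_v: "v * p = p * v" "v * (p * z) = p * (v * z)" using p_central[of v] by (auto simp: mult.assoc[symmetric])
lemma l's': "l' * s' = s"
  by (metis P.lf l'k'(1) mult.assoc mult_1 s'_eq s_k')

lemma e's'g'_eq: "p * e' * s' * g' = k' - k"
proof -
  have "e' * s' * g' = h * e * (v * s) * k * g" by (simp add: e'_def mult.assoc s'g'[simplified mult.assoc])
  also have "\<dots> = h * e * s * (v * (k * g))" by (simp add: s_v[symmetric] mult.assoc)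
  also have "\<dots> = (h * e * s * k * g) * v" by (simp add: kg_v[symmetric] mult.assoc)
  also have "h * e * s * k * g = k * s * e" by (simp add: algebra_simps order)
  finally have "p * e' * s' * g' = p * (k * (s * (e * v)))" by (simp add: mult.assoc)
  also have "\<dots> = k * (1 - u) * v" by (simp add: u_def mult.assoc p_central[of k, THEN assoc_rule])
  also have "\<dots> = k * v - k * (u * v)" by (simp add: algebra_simps)
  finally show ?thesis by (simp add: uv' k'_def)
qed

lemma e's's'g'_eq: "p * p * p * e' * s' * s' * g' = (k' - k) * s'"
proof -
  have "p * p * p * e' * s' * s' * g' = p * e' * s' * g' * s'" by (simp add: algebra_simps order')
  then show ?thesis by (simp only: e's'g'_eq)
qed

lemma u_k: "u * k = (1 - p * p) * k + p * p * k * u"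
  by (simp add: u_def algebra_simps order)

lemma l'ks': "l' * k * s' = (1 - p * p) * s' + p * p * s * k"
proof -
  have us: "u * s = s * u" by (simp add: u_def algebra_simps order)
  have "l' * k * s' = u * (l * k) * s * k * v" by (simp add: l'_def s'_def mult.assoc)
  also have "\<dots> = s * (u * k) * v" using us by (simp add: kl mult.assoc)
  also have "\<dots> = (1 - p * p) * (s * k * v) + p * p * s * k * (u * v)"
    unfolding u_k by (simp add: algebra_simps order)
  finally show ?thesis by (simp add: uv' s'_def mult.assoc)
qed

text \<open>This is the coefficient of \<open>x\<close> in the Casimir component of
  \<open>tau_delta\<close>. Multiplication by \<open>l'\<close> from the left absorbs the inverse
  \<open>v\<close> and leaves a polynomial identity with value \<open>u * f\<close>; multiplication
  by \<open>k'\<close> then undoes it.\<close>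

lemma kf_eq: "k * f = k' * f' * h' - p * (C - (p + q) * k') * s' - p * p * p * e' * s' * s' * g'"
proof -
  have f'h': "f' * h' = f + s * l - s'" by (simp add: coproduct_F_pass)
  have "l' * (k' * f' * h' - p * (C - (p + q) * k') * s' - p * p * p * e' * s' * s' * g')
     = (l' * k') * (f' * h') - p * C * (l' * s') + (1 + p * p) * ((l' * k') * s') - (l' * k') * s' + l' * k * s'"
    unfolding e's's'g'_eq by (simp add: algebra_simps order' C'_eq[symmetric] l'k')
  also have "\<dots> = f + s * l - p * C * s + p * p * s * k"
    by (simp add: l'k' f'h' l's' l'ks'[unfolded mult.assoc] algebra_simps)
  also have "\<dots> = u * f" by (simp add: C_def u_def algebra_simps order)
  also have "\<dots> = l' * (k * f)" by (simp add: l'_def mult.assoc kl(2)[THEN assoc_rule])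
  finally have "k' * (l' * (k * f)) = k' * (l' * (k' * f' * h' - p * (C - (p + q) * k') * s' - p * p * p * e' * s' * s' * g'))"
    by simp
  then show ?thesis by (simp only: l'k'(2)[THEN assoc_rule] mult_1)
qed

lemma h_eq: "h = h' - p * e' * l' * s'"
proof -
  have "h * (1 - p * s * e) * v = h' - p * h * e * (v * s)"
    by (simp add: h'_def s_v[symmetric] e_v algebra_simps order p_v)
  moreover have "p * e' * l' * s' = p * h * e * (v * s)"
    by (simp add: e'_def mult.assoc l's')
  moreover have "h * (1 - p * s * e) * v = h" using uv(1) by (simp add: mult.assoc)
  ultimately show ?thesis by simp
qed

lemma fs_eq: "p * p * p * s * s * g + p * s * g * k * f = p * f' * s' + p * p * p * s' * s' * g'"
proof -
  have "p * f' * s' + p * p * p * s' * s' * g' = p * p * p * (s' + f' * h') * (s' * g')"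
    by (simp add: algebra_simps order')
  also have "\<dots> = p * p * p * (f + s * l) * (s * k * g)" by (simp only: coproduct_F_pass s'g')
  also have "\<dots> = p * p * p * s * s * g + p * s * g * k * f" by (simp add: algebra_simps order)
  finally show ?thesis by simp
qed

text \<open>Hexagon relation: moving the strand past two factors merged by the coproduct is moving
  it past one after the other. Both sides are linear in the tuple, so the four components
  \<open>X\<close>, \<open>Y\<close>, \<open>Z\<close>, \<open>L\<close> reduce to identities
  between coefficients.\<close>

lemma tau_delta: "tau_tup p g h s (delta_tup q e f k l T) = delta_tup q e' f' k' l' (tau_tup p g' h' s' T)"
proof -
  obtain x y z w where T: "T = (x, y, z, w)" by (cases T)
  have hx: "h * x = (h' - p * e' * l' * s') * x" by (simp only: h_eq[symmetric])
  have X: "h * (e * l * z + x) = e' * l' * (z - p * s' * x) + h' * x"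
    using hx e'l' by (simp add: x'_def algebra_simps order order')
  have ls: "l' * (p * (s' * x)) = p * (s * x)"
    by (metis l's' mult.assoc p_central)
  have Z: "l * z - p * s * (e * l * z + x) = l' * (z - p * s' * x)"
    by (simp add: right_diff_distrib mult.assoc ls) (simp add: l'_def u_def algebra_simps)
  have es_eq: "(1 + p * p) * e' * s' * g' = (q + p) * (k' - k)"
    unfolding e's'g'_eq[symmetric] by (simp add: algebra_simps scalar_cancel)
  have L: "(e * f - q * k + q * l) * z + k * w + e * y + k * f * x = 
    (e' * f' - q * k' + q * l') * (z - p * s' * x) + k' * w
     + e' * (g' * y - p * p * p * s' * s' * g' * x + (1 + p * p) * s' * g' * z - p * s' * g' * w) + k' * f' * (h' * x)"
  proof -
    have eg: "e' * g' = e"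
    proof -
      have "e' * g' = h * e * (v * u) * g" by (simp add: e'_def g'_def mult.assoc)
      then show ?thesis by (simp add: uv' algebra_simps order)
    qed
    have "(e' * f' - q * k' + q * l') * (z - p * s' * x) + k' * w
     + e' * (g' * y - p * p * p * s' * s' * g' * x + (1 + p * p) * s' * g' * z - p * s' * g' * w) + k' * f' * (h' * x)
     = (C - (p + q) * k' + (1 + p * p) * e' * s' * g') * z + (k' - p * e' * s' * g') * w + (e' * g') * y
       + (k' * f' * h' - p * (C - (p + q) * k') * s' - p * p * p * e' * s' * s' * g') * x"
      by (simp add: C'_eq[symmetric] algebra_simps order')
    also have "\<dots> = (C - (p + q) * k' + (q + p) * (k' - k)) * z + k * w + e * y + k * f * x"
      by (simp only: kf_eq[symmetric] es_eq e's'g'_eq eg) simp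
    also have "\<dots> = (e * f - q * k + q * l) * z + k * w + e * y + k * f * x"
      by (simp add: C_def algebra_simps)
    finally show ?thesis by simp
  qed
  have Y: "g * (f * z + y) - p * p * p * s * s * g * (e * l * z + x) + (1 + p * p) * s * g * (l * z)
     - p * s * g * ((e * f - q * k + q * l) * z + k * w + e * y + k * f * x)
    = f' * (z - p * s' * x) + (g' * y - p * p * p * s' * s' * g' * x + (1 + p * p) * s' * g' * z - p * s' * g' * w)"
  proof -
    have "f' * (z - p * s' * x) + (g' * y - p * p * p * s' * s' * g' * x + (1 + p * p) * s' * g' * z - p * s' * g' * w)
      = (f' + (1 + p * p) * (s' * g')) * z + g' * y - (p * f' * s' + p * p * p * s' * s' * g') * x - p * (s' * g') * w"
      by (simp add: algebra_simps order')
    also have "\<dots> = (f' + (1 + p * p) * (s * k * g)) * z + g' * y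
       - (p * p * p * s * s * g + p * s * g * k * f) * x - p * (s * k * g) * w"
      by (simp only: fs_eq s'g')
    also have "\<dots> = g * (f * z + y) - p * p * p * s * s * g * (e * l * z + x) + (1 + p * p) * s * g * (l * z)
     - p * s * g * ((e * f - q * k + q * l) * z + k * w + e * y + k * f * x)"
      by (simp add: f'_def g'_def C_def u_def algebra_simps order)
    finally show ?thesis by simp
  qed
  show ?thesis using X Y Z L by (simp add: T)
qed

end

section \<open>Evaluation of expressions in rings, and a universal ring for the presented
  algebras\<close>

primrec ev :: "('k \<Rightarrow> 'a::ring_1) \<Rightarrow> ('l \<Rightarrow> 'a) \<Rightarrow> ('l, 'k) expr \<Rightarrow> 'a" where
  "ev sc \<rho> (Gen l) = \<rho> l"
| "ev sc \<rho> (Scal c) = sc c"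
| "ev sc \<rho> (Add x y) = ev sc \<rho> x + ev sc \<rho> y"
| "ev sc \<rho> (Mul x y) = ev sc \<rho> x * ev sc \<rho> y"

lemma ev_subst: "ev sc \<rho> (subst f x) = ev sc (\<lambda>l. ev sc \<rho> (f l)) x"
  by (induction x) auto

lemma ev_cong: "(\<And>l. l \<in> letters x \<Longrightarrow> \<rho> l = \<rho>' l) \<Longrightarrow> ev sc \<rho> x = ev sc \<rho>' x"
  by (induction x) auto

lemma subst_cong: "(\<And>l. l \<in> letters x \<Longrightarrow> f l = g l) \<Longrightarrow> subst f x = subst g x"
  by (induction x) auto

lemma subst_subst: "subst f (subst g x) = subst (\<lambda>l. subst f (g l)) x"
  by (induction x) auto

lemma letters_subst: "letters (subst f x) = (\<Union>l\<in>letters x. letters (f l))"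
  by (induction x) auto

locale scalar_map =
  fixes sc :: "'k::field \<Rightarrow> 'a::ring_1"
  assumes sc_add: "sc (a + b) = sc a + sc b" and sc_mult: "sc (a * b) = sc a * sc b"
    and sc_1: "sc 1 = 1" and sc_central: "sc a * x = x * sc a"
begin

lemma sc_0: "sc 0 = 0" using sc_add[of 0 0] by simp
lemma sc_minus: "sc (- a) = - sc a" using sc_add[of a "- a"] by (simp add: sc_0 eq_neg_iff_add_eq_0 add.commute)
lemma sc_diff: "sc (a - b) = sc a - sc b" using sc_add[of a "- b"] by (simp add: sc_minus)
lemma sc_inverse: "a \<noteq> 0 \<Longrightarrow> sc a * sc (inverse a) = 1" "a \<noteq> 0 \<Longrightarrow> sc (inverse a) * sc a = 1"
  by (auto simp: sc_1 simp flip: sc_mult)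

lemma ev_sub: "ev sc \<rho> (sub x y) = ev sc \<rho> x - ev sc \<rho> y"
  by (simp add: sub_def sc_minus sc_1)
lemma ev_smul: "ev sc \<rho> (smul c x) = sc c * ev sc \<rho> x"
  by (simp add: smul_def)

lemma ev_alg_eq:
  assumes "alg_eq R x y" and R: "\<And>x y. (x, y) \<in> R \<Longrightarrow> ev sc \<rho> x = ev sc \<rho> y"
  shows "ev sc \<rho> x = ev sc \<rho> y"
  using assms(1)
  by (induction rule: alg_eq.induct)
    (use R in \<open>auto simp: algebra_simps sc_0 sc_minus sc_add sc_mult sc_1 intro: sc_central\<close>)

lemma ev_commute:
  assumes "\<And>l. l \<in> letters x \<Longrightarrow> \<rho> l * y = y * \<rho> l"
  shows "ev sc \<rho> x * y = y * ev sc \<rho> x"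
  using assms
proof (induction x)
  case (Add x1 x2) then show ?case by (simp add: algebra_simps)
next
  case (Mul x1 x2) then show ?case by simp (metis mult.assoc)
qed (auto simp: sc_central)

end

text \<open>The product, over all sets of relations, of the algebras they present: the individual algebras depend
  on terms and are not types.\<close>

quotient_type (overloaded) ('l, 'k) alg = "(('l, 'k) expr \<times> ('l, 'k) expr) set \<Rightarrow> ('l, 'k::field) expr" /
  "\<lambda>f g. \<forall>R. alg_eq R (f R) (g R)"
  by (rule equivpI) (auto simp: reflp_def symp_def transp_def intro: alg_eq.intros)

text \<open>The class \<open>ring_1\<close> demands \<open>0 \<noteq> 1\<close>. In the product ring
  one nontrivial component is enough; the free algebra is one, since it maps to the field.\<close>

lemma not_alg_eq_0_1: "\<not> alg_eq {} (Scal (0::'k::field)) (Scal 1 :: ('l, 'k) expr)"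
proof
  interpret scalar_map "id :: 'k \<Rightarrow> 'k" by standard auto
  assume "alg_eq {} (Scal (0::'k::field)) (Scal 1 :: ('l, 'k) expr)"
  from ev_alg_eq[OF this, of "\<lambda>_. 0"] show False by simp
qed

lemma alg_eq_neg: "alg_eq R (Add (Mul (Scal (-1)) x) x) (Scal 0)"
  by (meson alg_eq.add_comm alg_eq.add_neg alg_eq.trans)

instantiation alg :: (type, field) ring_1
begin
lift_definition zero_alg :: "('a, 'b) alg" is "\<lambda>_. Scal 0" .
lift_definition one_alg :: "('a, 'b) alg" is "\<lambda>_. Scal 1" .
lift_definition plus_alg :: "('a, 'b) alg \<Rightarrow> ('a, 'b) alg \<Rightarrow> ('a, 'b) alg" is "\<lambda>f g R. Add (f R) (g R)"
  by (auto intro: alg_eq.add_cong)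
lift_definition times_alg :: "('a, 'b) alg \<Rightarrow> ('a, 'b) alg \<Rightarrow> ('a, 'b) alg" is "\<lambda>f g R. Mul (f R) (g R)"
  by (auto intro: alg_eq.mul_cong)
lift_definition uminus_alg :: "('a, 'b) alg \<Rightarrow> ('a, 'b) alg" is "\<lambda>f R. Mul (Scal (-1)) (f R)"
  by (auto intro: alg_eq.mul_cong alg_eq.refl)
lift_definition minus_alg :: "('a, 'b) alg \<Rightarrow> ('a, 'b) alg \<Rightarrow> ('a, 'b) alg" is "\<lambda>f g R. Add (f R) (Mul (Scal (-1)) (g R))"
  by (auto intro: alg_eq.mul_cong alg_eq.add_cong alg_eq.refl)
instance
proof
  fix a b c :: "('a, 'b) alg"
  show "a + b + c = a + (b + c)" by transfer (auto intro: alg_eq.intros)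
  show "a + b = b + a" by transfer (auto intro: alg_eq.add_comm)
  show "0 + a = a" by transfer (auto intro: alg_eq.add_zero)
  show "- a + a = 0" by transfer (auto intro: alg_eq_neg)
  show "a - b = a + - b" by transfer (simp add: alg_eq.refl)
  show "a * b * c = a * (b * c)" by transfer (auto intro: alg_eq.mul_assoc)
  show "1 * a = a" by transfer (auto intro: alg_eq.mul_one_l)
  show "a * 1 = a" by transfer (auto intro: alg_eq.mul_one_r)
  show "(a + b) * c = a * c + b * c" by transfer (auto intro: alg_eq.distrib_r)
  show "a * (b + c) = a * b + a * c" by transfer (auto intro: alg_eq.distrib_l)
  show "(0::('a, 'b) alg) \<noteq> 1" by transfer (use not_alg_eq_0_1 in blast)
qed
end

lift_definition alg_scal :: "'k::field \<Rightarrow> ('l, 'k) alg" is "\<lambda>c _. Scal c" .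

interpretation alg: scalar_map alg_scal
proof
  fix a b :: "'k::field" and x :: "('l, 'k) alg"
  show "alg_scal (a + b) = (alg_scal a + alg_scal b :: ('l, 'k) alg)" by transfer (auto intro: alg_eq.intros)
  show "alg_scal (a * b) = (alg_scal a * alg_scal b :: ('l, 'k) alg)" by transfer (auto intro: alg_eq.intros)
  show "alg_scal 1 = (1 :: ('l, 'k) alg)" by transfer (auto intro: alg_eq.intros)
  show "alg_scal a * x = x * alg_scal a" by transfer (auto intro: alg_eq.intros)
qed

text \<open>Every component other than \<open>R\<close> receives the counit, so that the relations hold in all of them.\<close>
definition counit_letter :: "nat \<times> gen \<Rightarrow> (nat \<times> gen, 'k::field) expr" where
  "counit_letter l = Scal (case snd l of E \<Rightarrow> 0 | F \<Rightarrow> 0 | K \<Rightarrow> 1 | Ki \<Rightarrow> 1)"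

lift_definition generic :: "((nat \<times> gen, 'k) expr \<times> (nat \<times> gen, 'k) expr) set \<Rightarrow> nat \<times> gen \<Rightarrow> (nat \<times> gen, 'k::field) alg"
  is "\<lambda>R l R'. if R' = R then Gen l else counit_letter l" .

lemma rep_abs_alg: "alg_eq R (rep_alg (abs_alg f) R) (f R)"
  using Quotient3_rep_abs[OF Quotient3_alg, of f] by (simp add: alg_eq.refl)

lemma rep_ev:
  fixes \<rho> :: "'l \<Rightarrow> ('m, 'k::field) alg"
  shows "alg_eq R (rep_alg (ev alg_scal \<rho> x) R) (subst (\<lambda>l. rep_alg (\<rho> l) R) x)"
proof (induction x)
  case (Gen l) show ?case by (simp add: alg_eq.refl)
next
  case (Scal c) show ?case
    using rep_abs_alg[of R "\<lambda>_. Scal c"] by (simp add: alg_scal_def)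
next
  case (Add x y)
  have "alg_eq R (rep_alg (ev alg_scal \<rho> x + ev alg_scal \<rho> y) R)
     (Add (rep_alg (ev alg_scal \<rho> x) R) (rep_alg (ev alg_scal \<rho> y) R))"
    using rep_abs_alg[of R "\<lambda>R. Add (rep_alg (ev alg_scal \<rho> x) R) (rep_alg (ev alg_scal \<rho> y) R)"]
    by (simp add: plus_alg_def)
  then show ?case using Add by (auto intro: alg_eq.trans alg_eq.add_cong)
next
  case (Mul x y)
  have "alg_eq R (rep_alg (ev alg_scal \<rho> x * ev alg_scal \<rho> y) R)
     (Mul (rep_alg (ev alg_scal \<rho> x) R) (rep_alg (ev alg_scal \<rho> y) R))"
    using rep_abs_alg[of R "\<lambda>R. Mul (rep_alg (ev alg_scal \<rho> x) R) (rep_alg (ev alg_scal \<rho> y) R)"]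
    by (simp add: times_alg_def)
  then show ?case using Mul by (auto intro: alg_eq.trans alg_eq.mul_cong)
qed

lemma alg_eq_subst_cong: "(\<And>l. alg_eq R (f l) (g l)) \<Longrightarrow> alg_eq R (subst f x) (subst g x)"
  by (induction x) (auto intro: alg_eq.intros)

lemma rep_generic: "alg_eq R' (rep_alg (generic R l) R') (if R' = R then Gen l else counit_letter l)"
  using rep_abs_alg[of R' "\<lambda>R'. if R' = R then Gen l else counit_letter l"] by (simp add: generic_def id_def)

lemma rep_ev_generic:
  "alg_eq R' (rep_alg (ev alg_scal (generic R) x) R') (if R' = R then x else subst counit_letter x)"
proof -
  have "subst Gen x = x" by (induction x) auto
  moreover have "alg_eq R' (subst (\<lambda>l. rep_alg (generic R l) R') x)
      (subst (\<lambda>l. if R' = R then Gen l else counit_letter l) x)"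
    by (rule alg_eq_subst_cong) (rule rep_generic)
  ultimately show ?thesis
    using alg_eq.trans[OF rep_ev] by (smt (verit, best) subst_cong)
qed

text \<open>In the component \<open>R\<close>, the value of an expression at
  \<open>generic R\<close> is represented by the expression itself.\<close>

lemma alg_eq_generic: "ev alg_scal (generic R) x = ev alg_scal (generic R) y \<Longrightarrow> alg_eq R x y"
  using rep_ev_generic[of R R] alg_eq.sym alg_eq.trans by (metis (full_types))

section \<open>Families of generators\<close>

text \<open>A family stores the rescaled \<open>(q - q^-1)^2 E\<close>, while expressions speak of
  the original E. The factor is undone exactly when the letter \<open>E\<close> is
  evaluated.\<close>

definition unscale :: "('k::field \<Rightarrow> 'a::ring_1) \<Rightarrow> 'k \<Rightarrow> (nat \<Rightarrow> gen \<Rightarrow> 'a) \<Rightarrow> nat \<times> gen \<Rightarrow> 'a" where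
  "unscale sc q \<phi> = (\<lambda>(i, g). if g = E then sc (inverse ((q - inverse q)^2)) * \<phi> i E else \<phi> i g)"

definition uq_family :: "('k::field \<Rightarrow> 'a::ring_1) \<Rightarrow> 'k \<Rightarrow> nat \<Rightarrow> (nat \<Rightarrow> gen \<Rightarrow> 'a) \<Rightarrow> bool" where
  "uq_family sc q n \<phi> \<longleftrightarrow>
     (\<forall>i\<in>{1..n}. uq_quad (sc q) (sc (inverse q)) (\<phi> i E) (\<phi> i F) (\<phi> i K) (\<phi> i Ki)) \<and>
     (\<forall>i\<in>{1..n}. \<forall>j\<in>{1..n}. i \<noteq> j \<longrightarrow> (\<forall>x y. \<phi> i x * \<phi> j y = \<phi> j y * \<phi> i x))"

fun ir_letter :: "('k::field \<Rightarrow> 'a::ring_1) \<Rightarrow> 'k \<Rightarrow> (nat \<Rightarrow> gen \<Rightarrow> 'a) \<Rightarrow> 'a \<times> 'a \<times> 'a \<times> 'a \<Rightarrow> (nat \<times> gen) + irgen \<Rightarrow> 'a" where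
  "ir_letter sc q \<phi> T (Inl l) = unscale sc q \<phi> l"
| "ir_letter sc q \<phi> (x, y, z, w) (Inr IEKi) = sc (inverse ((q - inverse q)^2)) * x"
| "ir_letter sc q \<phi> (x, y, z, w) (Inr IF) = y"
| "ir_letter sc q \<phi> (x, y, z, w) (Inr IKi) = z"
| "ir_letter sc q \<phi> (x, y, z, w) (Inr IL) = w"

definition tup :: "('k::field \<Rightarrow> 'a::ring_1) \<Rightarrow> 'k \<Rightarrow> (gen \<Rightarrow> 'a) \<Rightarrow> 'a \<times> 'a \<times> 'a \<times> 'a" where
  "tup sc q \<theta> = (\<theta> E * \<theta> Ki, \<theta> F, \<theta> Ki, \<theta> E * \<theta> F + sc (inverse q) * \<theta> K + sc q * \<theta> Ki)"

abbreviation tau_act where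
  "tau_act sc q \<theta> \<equiv> tau_tup (sc (inverse q)) (\<theta> K) (\<theta> Ki) (\<theta> F)"
abbreviation delta_act where
  "delta_act sc q \<theta> \<equiv> delta_tup (sc q) (\<theta> E) (\<theta> F) (\<theta> K) (\<theta> Ki)"

text \<open>The second factor stays symbolic, as generators of I_R, instead of being expanded at
  position \<open>p + 1\<close>. Hence the maps can be iterated without choosing a preimage in I_R
  after each step.\<close>

fun tau_lift :: "'k::field \<Rightarrow> nat \<Rightarrow> (nat \<times> gen) + irgen \<Rightarrow> ((nat \<times> gen) + irgen, 'k) expr" where
  "tau_lift q p (Inl l) = Gen (Inl l)"
| "tau_lift q p (Inr IEKi) = Mul (Gen (Inl (p, Ki))) (Gen (Inr IEKi))"
| "tau_lift q p (Inr IF) =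
     sub (Add (sub (Mul (Gen (Inl (p, K))) (Gen (Inr IF)))
                   (smul (inverse q ^ 3 * (q - inverse q)^2)
                         (Mul (Mul (Mul (Gen (Inl (p, F))) (Gen (Inl (p, F)))) (Gen (Inl (p, K)))) (Gen (Inr IEKi)))))
              (smul (inverse q * (q + inverse q)) (Mul (Mul (Gen (Inl (p, F))) (Gen (Inl (p, K)))) (Gen (Inr IKi)))))
         (smul (inverse q) (Mul (Mul (Gen (Inl (p, F))) (Gen (Inl (p, K)))) (Gen (Inr IL))))"
| "tau_lift q p (Inr IKi) =
     sub (Gen (Inr IKi)) (smul (inverse q * (q - inverse q)^2) (Mul (Gen (Inl (p, F))) (Gen (Inr IEKi))))"
| "tau_lift q p (Inr IL) = Gen (Inr IL)"

text \<open>In the image of \<open>\<Lambda>\<close> the summand with K in both factors has no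
  place, as K is not in I_R. It is absorbed into K tensor \<open>\<Lambda>\<close>, at the price of
  the term \<open>- q K\<close> in front of \<open>IKi\<close>.\<close>

fun delta_lift :: "'k::field \<Rightarrow> nat \<Rightarrow> (nat \<times> gen) + irgen \<Rightarrow> ((nat \<times> gen) + irgen, 'k) expr" where
  "delta_lift q p (Inl l) = Gen (Inl l)"
| "delta_lift q p (Inr IEKi) = Add (Mul (Mul (Gen (Inl (p, E))) (Gen (Inl (p, Ki)))) (Gen (Inr IKi))) (Gen (Inr IEKi))"
| "delta_lift q p (Inr IF) = Add (Mul (Gen (Inl (p, F))) (Gen (Inr IKi))) (Gen (Inr IF))"
| "delta_lift q p (Inr IKi) = Mul (Gen (Inl (p, Ki))) (Gen (Inr IKi))"
| "delta_lift q p (Inr IL) =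
     Add (Add (Add
       (Mul (Add (sub (smul ((q - inverse q)^2) (Mul (Gen (Inl (p, E))) (Gen (Inl (p, F)))))
                      (smul q (Gen (Inl (p, K))))) (smul q (Gen (Inl (p, Ki))))) (Gen (Inr IKi)))
       (Mul (Gen (Inl (p, K))) (Gen (Inr IL))))
       (smul ((q - inverse q)^2) (Mul (Gen (Inl (p, E))) (Gen (Inr IF)))))
       (smul ((q - inverse q)^2) (Mul (Mul (Gen (Inl (p, K))) (Gen (Inl (p, F)))) (Gen (Inr IEKi))))"

text \<open>\<open>\<Lambda>\<^sub>A\<close> is the value of \<open>chain q A (Max A)\<close>. Starting at position 1 instead of \<open>Min A\<close> is harmless, since
  \<open>\<tau>\<^sub>R(\<Lambda>) = 1 \<otimes> \<Lambda>\<close>; only \<open>A \<inter> {1..<p}\<close> matters for \<open>chain q A p\<close>.\<close>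

fun chain :: "'k::field \<Rightarrow> nat set \<Rightarrow> nat \<Rightarrow> ((nat \<times> gen) + irgen, 'k) expr" where
  "chain q A 0 = Gen (Inr IL)"
| "chain q A (Suc p) = (if p = 0 then Gen (Inr IL)
     else subst (if p \<in> A then delta_lift q p else tau_lift q p) (chain q A p))"

abbreviation irev where "irev sc q \<phi> T \<equiv> ev sc (ir_letter sc q \<phi> T)"

lemma lift_letters:
  "Inl (j, h) \<in> letters (tau_lift q p l) \<Longrightarrow> l = Inl (j, h) \<or> j = p"
  "Inl (j, h) \<in> letters (delta_lift q p l) \<Longrightarrow> l = Inl (j, h) \<or> j = p"
  by (cases "(q, p, l)" rule: tau_lift.cases; auto simp: sub_def smul_def)+

lemma chain_letters: "Inl (j, h) \<in> letters (chain q A p) \<Longrightarrow> 1 \<le> j \<and> j < p"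
proof (induction p)
  case (Suc p)
  then have "p \<noteq> 0" by (cases "p = 0") auto
  with Suc.prems obtain l where l: "l \<in> letters (chain q A p)"
    "Inl (j, h) \<in> letters ((if p \<in> A then delta_lift q p else tau_lift q p) l)"
    by (auto simp: letters_subst split: if_splits)
  then have "l = Inl (j, h) \<or> j = p"
    using lift_letters[of j h q p l] by (simp split: if_splits)
  then show ?case using Suc.IH l(1) \<open>p \<noteq> 0\<close> by auto
qed simp

lemma chain_cong: "(\<And>i. 1 \<le> i \<Longrightarrow> i < p \<Longrightarrow> i \<in> A \<longleftrightarrow> i \<in> B) \<Longrightarrow> chain q A p = chain q B p"
  by (induction p) auto

definition below :: "nat \<Rightarrow> ((nat \<times> gen) + irgen, 'k) expr \<Rightarrow> bool" where
  "below p x \<longleftrightarrow> (\<forall>j h. Inl (j, h) \<in> letters x \<longrightarrow> 1 \<le> j \<and> j < p)"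

lemma below_chain: "below p (chain q A p)"
  unfolding below_def using chain_letters by blast

lemma irev_below_cong:
  assumes "below p x" "\<And>i h. 1 \<le> i \<Longrightarrow> i < p \<Longrightarrow> \<phi> i h = \<psi> i h"
  shows "irev sc q \<phi> T x = irev sc q \<psi> T x"
proof (rule ev_cong)
  fix l assume l: "l \<in> letters x"
  show "ir_letter sc q \<phi> T l = ir_letter sc q \<psi> T l"
  proof (cases l)
    case (Inl m)
    then obtain j h where m: "l = Inl (j, h)" by (cases m) auto
    then have "1 \<le> j" "j < p" using assms(1) l unfolding below_def by blast+
    then show ?thesis using assms(2) m by (simp add: unscale_def)
  next
    case (Inr i)
    then show ?thesis by (cases T; cases i) auto
  qed
qed

lemmas irev_cong = irev_below_cong[OF below_chain]

locale uq_scalars = scalar_map sc for sc :: "'k::field \<Rightarrow> 'a::ring_1" +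
  fixes q :: 'k
  assumes q0: "q \<noteq> 0" and q2: "q * q \<noteq> 1"
begin

lemma q_diff: "q - inverse q \<noteq> 0"
  using q0 q2 by (metis right_inverse right_minus_eq)

sublocale scalars "sc q" "sc (inverse q)"
  by standard (rule sc_central[symmetric] sc_inverse[OF q0])+

lemma sc_cancel: "a \<noteq> 0 \<Longrightarrow> sc a * x = sc a * y \<longleftrightarrow> x = y"
proof
  assume a: "a \<noteq> 0" and "sc a * x = sc a * y"
  then have "sc (inverse a) * (sc a * x) = sc (inverse a) * (sc a * y)" by simp
  then show "x = y" by (simp add: sc_inverse[OF a, THEN assoc_rule])
qed simp

abbreviation "c \<equiv> (q - inverse q)^2"

lemma sc_move: "x * (sc a * y) = sc a * (x * y)"
  using arg_cong[OF sc_central[of a x], of "\<lambda>z. z * y"] by (simp only: mult.assoc)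

lemmas c_move = sc_move[where a = "inverse c"]

lemma c: "sc (inverse c) * (sc c * x) = x" "sc c * (sc (inverse c) * x) = x" "sc c * sc (inverse c) = 1"
  "x * (sc c * (sc (inverse c) * y)) = x * y"
proof -
  have "c \<noteq> 0" using q_diff by simp
  note i = sc_inverse[OF this]
  show "sc (inverse c) * (sc c * x) = x" "sc c * (sc (inverse c) * x) = x" "sc c * sc (inverse c) = 1"
    "x * (sc c * (sc (inverse c) * y)) = x * y"
    using i[THEN assoc_rule] i by simp_all
qed

text \<open>Substitution at position \<open>p\<close> becomes a matrix acting on the tuple of the
  second factor, so a chain is evaluated from its last position backwards. The powers of
  \<open>q - q^-1\<close> cancel against the rescaling of E.\<close>

lemma irev_tau:
  "irev sc q \<phi> T (subst (tau_lift q p) x) = irev sc q \<phi> (tau_act sc q (\<phi> p) T) x"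
proof -
  obtain x y z w where T: "T = (x, y, z, w)" by (cases T)
  have "ev sc (ir_letter sc q \<phi> T) (tau_lift q p l) = ir_letter sc q \<phi> (tau_act sc q (\<phi> p) T) l" for l
  proof (cases "(q, p, l)" rule: tau_lift.cases)
    case (3 q' p')
    have "sc (inverse q ^ 3 * c) * (\<phi> p F * \<phi> p F * \<phi> p K * (sc (inverse c) * x))
      = sc (inverse q ^ 3) * (sc c * (sc (inverse c) * (\<phi> p F * \<phi> p F * \<phi> p K * x)))"
      by (simp only: c_move sc_mult mult.assoc)
    also have "sc c * (sc (inverse c) * (\<phi> p F * \<phi> p F * \<phi> p K * x)) = \<phi> p F * \<phi> p F * \<phi> p K * x"
      by (rule c)
    finally have "sc (inverse q ^ 3 * c) * (\<phi> p F * \<phi> p F * \<phi> p K * (sc (inverse c) * x))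
      = sc (inverse q) * sc (inverse q) * sc (inverse q) * \<phi> p F * \<phi> p F * \<phi> p K * x"
      by (simp only: sc_mult power3_eq_cube mult.assoc)
    moreover have "inverse q * (q + inverse q) = 1 + inverse q * inverse q"
      using q0 by (simp add: distrib_left)
    then have "sc (inverse q * (q + inverse q)) = 1 + sc (inverse q) * sc (inverse q)"
      by (simp only: sc_add sc_mult sc_1)
    ultimately show ?thesis using 3
      by (simp add: T ev_sub ev_smul unscale_def mult.assoc sc_mult)
  next
    case (4 q' p')
    have "sc (inverse q * c) * (\<phi> p F * (sc (inverse c) * x)) = sc (inverse q) * (sc c * (sc (inverse c) * (\<phi> p F * x)))"
      by (simp only: c_move sc_mult mult.assoc)
    then show ?thesis using 4
      by (simp add: T ev_sub ev_smul unscale_def mult.assoc c)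
  qed (auto simp: T unscale_def c_move)
  then show ?thesis by (simp add: ev_subst)
qed

lemma irev_delta:
  "irev sc q \<phi> T (subst (delta_lift q p) x) = irev sc q \<phi> (delta_act sc q (\<phi> p) T) x"
proof -
  obtain x y z w where T: "T = (x, y, z, w)" by (cases T)
  have "ev sc (ir_letter sc q \<phi> T) (delta_lift q p l) = ir_letter sc q \<phi> (delta_act sc q (\<phi> p) T) l" for l
    by (cases "(q, p, l)" rule: delta_lift.cases)
      (simp_all add: T ev_sub ev_smul unscale_def mult.assoc c c_move distrib_left)
  then show ?thesis by (simp add: ev_subst)
qed

lemma irev_chain:
  "p \<ge> 1 \<Longrightarrow> irev sc q \<phi> T (chain q A (Suc p)) =
     irev sc q \<phi> (if p \<in> A then delta_act sc q (\<phi> p) T else tau_act sc q (\<phi> p) T) (chain q A p)"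
  by (simp add: irev_tau irev_delta)

lemma irev_chain_1: "irev sc q \<phi> T (chain q A (Suc 0)) = snd (snd (snd T))"
  by (cases T) simp

lemma ev_ir_eval:
  "ev sc (unscale sc q \<phi>) (subst (ir_eval q p) x) = irev sc q \<phi> (tup sc q (\<phi> p)) x"
proof -
  have "ev sc (unscale sc q \<phi>) (ir_eval q p l) = ir_letter sc q \<phi> (tup sc q (\<phi> p)) l" for l
    by (cases "(q, p, l)" rule: ir_eval.cases)
      (simp_all add: ev_smul tup_def EKi_def Cas_def unscale_def mult.assoc c)
  then show ?thesis by (simp add: ev_subst)
qed

text \<open>The rescaling of E is by an invertible scalar, so the two sets of relations are
  equivalent one by one. The forward direction yields soundness of evaluation; the converse shows
  that the generic letters form a family.\<close>

lemma uq_family_rel: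
  "uq_family sc q n \<phi> \<longleftrightarrow> (\<forall>x y. (x, y) \<in> uq_rels q n \<longrightarrow> ev sc (unscale sc q \<phi>) x = ev sc (unscale sc q \<phi>) y)"
proof -
  let ?ev = "ev sc (unscale sc q \<phi>)"
  have ic: "inverse c \<noteq> 0" using q_diff by simp
  have KE': "?ev (Mul (G i K) (G i E)) = ?ev (smul (q^2) (Mul (G i E) (G i K))) \<longleftrightarrow>
      \<phi> i K * \<phi> i E = sc q * sc q * \<phi> i E * \<phi> i K" for i
  proof -
    have "?ev (Mul (G i K) (G i E)) = sc (inverse c) * (\<phi> i K * \<phi> i E)"
      by (simp add: unscale_def c_move)
    moreover have "?ev (smul (q^2) (Mul (G i E) (G i K))) = sc (inverse c) * (sc q * sc q * \<phi> i E * \<phi> i K)"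
      by (simp add: ev_smul unscale_def power2_eq_square[of q] sc_mult mult.assoc c_move)
    ultimately show ?thesis by (simp only: sc_cancel[OF ic])
  qed
  have EF': "?ev (sub (Mul (G i E) (G i F)) (Mul (G i F) (G i E))) = ?ev (smul (inverse (q - inverse q)) (sub (G i K) (G i Ki))) \<longleftrightarrow>
      \<phi> i E * \<phi> i F - \<phi> i F * \<phi> i E = (sc q - sc (inverse q)) * (\<phi> i K - \<phi> i Ki)" for i
  proof -
    have "inverse (q - inverse q) = inverse c * (q - inverse q)"
      using q_diff by (simp add: power2_eq_square)
    then have "?ev (smul (inverse (q - inverse q)) (sub (G i K) (G i Ki)))
       = sc (inverse c) * ((sc q - sc (inverse q)) * (\<phi> i K - \<phi> i Ki))"
      by (simp add: ev_smul ev_sub unscale_def sc_diff sc_mult mult.assoc)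
    moreover have "?ev (sub (Mul (G i E) (G i F)) (Mul (G i F) (G i E))) = sc (inverse c) * (\<phi> i E * \<phi> i F - \<phi> i F * \<phi> i E)"
      by (simp add: ev_sub unscale_def mult.assoc c_move right_diff_distrib)
    ultimately show ?thesis by (simp only: sc_cancel[OF ic])
  qed
  have co: "?ev (Mul (G i g) (G j h)) = ?ev (Mul (G j h) (G i g)) \<longleftrightarrow> \<phi> i g * \<phi> j h = \<phi> j h * \<phi> i g" for i j g h
  proof -
    define a b where "a = (if g = E then inverse c else 1)" and "b = (if h = E then inverse c else 1)"
    have a: "unscale sc q \<phi> (i, g) = sc a * \<phi> i g" "unscale sc q \<phi> (j, h) = sc b * \<phi> j h"
      by (auto simp: a_def b_def unscale_def sc_1)
    have m: "sc a * x * (sc b * y) = sc (a * b) * (x * y)" for a b x y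
      by (simp only: sc_mult mult.assoc sc_move[of x b])
    have "?ev (Mul (G i g) (G j h)) = sc (a * b) * (\<phi> i g * \<phi> j h)" "?ev (Mul (G j h) (G i g)) = sc (a * b) * (\<phi> j h * \<phi> i g)"
      by (simp_all only: ev.simps a m mult.commute[of b a])
    moreover have "a * b \<noteq> 0" using q_diff by (auto simp: a_def b_def)
    ultimately show ?thesis using sc_cancel[of "a * b"] by simp
  qed
  have KF': "?ev (Mul (G i K) (G i F)) = ?ev (smul (inverse q ^ 2) (Mul (G i F) (G i K))) \<longleftrightarrow>
      \<phi> i K * \<phi> i F = sc (inverse q) * sc (inverse q) * \<phi> i F * \<phi> i K" for i
    by (simp add: ev_smul unscale_def power2_eq_square[of "inverse q"] sc_mult mult.assoc del: power_inverse)
  have KK: "?ev (Mul (G i K) (G i Ki)) = ?ev (Scal 1) \<longleftrightarrow> \<phi> i K * \<phi> i Ki = 1"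
    "?ev (Mul (G i Ki) (G i K)) = ?ev (Scal 1) \<longleftrightarrow> \<phi> i Ki * \<phi> i K = 1" for i
    by (simp_all add: unscale_def sc_1)
  show ?thesis
  proof
    assume f: "uq_family sc q n \<phi>"
    then have quad: "uq_quad (sc q) (sc (inverse q)) (\<phi> i E) (\<phi> i F) (\<phi> i K) (\<phi> i Ki)" if "i \<in> {1..n}" for i
      using that unfolding uq_family_def by blast
    show "\<forall>x y. (x, y) \<in> uq_rels q n \<longrightarrow> ?ev x = ?ev y"
    proof (intro allI impI)
      fix x y assume "(x, y) \<in> uq_rels q n"
      then show "?ev x = ?ev y"
      proof cases
        case (KKi i)
        show ?thesis unfolding KKi(1,2) by (rule KK(1)[THEN iffD2]) (use quad[OF KKi(3)] in \<open>simp add: uq_quad_def\<close>)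
      next
        case (KiK i)
        show ?thesis unfolding KiK(1,2) by (rule KK(2)[THEN iffD2]) (use quad[OF KiK(3)] in \<open>simp add: uq_quad_def\<close>)
      next
        case (KE i)
        show ?thesis unfolding KE(1,2) by (rule KE'[THEN iffD2]) (use quad[OF KE(3)] in \<open>simp add: uq_quad_def\<close>)
      next
        case (KF i)
        show ?thesis unfolding KF(1,2) by (rule KF'[THEN iffD2]) (use quad[OF KF(3)] in \<open>simp add: uq_quad_def\<close>)
      next
        case (EF i)
        show ?thesis unfolding EF(1,2) by (rule EF'[THEN iffD2]) (use quad[OF EF(3)] in \<open>simp add: uq_quad_def\<close>)
      next
        case (comm i j g h)
        show ?thesis unfolding comm(1,2) by (rule co[THEN iffD2]) (use f comm(3-5) in \<open>unfold uq_family_def, blast\<close>)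
      qed
    qed
  next
    assume r: "\<forall>x y. (x, y) \<in> uq_rels q n \<longrightarrow> ?ev x = ?ev y"
    have "uq_quad (sc q) (sc (inverse q)) (\<phi> i E) (\<phi> i F) (\<phi> i K) (\<phi> i Ki)" if i: "i \<in> {1..n}" for i
      unfolding uq_quad_def
      using KK(1)[THEN iffD1, OF r[rule_format, OF uq_rels.KKi[OF i]]]
        KK(2)[THEN iffD1, OF r[rule_format, OF uq_rels.KiK[OF i]]]
        KE'[THEN iffD1, OF r[rule_format, OF uq_rels.KE[OF i]]]
        KF'[THEN iffD1, OF r[rule_format, OF uq_rels.KF[OF i]]]
        EF'[THEN iffD1, OF r[rule_format, OF uq_rels.EF[OF i]]]
      by (intro conjI)
    moreover have "\<phi> i g * \<phi> j h = \<phi> j h * \<phi> i g" if "i \<in> {1..n}" "j \<in> {1..n}" "i \<noteq> j" for i j g h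
      by (rule co[THEN iffD1, OF r[rule_format, OF uq_rels.comm[OF that]]])
    ultimately show "uq_family sc q n \<phi>" unfolding uq_family_def by blast
  qed
qed

lemma family_sound: "uq_family sc q n \<phi> \<Longrightarrow> alg_eq (uq_rels q n) x y \<Longrightarrow> ev sc (unscale sc q \<phi>) x = ev sc (unscale sc q \<phi>) y"
  by (erule ev_alg_eq) (simp add: uq_family_rel)

end

definition generic_family :: "'k::field \<Rightarrow> nat \<Rightarrow> nat \<Rightarrow> gen \<Rightarrow> (nat \<times> gen, 'k) alg" where
  "generic_family q n i g = (if g = E then alg_scal ((q - inverse q)^2) * generic (uq_rels q n) (i, E) else generic (uq_rels q n) (i, g))"

context
  fixes q :: "'k::field"
  assumes q0: "q \<noteq> 0" and q2: "q * q \<noteq> 1"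
begin

interpretation uq_scalars alg_scal q using q0 q2 by unfold_locales

lemma unscale_generic: "unscale alg_scal q (generic_family q n) = generic (uq_rels q n)"
  by (auto simp: unscale_def generic_family_def c)

lemma alg_eq_counit: "alg_eq R (subst counit_letter x) (Scal (ev id (\<lambda>l. case snd l of E \<Rightarrow> 0 | F \<Rightarrow> 0 | K \<Rightarrow> 1 | Ki \<Rightarrow> 1) x))"
proof (induction x)
  case (Gen l) show ?case by (simp add: counit_letter_def alg_eq.refl)
next
  case (Scal c) show ?case by (simp add: alg_eq.refl)
next
  case (Add x y)
  show ?case using alg_eq.trans[OF alg_eq.add_cong[OF Add] alg_eq.scal_add] by simp
next
  case (Mul x y)
  show ?case using alg_eq.trans[OF alg_eq.mul_cong[OF Mul] alg_eq.scal_mul] by simp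
qed

lemma generic_rel: 
  assumes "(x, y) \<in> uq_rels q n"
  shows "ev alg_scal (generic (uq_rels q n)) x = ev alg_scal (generic (uq_rels q n)) y"
proof -
  let ?R = "uq_rels q n"
  let ?ev = "ev alg_scal (generic ?R)"
  have "alg_eq R' (rep_alg (?ev x) R') (rep_alg (?ev y) R')" for R'
  proof (cases "R' = ?R")
    case True
    then show ?thesis
      by (intro alg_eq.trans[OF rep_ev_generic alg_eq.trans[OF _ alg_eq.sym[OF rep_ev_generic]]])
        (simp add: alg_eq.rel[OF assms])
  next
    case False
    \<comment> \<open>In the other components the letters are scalars, and the relations need only
      be checked for the counit with values in the field.\<close>
    interpret I: uq_scalars "id :: 'k \<Rightarrow> 'k" q using q0 q2 by unfold_locales auto
    let ?u = "(\<lambda>l. case snd l of E \<Rightarrow> 0 | F \<Rightarrow> 0 | K \<Rightarrow> 1 | Ki \<Rightarrow> 1) :: nat \<times> gen \<Rightarrow> 'k"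
    have "ev id ?u x = ev id ?u y"
      using assms by cases (auto simp: I.ev_sub I.ev_smul split: gen.splits)
    then have "alg_eq R' (subst counit_letter x) (subst counit_letter y)"
      using alg_eq_counit[of R' x] alg_eq.sym[OF alg_eq_counit[of R' y]] by (metis alg_eq.trans)
    then show ?thesis
      using False by (intro alg_eq.trans[OF rep_ev_generic alg_eq.trans[OF _ alg_eq.sym[OF rep_ev_generic]]]) simp
  qed
  then show ?thesis using Quotient3_rel_rep[OF Quotient3_alg, of "?ev x" "?ev y"] by simp
qed

lemma generic_family: "uq_family alg_scal q n (generic_family q n)"
  unfolding uq_family_rel unscale_generic by (intro allI impI generic_rel)

lemma generic_complete:
  "ev alg_scal (unscale alg_scal q (generic_family q n)) x = ev alg_scal (unscale alg_scal q (generic_family q n)) y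
    \<Longrightarrow> alg_eq (uq_rels q n) x y"
  unfolding unscale_generic by (rule alg_eq_generic)

end

section \<open>Specialisation at t = 1\<close>

text \<open>\<open>f\<close> is a polynomial and \<open>v\<close> its value at 1.\<close>

definition at_one :: "'a::ring_1 fps \<Rightarrow> 'a \<Rightarrow> bool" where
  "at_one f v \<longleftrightarrow> (\<exists>N. (\<forall>n\<ge>N. fps_nth f n = 0) \<and> (\<Sum>n<N. fps_nth f n) = v)"

lemma at_one_bound:
  assumes "at_one f v"
  shows "\<exists>N. (\<forall>M\<ge>N. (\<Sum>n<M. fps_nth f n) = v) \<and> (\<forall>n\<ge>N. fps_nth f n = 0)"
proof -
  from assms obtain N where N: "\<And>n. n \<ge> N \<Longrightarrow> fps_nth f n = 0" "(\<Sum>n<N. fps_nth f n) = v"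
    by (auto simp: at_one_def)
  have "(\<Sum>n<M. fps_nth f n) = v" if "M \<ge> N" for M
  proof -
    have "(\<Sum>n<M. fps_nth f n) = (\<Sum>n<N. fps_nth f n)"
      by (rule sum.mono_neutral_right) (use that N(1) in auto)
    then show ?thesis using N(2) by simp
  qed
  then show ?thesis using N(1) by blast
qed

lemma at_one_unique: assumes "at_one f v" "at_one f w" shows "v = w"
proof -
  obtain N where N: "\<And>M. M \<ge> N \<Longrightarrow> (\<Sum>n<M. fps_nth f n) = v" using at_one_bound[OF assms(1)] by blast
  obtain N' where N': "\<And>M. M \<ge> N' \<Longrightarrow> (\<Sum>n<M. fps_nth f n) = w" using at_one_bound[OF assms(2)] by blast
  show ?thesis using N[of "max N N'"] N'[of "max N N'"] by simp
qed

lemma at_one_const: "at_one (fps_const c) c"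
  unfolding at_one_def by (rule exI[of _ 1]) auto

lemma at_one_X: "at_one fps_X 1"
  unfolding at_one_def by (rule exI[of _ 2]) (auto simp: fps_X_def numeral_2_eq_2)

lemma at_one_add: assumes "at_one f v" "at_one g w" shows "at_one (f + g) (v + w)"
proof -
  obtain N where N: "\<And>M. M \<ge> N \<Longrightarrow> (\<Sum>n<M. fps_nth f n) = v" "\<And>n. n \<ge> N \<Longrightarrow> fps_nth f n = 0"
    using at_one_bound[OF assms(1)] by blast
  obtain N' where N': "\<And>M. M \<ge> N' \<Longrightarrow> (\<Sum>n<M. fps_nth g n) = w" "\<And>n. n \<ge> N' \<Longrightarrow> fps_nth g n = 0"
    using at_one_bound[OF assms(2)] by blast
  show ?thesis unfolding at_one_def
    by (rule exI[of _ "max N N'"]) (use N N' in \<open>auto simp: sum.distrib\<close>)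
qed

lemma at_one_mult: assumes "at_one f v" "at_one g w" shows "at_one (f * g) (v * w)"
proof -
  obtain N where N: "\<And>M. M \<ge> N \<Longrightarrow> (\<Sum>n<M. fps_nth f n) = v" "\<And>n. n \<ge> N \<Longrightarrow> fps_nth f n = 0"
    using at_one_bound[OF assms(1)] by blast
  obtain N' where N': "\<And>M. M \<ge> N' \<Longrightarrow> (\<Sum>n<M. fps_nth g n) = w" "\<And>n. n \<ge> N' \<Longrightarrow> fps_nth g n = 0"
    using at_one_bound[OF assms(2)] by blast
  let ?M = "N + N'"
  have z: "fps_nth f i * fps_nth g j = 0" if "i \<ge> N \<or> j \<ge> N'" for i j
    using that N(2) N'(2) by auto
  have "fps_nth (f * g) n = 0" if "n \<ge> ?M" for n
    unfolding fps_mult_nth by (rule sum.neutral, intro ballI z) (use that in linarith)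
  moreover have "(\<Sum>n<?M. fps_nth (f * g) n) = v * w"
  proof -
    have "(\<Sum>n<?M. fps_nth (f * g) n) = (\<Sum>n<?M. \<Sum>i\<le>n. fps_nth f i * fps_nth g (n - i))"
      by (simp add: fps_mult_nth atLeast0AtMost)
    also have "\<dots> = (\<Sum>(i, j)\<in>{(i, j). i + j < ?M}. fps_nth f i * fps_nth g j)"
      by (rule sum.triangle_reindex[symmetric])
    also have "\<dots> = (\<Sum>(i, j)\<in>{..<N} \<times> {..<N'}. fps_nth f i * fps_nth g j)"
    proof (rule sum.mono_neutral_right)
      have "{(i, j). i + j < ?M} \<subseteq> {..<?M} \<times> {..<?M}" by auto
      then show "finite {(i, j). i + j < ?M}" by (rule finite_subset) simp
      show "\<forall>i\<in>{(i, j). i + j < ?M} - {..<N} \<times> {..<N'}. (case i of (i, j) \<Rightarrow> fps_nth f i * fps_nth g j) = 0"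
      proof
        fix x assume x: "x \<in> {(i, j). i + j < ?M} - {..<N} \<times> {..<N'}"
        then obtain i j where "x = (i, j)" "i \<ge> N \<or> j \<ge> N'" by (cases x) auto
        then show "(case x of (i, j) \<Rightarrow> fps_nth f i * fps_nth g j) = 0" using z by simp
      qed
    qed auto
    also have "\<dots> = (\<Sum>i<N. fps_nth f i) * (\<Sum>j<N'. fps_nth g j)"
      by (simp add: sum_product sum.cartesian_product)
    finally show ?thesis using N(1) N'(1) by simp
  qed
  ultimately show ?thesis unfolding at_one_def by blast
qed

lemma at_one_uminus: assumes "at_one f v" shows "at_one (- f) (- v)"
  using assms by (auto simp: at_one_def sum_negf)

lemma at_one_diff: assumes "at_one f v" "at_one g w" shows "at_one (f - g) (v - w)"
  using at_one_add[OF assms(1) at_one_uminus[OF assms(2)]] by simp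

lemma at_one_1: "at_one 1 1" using at_one_const[of 1] by simp

lemmas at_one_intros = at_one_const at_one_X at_one_1 at_one_add at_one_mult at_one_diff

abbreviation fps_scal where "fps_scal sc \<equiv> (\<lambda>c. fps_const (sc c))"

lemma at_one_ev:
  assumes "\<And>l. l \<in> letters x \<Longrightarrow> at_one (\<rho> l) (\<sigma> l)"
  shows "at_one (ev (fps_scal sc) \<rho> x) (ev sc \<sigma> x)"
  using assms by (induction x) (auto intro: at_one_intros)

fun at_one_tup where
  "at_one_tup (x, y, z, w) (x', y', z', w') \<longleftrightarrow> at_one x x' \<and> at_one y y' \<and> at_one z z' \<and> at_one w w'"

lemma at_one_tau_tup:
  assumes "at_one p p'" "at_one g g'" "at_one h h'" "at_one s s'" "at_one_tup T T'"
  shows "at_one_tup (tau_tup p g h s T) (tau_tup p' g' h' s' T')"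
  using assms by (cases T; cases T') (auto intro!: at_one_intros)

lemma at_one_tup:
  assumes "\<And>x. at_one (\<theta> x) (\<eta> x)"
  shows "at_one_tup (tup (fps_scal sc) q \<theta>) (tup sc q \<eta>)"
  using assms by (auto simp: tup_def intro!: at_one_intros)

lemma at_one_irev_below:
  assumes "below p x" "\<And>i h. 1 \<le> i \<Longrightarrow> i < p \<Longrightarrow> at_one (\<phi> i h) (\<psi> i h)" "at_one_tup T T'"
  shows "at_one (irev (fps_scal sc) q \<phi> T x) (irev sc q \<psi> T' x)"
proof (rule at_one_ev)
  fix l assume l: "l \<in> letters x"
  show "at_one (ir_letter (fps_scal sc) q \<phi> T l) (ir_letter sc q \<psi> T' l)"
  proof (cases l)
    case (Inl m)
    then obtain j h where m: "l = Inl (j, h)" by (cases m) auto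
    then have "1 \<le> j" "j < p" using assms(1) l unfolding below_def by blast+
    then show ?thesis using assms m by (auto simp: unscale_def intro!: at_one_intros)
  next
    case (Inr i)
    then show ?thesis using assms(3) by (cases T; cases T'; cases i) (auto intro!: at_one_intros)
  qed
qed

lemmas at_one_irev = at_one_irev_below[OF below_chain]

lemma (in scalar_map) scalar_map_fps: "scalar_map (fps_scal sc)"
proof
  fix a and x :: "'a fps"
  show "fps_const (sc a) * x = x * fps_const (sc a)"
    by (simp add: fps_eq_iff sc_central)
qed (auto simp: sc_add sc_mult sc_1)

lemma (in uq_scalars) uq_scalars_fps: "uq_scalars (fps_scal sc) q"
  using scalar_map_fps q0 q2 by (simp add: uq_scalars_def uq_scalars_axioms_def)

lemma commute_mult: "a * x = x * a \<Longrightarrow> b * x = x * b \<Longrightarrow> (a * b) * x = x * (a * b :: 'a::ring_1)"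
  by (metis mult.assoc)

context scalar_map
begin

lemma irev_commute:
  assumes "\<And>i h. 1 \<le> i \<Longrightarrow> i < p \<Longrightarrow> \<phi> i h * y = y * \<phi> i h"
    and T: "a * y = y * a" "b * y = y * b" "d * y = y * d" "w * y = y * w"
  shows "irev sc q \<phi> (a, b, d, w) (chain q A p) * y = y * irev sc q \<phi> (a, b, d, w) (chain q A p)"
proof (rule ev_commute)
  have s: "sc c * x * y = y * (sc c * x)" if "x * y = y * x" for c x
    by (rule commute_mult[OF sc_central that])
  fix l assume l: "l \<in> letters (chain q A p)"
  show "ir_letter sc q \<phi> (a, b, d, w) l * y = y * ir_letter sc q \<phi> (a, b, d, w) l"
  proof (cases l)
    case (Inl m)
    then obtain j h where m: "l = Inl (j, h)" by (cases m) auto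
    then have "1 \<le> j" "j < p" using chain_letters l by blast+
    then show ?thesis using assms(1) m by (auto simp: unscale_def intro!: s)
  next
    case (Inr i)
    then show ?thesis using T by (cases i) (auto intro!: s)
  qed
qed

end

section \<open>Commutation inherited by conjugates, and coproducts of quadruples\<close>

fun quad_fun :: "'a \<Rightarrow> 'a \<Rightarrow> 'a \<Rightarrow> 'a \<Rightarrow> gen \<Rightarrow> 'a" where
  "quad_fun e f k l E = e" | "quad_fun e f k l F = f" | "quad_fun e f k l K = k" | "quad_fun e f k l Ki = l"

lemma commute_add: "a * x = x * a \<Longrightarrow> b * x = x * b \<Longrightarrow> (a + b) * x = x * (a + b :: 'a::ring_1)"
  "a * x = x * a \<Longrightarrow> b * x = x * b \<Longrightarrow> (a - b) * x = x * (a - b :: 'a::ring_1)"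
  by (simp_all add: algebra_simps)

context pass_inv
begin

text \<open>Conjugates are products and sums of the original letters, scalars and \<open>v\<close>,
  and \<open>v\<close> inherits commutation from its inverse \<open>u\<close>. This keeps all other
  positions independent of the pair being exchanged.\<close>

lemma commutant:
  assumes x: "e * x = x * e" "f * x = x * f" "k * x = x * k" "l * x = x * l"
    "g * x = x * g" "h * x = x * h" "s * x = x * s"
  shows "quad_fun e' f' k' l' i * x = x * quad_fun e' f' k' l' i"
    "g' * x = x * g'" "h' * x = x * h'" "s' * x = x * s'" "C * x = x * C"
proof -
  have c: "p * x = x * p" "q * x = x * q" using p_central q_central by auto
  have one: "1 * x = x * 1" by simp
  note I = commute_mult commute_add x c one
  have u: "u * x = x * u" unfolding u_def by (intro I)
  have v: "v * x = x * v" using commute_inverse[OF uv' u] by simp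
  show C: "C * x = x * C" unfolding C_def by (intro I)
  have "e' * x = x * e'" unfolding e'_def by (intro I v)
  moreover have "k' * x = x * k'" unfolding k'_def by (intro I v)
  moreover have "l' * x = x * l'" unfolding l'_def by (intro I u)
  moreover have "f' * x = x * f'" unfolding f'_def by (intro I C)
  ultimately show "quad_fun e' f' k' l' i * x = x * quad_fun e' f' k' l' i" by (cases i) auto
  show "g' * x = x * g'" unfolding g'_def by (intro I u)
  show "h' * x = x * h'" unfolding h'_def by (intro I v)
  show "s' * x = x * s'" unfolding s'_def by (intro I v)
qed

text \<open>This is the sense in which conjugation extends \<open>\<tau>_R\<close>: the generators
  of I_R formed from the conjugated quadruple are the values of \<open>\<tau>_R\<close>.\<close>

lemma tup_pass:
  "(e' * l', f', l', e' * f' + p * k' + q * l') = tau_tup p g h s (e * l, f, l, e * f + p * k + q * l)"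
  by (simp add: e'l' C'_eq) (simp add: x'_def l'_def u_def f'_def C_def algebra_simps order)

end

context quad
begin
definition "cas = e * f + p * k + q * l"
lemma cas_commute: "cas * e = e * cas" "cas * f = f * cas" "cas * k = k * cas" "cas * l = l * cas"
  unfolding cas_def by (simp_all add: algebra_simps quad_order scalar_cancel)
end

definition delta_quad :: "(gen \<Rightarrow> 'a::ring_1) \<Rightarrow> (gen \<Rightarrow> 'a) \<Rightarrow> gen \<Rightarrow> 'a" where
  "delta_quad \<theta> \<eta> = quad_fun (\<theta> E + \<theta> K * \<eta> E) (\<theta> F * \<eta> Ki + \<eta> F) (\<theta> K * \<eta> K) (\<theta> Ki * \<eta> Ki)"

lemma delta_quad_assoc: "delta_quad (delta_quad a b) c = delta_quad a (delta_quad b c)"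
  by (auto simp: delta_quad_def algebra_simps)

abbreviation uq_gen where "uq_gen q p \<theta> \<equiv> uq_quad q p (\<theta> E) (\<theta> F) (\<theta> K) (\<theta> Ki)"

lemma (in scalars) delta_quad:
  assumes "uq_gen q p \<theta>" "uq_gen q p \<eta>" and c: "\<And>x y. \<eta> y * \<theta> x = \<theta> x * \<eta> y"
  shows "uq_gen q p (delta_quad \<theta> \<eta>)"
    "delta_tup q (\<theta> E) (\<theta> F) (\<theta> K) (\<theta> Ki) (\<eta> E * \<eta> Ki, \<eta> F, \<eta> Ki, \<eta> E * \<eta> F + p * \<eta> K + q * \<eta> Ki)
     = (delta_quad \<theta> \<eta> E * delta_quad \<theta> \<eta> Ki, delta_quad \<theta> \<eta> F, delta_quad \<theta> \<eta> Ki,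
        delta_quad \<theta> \<eta> E * delta_quad \<theta> \<eta> F + p * delta_quad \<theta> \<eta> K + q * delta_quad \<theta> \<eta> Ki)"
proof -
  interpret A: quad q p "\<theta> E" "\<theta> F" "\<theta> K" "\<theta> Ki" by standard (rule assms)
  interpret B: quad q p "\<eta> E" "\<eta> F" "\<eta> K" "\<eta> Ki" by standard (rule assms)
  note o = A.quad_order B.quad_order scalar_cancel c c[THEN assoc_rule]
  show "uq_gen q p (delta_quad \<theta> \<eta>)"
    unfolding uq_quad_def delta_quad_def by (simp add: algebra_simps o)
  show "delta_tup q (\<theta> E) (\<theta> F) (\<theta> K) (\<theta> Ki) (\<eta> E * \<eta> Ki, \<eta> F, \<eta> Ki, \<eta> E * \<eta> F + p * \<eta> K + q * \<eta> Ki)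
     = (delta_quad \<theta> \<eta> E * delta_quad \<theta> \<eta> Ki, delta_quad \<theta> \<eta> F, delta_quad \<theta> \<eta> Ki,
        delta_quad \<theta> \<eta> E * delta_quad \<theta> \<eta> F + p * delta_quad \<theta> \<eta> K + q * delta_quad \<theta> \<eta> Ki)"
    unfolding delta_quad_def by (simp add: algebra_simps o)
qed

section \<open>Removing a strand\<close>

text \<open>Since \<open>s\<close> has constant term 0, \<open>u\<close> has constant term 1 and is
  invertible as a power series. The conjugate \<open>s' = s * k * v\<close> again has constant term
  0, so the same strand can be passed by the next factor.\<close>

lemma pass_fps_exists:
  fixes q p :: "'a::ring_1 fps" and \<theta> :: "gen \<Rightarrow> 'a fps"
  assumes "pass q p (\<theta> E) (\<theta> F) (\<theta> K) (\<theta> Ki) g h s" and s0: "fps_nth s 0 = 0"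
  obtains \<theta>' g' h' s' where
    "pass q p (\<theta>' E) (\<theta>' F) (\<theta>' K) (\<theta>' Ki) g' h' s'" "fps_nth s' 0 = 0"
    "(\<theta>' E * \<theta>' Ki, \<theta>' F, \<theta>' Ki, \<theta>' E * \<theta>' F + p * \<theta>' K + q * \<theta>' Ki)
       = tau_tup p g h s (\<theta> E * \<theta> Ki, \<theta> F, \<theta> Ki, \<theta> E * \<theta> F + p * \<theta> K + q * \<theta> Ki)"
    "\<And>T. tau_tup p g h s (tau_tup p (\<theta> K) (\<theta> Ki) (\<theta> F) T) = tau_tup p (\<theta>' K) (\<theta>' Ki) (\<theta>' F) (tau_tup p g' h' s' T)"
    "\<And>T. tau_tup p g h s (delta_tup q (\<theta> E) (\<theta> F) (\<theta> K) (\<theta> Ki) T)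
       = delta_tup q (\<theta>' E) (\<theta>' F) (\<theta>' K) (\<theta>' Ki) (tau_tup p g' h' s' T)"
    "\<And>x i. (\<And>i. \<theta> i * x = x * \<theta> i) \<Longrightarrow> g * x = x * g \<Longrightarrow> h * x = x * h \<Longrightarrow> s * x = x * s \<Longrightarrow>
       \<theta>' i * x = x * \<theta>' i \<and> g' * x = x * g' \<and> h' * x = x * h' \<and> s' * x = x * s'"
proof -
  interpret pass q p "\<theta> E" "\<theta> F" "\<theta> K" "\<theta> Ki" g h s by (rule assms)
  let ?u = "1 - p * s * \<theta> E" let ?v = "fps_right_inverse ?u 1"
  have "fps_nth ?u 0 = 1" by (simp add: s0)
  then have "?u * ?v = 1" "?v * ?u = 1"
    by (auto intro: fps_right_inverse fps_left_inverse')
  then interpret pass_inv q p "\<theta> E" "\<theta> F" "\<theta> K" "\<theta> Ki" g h s ?v by unfold_locales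
  interpret P: pass q p e' f' k' l' g' h' s'
    using quad' g'h' g's' s'_cross g'_cross h'_cross by unfold_locales auto
  show ?thesis
  proof (rule that[of "quad_fun e' f' k' l'" g' h' s'])
    show "pass q p (quad_fun e' f' k' l' E) (quad_fun e' f' k' l' F) (quad_fun e' f' k' l' K) (quad_fun e' f' k' l' Ki) g' h' s'"
      by (simp add: P.pass_axioms)
    show "fps_nth s' 0 = 0" by (simp add: s'_def s0)
  qed (use tup_pass tau_tau tau_delta commutant in auto)
qed

definition del :: "nat \<Rightarrow> nat set \<Rightarrow> nat set" where
  "del g A = {i. i < g \<and> i \<in> A \<or> g \<le> i \<and> Suc i \<in> A}"

abbreviation commutes where "commutes x y \<equiv> x * y = y * (x :: 'a::ring_1)"

text \<open>The strand \<open>g\<close> of \<open>\<phi>\<close> has been passed by the positions \<open>g + 1, \<dots>, j - 1\<close>, whose conjugates form \<open>\<psi>\<close> at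
  positions \<open>g, \<dots>, j - 2\<close>; \<open>(\<kappa>, \<kappa>i, s)\<close> is the resulting conjugate of \<open>(K, K\<^sup>-\<^sup>1, F)\<close> of the strand.\<close>

definition gap_inv where
  "gap_inv sc q m g \<phi> j \<psi> \<kappa> \<kappa>i s \<longleftrightarrow>
     (\<forall>i<g. \<psi> i = \<phi> i) \<and>
     (\<forall>i\<in>{1..<j-1}. uq_gen (sc q) (sc (inverse q)) (\<psi> i)) \<and>
     (\<forall>i\<in>{1..<j-1}. \<forall>i'\<in>{1..<j-1}. i \<noteq> i' \<longrightarrow> (\<forall>x y. commutes (\<psi> i x) (\<psi> i' y))) \<and>
     strand (sc q) (sc (inverse q)) \<kappa> \<kappa>i s \<and> fps_nth s 0 = 0 \<and>
     (\<forall>i\<in>{1..<j-1}. \<forall>x. commutes (\<psi> i x) \<kappa> \<and> commutes (\<psi> i x) \<kappa>i \<and> commutes (\<psi> i x) s) \<and>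
     (\<forall>i\<in>{j..m}. \<forall>x. commutes (\<phi> i x) \<kappa> \<and> commutes (\<phi> i x) \<kappa>i \<and> commutes (\<phi> i x) s \<and>
        (\<forall>i'\<in>{1..<j-1}. \<forall>y. commutes (\<phi> i x) (\<psi> i' y))) \<and>
     (\<forall>A T. g \<notin> A \<longrightarrow> irev sc q \<phi> T (chain q A j) =
        irev sc q \<psi> (tau_tup (sc (inverse q)) \<kappa> \<kappa>i s T) (chain q (del g A) (j - 1))) \<and>
     (\<forall>A i. g \<notin> A \<longrightarrow> g < i \<longrightarrow> i < j \<longrightarrow> irev sc q \<phi> (tup sc q (\<phi> i)) (chain q A i) =
        irev sc q \<psi> (tup sc q (\<psi> (i - 1))) (chain q (del g A) (i - 1)))"

locale uq_scalars_fps = uq_scalars sc q for sc :: "'k::field \<Rightarrow> 'a::ring_1 fps" and q :: 'k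
begin

text \<open>Exchanging the strand with position \<open>j\<close> gives a new member
  \<open>\<theta>'\<close> at \<open>j - 1\<close> and a new strand. The strand matrix moves one
  place to the right through the matrix of position \<open>j\<close>, by the hexagon relation if
  \<open>j \<in> A\<close> and by Yang-Baxter otherwise.\<close>

lemma gap_step:
  assumes I: "gap_inv sc q m g \<phi> j \<psi> \<kappa> \<kappa>i s" and g: "1 \<le> g" "g < j" "j \<le> m"
    and quad: "uq_gen (sc q) (sc (inverse q)) (\<phi> j)"
    and comm: "\<And>i x y. i \<in> {1..m} \<Longrightarrow> i \<noteq> j \<Longrightarrow> commutes (\<phi> j x) (\<phi> i y)"
  shows "\<exists>\<psi>' \<kappa>' \<kappa>i' s'. gap_inv sc q m g \<phi> (Suc j) \<psi>' \<kappa>' \<kappa>i' s'"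
proof -
  let ?Q = "sc q" and ?P = "sc (inverse q)"
  note I = I[unfolded gap_inv_def]
  have i1: "\<forall>i<g. \<psi> i = \<phi> i"
    and i2: "\<forall>i\<in>{1..<j-1}. uq_gen ?Q ?P (\<psi> i)"
    and i3: "\<forall>i\<in>{1..<j-1}. \<forall>i'\<in>{1..<j-1}. i \<noteq> i' \<longrightarrow> (\<forall>x y. commutes (\<psi> i x) (\<psi> i' y))"
    and i4: "strand ?Q ?P \<kappa> \<kappa>i s" and i5: "fps_nth s 0 = 0"
    and i6: "\<forall>i\<in>{1..<j-1}. \<forall>x. commutes (\<psi> i x) \<kappa> \<and> commutes (\<psi> i x) \<kappa>i \<and> commutes (\<psi> i x) s"
    and i7: "\<forall>i\<in>{j..m}. \<forall>x. commutes (\<phi> i x) \<kappa> \<and> commutes (\<phi> i x) \<kappa>i \<and> commutes (\<phi> i x) s \<and>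
        (\<forall>i'\<in>{1..<j-1}. \<forall>y. commutes (\<phi> i x) (\<psi> i' y))"
    and i8: "\<forall>A T. g \<notin> A \<longrightarrow> irev sc q \<phi> T (chain q A j) =
        irev sc q \<psi> (tau_tup ?P \<kappa> \<kappa>i s T) (chain q (del g A) (j - 1))"
    and i9: "\<forall>A i. g \<notin> A \<longrightarrow> g < i \<longrightarrow> i < j \<longrightarrow> irev sc q \<phi> (tup sc q (\<phi> i)) (chain q A i) =
        irev sc q \<psi> (tup sc q (\<psi> (i - 1))) (chain q (del g A) (i - 1))"
    using I by auto
  have "j \<in> {j..m}" using g by auto
  with i7 have cj: "commutes (\<phi> j x) \<kappa>" "commutes (\<phi> j x) \<kappa>i" "commutes (\<phi> j x) s"
    "i' \<in> {1..<j-1} \<Longrightarrow> commutes (\<phi> j x) (\<psi> i' y)" for x y i' by blast+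
  interpret st: strand ?Q ?P \<kappa> \<kappa>i s by (rule i4)
  have "pass ?Q ?P (\<phi> j E) (\<phi> j F) (\<phi> j K) (\<phi> j Ki) \<kappa> \<kappa>i s"
    using quad cj by unfold_locales auto
  then obtain \<theta>' g' h' s' where pa: "pass ?Q ?P (\<theta>' E) (\<theta>' F) (\<theta>' K) (\<theta>' Ki) g' h' s'" and s': "fps_nth s' 0 = 0"
    and tp: "tup sc q \<theta>' = tau_tup ?P \<kappa> \<kappa>i s (tup sc q (\<phi> j))"
    and tt: "\<And>T. tau_tup ?P \<kappa> \<kappa>i s (tau_act sc q (\<phi> j) T) = tau_act sc q \<theta>' (tau_tup ?P g' h' s' T)"
    and td: "\<And>T. tau_tup ?P \<kappa> \<kappa>i s (delta_act sc q (\<phi> j) T) = delta_act sc q \<theta>' (tau_tup ?P g' h' s' T)"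
    and cm: "\<And>x i. (\<And>i. \<phi> j i * x = x * \<phi> j i) \<Longrightarrow> \<kappa> * x = x * \<kappa> \<Longrightarrow> \<kappa>i * x = x * \<kappa>i \<Longrightarrow> s * x = x * s \<Longrightarrow>
       \<theta>' i * x = x * \<theta>' i \<and> g' * x = x * g' \<and> h' * x = x * h' \<and> s' * x = x * s'"
    unfolding tup_def using i5 by (rule pass_fps_exists) blast
  interpret P: pass ?Q ?P "\<theta>' E" "\<theta>' F" "\<theta>' K" "\<theta>' Ki" g' h' s' by (rule pa)
  let ?\<psi> = "\<psi>(j - 1 := \<theta>')"
  have set: "{1..<Suc j - 1} = insert (j - 1) {1..<j-1}" using g by auto
  have irev_upd: "irev sc q ?\<psi> T (chain q A i) = irev sc q \<psi> T (chain q A i)" if "i \<le> j - 1" for T A i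
    by (rule irev_cong) (use that in auto)
  have cpsi: "commutes (\<theta>' x) (\<psi> i y) \<and> commutes g' (\<psi> i y) \<and> commutes h' (\<psi> i y) \<and> commutes s' (\<psi> i y)"
    if "i \<in> {1..<j-1}" for i x y
    by (rule cm) (use that i6 cj in auto)
  have cphi: "commutes (\<theta>' x) (\<phi> i y) \<and> commutes g' (\<phi> i y) \<and> commutes h' (\<phi> i y) \<and> commutes s' (\<phi> i y)"
    if "i \<in> {Suc j..m}" for i x y
    by (rule cm) (use that i7 comm g in auto)
  have cth: "commutes (\<theta>' x) g' \<and> commutes (\<theta>' x) h' \<and> commutes (\<theta>' x) s'" for x
    by (cases x) (simp_all add: P.cross)
  have "gap_inv sc q m g \<phi> (Suc j) ?\<psi> g' h' s'"
    unfolding gap_inv_def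
  proof (intro conjI)
    show "\<forall>i<g. ?\<psi> i = \<phi> i" using i1 g by auto
    show "\<forall>i\<in>{1..<Suc j - 1}. uq_gen ?Q ?P (?\<psi> i)" unfolding set using i2 P.uq by auto
    show "\<forall>i\<in>{1..<Suc j - 1}. \<forall>i'\<in>{1..<Suc j - 1}. i \<noteq> i' \<longrightarrow> (\<forall>x y. commutes (?\<psi> i x) (?\<psi> i' y))"
    proof (intro ballI impI allI)
      fix i i' x y assume i: "i \<in> {1..<Suc j - 1}" "i' \<in> {1..<Suc j - 1}" "i \<noteq> i'"
      then consider "i = j - 1" "i' \<in> {1..<j-1}" | "i \<in> {1..<j-1}" "i' = j - 1" | "i \<in> {1..<j-1}" "i' \<in> {1..<j-1}"
        unfolding set by blast
      then show "commutes (?\<psi> i x) (?\<psi> i' y)"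
      proof cases
        case 1 then show ?thesis using cpsi[of i' x y] by auto
      next
        case 2 then show ?thesis using cpsi[of i y x] by auto
      next
        case 3 then show ?thesis using i3 i(3) by auto
      qed
    qed
    show "strand ?Q ?P g' h' s'" by (rule P.strand_axioms)
    show "fps_nth s' 0 = 0" by (rule s')
    show "\<forall>i\<in>{1..<Suc j - 1}. \<forall>x. commutes (?\<psi> i x) g' \<and> commutes (?\<psi> i x) h' \<and> commutes (?\<psi> i x) s'"
      unfolding set using cth cpsi by fastforce
    show "\<forall>i\<in>{Suc j..m}. \<forall>x. commutes (\<phi> i x) g' \<and> commutes (\<phi> i x) h' \<and> commutes (\<phi> i x) s' \<and>
        (\<forall>i'\<in>{1..<Suc j-1}. \<forall>y. commutes (\<phi> i x) (?\<psi> i' y))"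
    proof (intro ballI allI conjI)
      fix i x assume i: "i \<in> {Suc j..m}"
      show "commutes (\<phi> i x) g'" "commutes (\<phi> i x) h'" "commutes (\<phi> i x) s'" using cphi[OF i] by auto
      fix i' y assume "i' \<in> {1..<Suc j - 1}"
      then consider "i' = j - 1" | "i' \<in> {1..<j-1}" "i' \<noteq> j - 1" by fastforce
      then show "commutes (\<phi> i x) (?\<psi> i' y)"
      proof cases
        case 1 then show ?thesis using cphi[OF i, of y x] by simp
      next
        case 2 then show ?thesis using i7 i by simp
      qed
    qed
    show "\<forall>A T. g \<notin> A \<longrightarrow> irev sc q \<phi> T (chain q A (Suc j)) =
        irev sc q ?\<psi> (tau_tup ?P g' h' s' T) (chain q (del g A) (Suc j - 1))"
    proof (intro allI impI)
      fix A T assume A: "g \<notin> A"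
      have d: "j - 1 \<in> del g A \<longleftrightarrow> j \<in> A" using g by (auto simp: del_def)
      have "irev sc q \<phi> T (chain q A (Suc j)) =
         irev sc q \<phi> (if j \<in> A then delta_act sc q (\<phi> j) T else tau_act sc q (\<phi> j) T) (chain q A j)"
        using g by (intro irev_chain) auto
      also have "\<dots> = irev sc q \<psi> (tau_tup ?P \<kappa> \<kappa>i s (if j \<in> A then delta_act sc q (\<phi> j) T else tau_act sc q (\<phi> j) T))
          (chain q (del g A) (j - 1))"
        using i8 A by blast
      also have "\<dots> = irev sc q ?\<psi> (if j \<in> A then delta_act sc q \<theta>' (tau_tup ?P g' h' s' T)
            else tau_act sc q \<theta>' (tau_tup ?P g' h' s' T)) (chain q (del g A) (j - 1))"
        by (simp add: tt td irev_upd del: One_nat_def)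
      also have "\<dots> = irev sc q ?\<psi> (tau_tup ?P g' h' s' T) (chain q (del g A) (Suc (j - 1)))"
        using g d by (subst irev_chain) (auto simp del: One_nat_def)
      finally show "irev sc q \<phi> T (chain q A (Suc j)) =
        irev sc q ?\<psi> (tau_tup ?P g' h' s' T) (chain q (del g A) (Suc j - 1))" using g by simp
    qed
    show "\<forall>A i. g \<notin> A \<longrightarrow> g < i \<longrightarrow> i < Suc j \<longrightarrow> irev sc q \<phi> (tup sc q (\<phi> i)) (chain q A i) =
        irev sc q ?\<psi> (tup sc q (?\<psi> (i - 1))) (chain q (del g A) (i - 1))"
    proof (intro allI impI)
      fix A i assume A: "g \<notin> A" "g < i" "i < Suc j"
      show "irev sc q \<phi> (tup sc q (\<phi> i)) (chain q A i) =
        irev sc q ?\<psi> (tup sc q (?\<psi> (i - 1))) (chain q (del g A) (i - 1))"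
      proof (cases "i = j")
        case True
        \<comment> \<open>A chain ending at \<open>j\<close> leaves the strand matrix applied to the
          tuple of \<open>\<phi> j\<close>; by \<open>tp\<close> this is the tuple of
          \<open>\<theta>'\<close>, and the strand has disappeared.\<close>
        then show ?thesis using i8[rule_format, OF A(1), of "tup sc q (\<phi> j)"]
          by (simp add: irev_upd tp del: One_nat_def)
      next
        case False
        then have i: "i < j" using A by simp
        then have "i - 1 \<noteq> j - 1" using A g by auto
        then show ?thesis using i9 A i by (simp add: irev_upd del: One_nat_def)
      qed
    qed
  qed
  then show ?thesis by blast
qed

text \<open>Only \<open>strand\<close> is asked of position \<open>g\<close>: replacing F by
  \<open>t F\<close> breaks its relation with E, and \<open>\<tau>_R\<close> contains no E of the
  strand. The induction starts at \<open>j = g + 1\<close>, where the invariant speaks of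
  \<open>\<psi>\<close> only below \<open>g\<close>, so that \<open>\<phi>\<close> itself
  serves.\<close>

lemma gap_exists:
  assumes g: "1 \<le> g" "g < j" "j \<le> Suc m"
    and quad: "\<And>i. i \<in> {1..m} \<Longrightarrow> i \<noteq> g \<Longrightarrow> uq_gen (sc q) (sc (inverse q)) (\<phi> i)"
    and comm: "\<And>i i' x y. i \<in> {1..m} \<Longrightarrow> i' \<in> {1..m} \<Longrightarrow> i \<noteq> i' \<Longrightarrow> commutes (\<phi> i x) (\<phi> i' y)"
    and st: "strand (sc q) (sc (inverse q)) (\<phi> g K) (\<phi> g Ki) (\<phi> g F)" and F0: "fps_nth (\<phi> g F) 0 = 0"
  shows "\<exists>\<psi> \<kappa> \<kappa>i s. gap_inv sc q m g \<phi> j \<psi> \<kappa> \<kappa>i s"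
proof -
  have "Suc g \<le> j" using g by simp
  then show ?thesis using g(3)
  proof (induction j rule: dec_induct)
    case base
    have ch: "chain q (del g A) g = chain q A g" for A
      by (rule chain_cong) (auto simp: del_def)
    have "irev sc q \<phi> T (chain q A (Suc g)) = irev sc q \<phi> (tau_act sc q (\<phi> g) T) (chain q A g)" if "g \<notin> A" for A T
      using g that by (subst irev_chain) auto
    then have "gap_inv sc q m g \<phi> (Suc g) \<phi> (\<phi> g K) (\<phi> g Ki) (\<phi> g F)"
      unfolding gap_inv_def using assms by (auto simp: ch simp del: chain.simps)
    then show ?case by blast
  next
    case (step j)
    then obtain \<psi> \<kappa> \<kappa>i s where "gap_inv sc q m g \<phi> j \<psi> \<kappa> \<kappa>i s" by auto
    then show ?case
      by (rule gap_step) (use step quad comm g in auto)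
  qed
qed

end

section \<open>The image of the iterated coproduct\<close>

primrec coprod :: "nat \<Rightarrow> gen \<Rightarrow> (nat \<times> gen, 'k::field) expr" where
  "coprod 0 g = (case g of E \<Rightarrow> Scal 0 | F \<Rightarrow> Scal 0 | K \<Rightarrow> Scal 1 | Ki \<Rightarrow> Scal 1)"
| "coprod (Suc m) g = (case g of
      E \<Rightarrow> Add (coprod m E) (Mul (coprod m K) (G (Suc m) E))
    | F \<Rightarrow> Add (Mul (coprod m F) (G (Suc m) Ki)) (G (Suc m) F)
    | K \<Rightarrow> Mul (coprod m K) (G (Suc m) K)
    | Ki \<Rightarrow> Mul (coprod m Ki) (G (Suc m) Ki))"

primrec coprod_val :: "(nat \<Rightarrow> gen \<Rightarrow> 'a::ring_1) \<Rightarrow> nat \<Rightarrow> gen \<Rightarrow> 'a" where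
  "coprod_val \<phi> 0 = quad_fun 0 0 1 1"
| "coprod_val \<phi> (Suc m) = delta_quad (coprod_val \<phi> m) (\<phi> (Suc m))"

lemma coprod_val_cong: "(\<And>i. 1 \<le> i \<Longrightarrow> i \<le> m \<Longrightarrow> \<phi> i = \<psi> i) \<Longrightarrow> coprod_val \<phi> m = coprod_val \<psi> m"
  by (induction m) auto

lemma coprod_val_commute:
  "(\<And>i x. 1 \<le> i \<Longrightarrow> i \<le> m \<Longrightarrow> commutes (\<phi> i x) y) \<Longrightarrow> commutes (coprod_val \<phi> m g) y"
proof (induction m arbitrary: g)
  case (Suc m)
  have "commutes (coprod_val \<phi> m g) y" for g using Suc by auto
  moreover have "commutes (\<phi> (Suc m) g) y" for g using Suc.prems by auto
  ultimately show ?case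
    by (cases g) (simp_all add: delta_quad_def commute_mult commute_add)
next
  case 0 show ?case by (cases g) auto
qed

lemma at_one_coprod_val:
  "(\<And>i x. 1 \<le> i \<Longrightarrow> i \<le> m \<Longrightarrow> at_one (\<phi> i x) (\<psi> i x)) \<Longrightarrow> at_one (coprod_val \<phi> m g) (coprod_val \<psi> m g)"
proof (induction m arbitrary: g)
  case (Suc m)
  then show ?case
    by (cases g) (auto simp: delta_quad_def intro!: at_one_intros)
next
  case 0 show ?case using at_one_const[of 0] by (cases g) (auto simp: at_one_1)
qed

text \<open>Position \<open>m\<close> counts as the last element whether or not it lies in
  \<open>A\<close>: the element denoted is \<open>\<Lambda>\<close> of
  \<open>(A \<inter> {1..<m}) \<union> {m}\<close>.\<close>

definition chain_expr :: "'k::field \<Rightarrow> nat set \<Rightarrow> nat \<Rightarrow> (nat \<times> gen, 'k) expr" where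
  "chain_expr q A m = subst (ir_eval q m) (chain q A m)"

context uq_scalars
begin

lemma ev_chain_expr: "ev sc (unscale sc q \<phi>) (chain_expr q A m) = irev sc q \<phi> (tup sc q (\<phi> m)) (chain q A m)"
  by (simp add: chain_expr_def ev_ir_eval)

lemma ev_coprod: "ev sc (unscale sc q \<phi>) (coprod m g) = unscale sc q (\<lambda>_. coprod_val \<phi> m) (0, g)"
proof (induction m arbitrary: g)
  case 0 show ?case by (cases g) (simp_all add: unscale_def sc_0 sc_1)
next
  case (Suc m)
  then show ?case
    by (cases g) (simp_all add: unscale_def delta_quad_def distrib_left c_move)
qed

lemma commutes_scaled:
  "commutes x (unscale sc q (\<lambda>_. \<theta>) (0, g)) \<longleftrightarrow> commutes x (\<theta> g)"
proof (cases "g = E")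
  case True
  have "inverse c \<noteq> 0" using q_diff by simp
  then show ?thesis using True sc_cancel[of "inverse c"] by (simp add: unscale_def c_move mult.assoc)
qed (simp add: unscale_def)

text \<open>A congruence evaluates in every ring, so the induction hypothesis on \<open>m\<close>
  factors becomes available for conjugated generators over power series.\<close>

lemma centralizer_sound:
  assumes "alg_eq (uq_rels q m) (Mul (chain_expr q B m) (coprod m g)) (Mul (coprod m g) (chain_expr q B m))"
    and "uq_family sc q m \<phi>"
  shows "commutes (irev sc q \<phi> (tup sc q (\<phi> m)) (chain q B m)) (coprod_val \<phi> m g)"
  using family_sound[OF assms(2,1)] by (simp add: ev_chain_expr ev_coprod commutes_scaled)

end

text \<open>Multiplied by \<open>k'\<close> this reads
  \<open>S * k' + t * e' = d + t * g * e\<close>, the intertwining of the coproduct of E with its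
  opposite. The factors \<open>t\<close> arise because the partner of \<open>t F\<close> in a
  quadruple would be \<open>d\<close> divided by \<open>t\<close>; the denominator is
  cleared.\<close>

lemma (in pass_e) S_eq: "S = d * l' + t * g * e * l' - t * x'"
  unfolding defs S_def by (simp add: algebra_simps order_d)

lemma (in pass_e) S_commute:
  assumes "commutes d x" "commutes e x" "commutes l x" "commutes g x" "commutes h x" "commutes s x"
  shows "commutes S x"
proof -
  have "commutes p x" "commutes t x" using p_central t_central by auto
  then show ?thesis unfolding S_def by (intro commute_add commute_mult assms)
qed

text \<open>The coproduct respects the relations, so the last two members may be replaced by one.
  The second claim lets the coproduct matrix of position \<open>m\<close> be absorbed into the tuple
  of the merged member.\<close>

lemma uq_family_merge:
  assumes u: "uq_scalars sc q" and f: "uq_family sc q (Suc m) \<phi>" and m: "1 \<le> m"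
  shows "uq_family sc q m (\<phi>(m := delta_quad (\<phi> m) (\<phi> (Suc m))))"
    "delta_act sc q (\<phi> m) (tup sc q (\<phi> (Suc m))) = tup sc q (delta_quad (\<phi> m) (\<phi> (Suc m)))"
proof -
  interpret uq_scalars sc q by (rule u)
  let ?d = "delta_quad (\<phi> m) (\<phi> (Suc m))"
  have quad: "uq_gen (sc q) (sc (inverse q)) (\<phi> i)" if "i \<in> {1..Suc m}" for i
    using f that unfolding uq_family_def by blast
  have comm: "commutes (\<phi> i x) (\<phi> j y)" if "i \<in> {1..Suc m}" "j \<in> {1..Suc m}" "i \<noteq> j" for i j x y
    using f that unfolding uq_family_def by blast
  have dq: "uq_gen (sc q) (sc (inverse q)) ?d"
    by (rule delta_quad) (use quad comm m in auto)
  show "delta_act sc q (\<phi> m) (tup sc q (\<phi> (Suc m))) = tup sc q ?d"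
    unfolding tup_def by (rule delta_quad) (use quad comm m in auto)
  have cd: "commutes (?d x) (\<phi> i y)" if "i \<in> {1..m}" "i \<noteq> m" for i x y
  proof -
    have "commutes (\<phi> m x) (\<phi> i y)" "commutes (\<phi> (Suc m) x) (\<phi> i y)" for x
      using comm that m by auto
    then show ?thesis by (cases x) (simp_all add: delta_quad_def commute_mult commute_add)
  qed
  have "commutes ((\<phi>(m := ?d)) i x) ((\<phi>(m := ?d)) j y)" if "i \<in> {1..m}" "j \<in> {1..m}" "i \<noteq> j" for i j x y
    using comm[of i j x y] cd[of j x y] cd[of i y x] that by auto
  moreover have "uq_gen (sc q) (sc (inverse q)) ((\<phi>(m := ?d)) i)" if "i \<in> {1..m}" for i
    using quad[of i] dq that by auto
  ultimately show "uq_family sc q m (\<phi>(m := ?d))" unfolding uq_family_def by blast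
qed

lemma family_quad: "uq_family sc q n \<phi> \<Longrightarrow> i \<in> {1..n} \<Longrightarrow> uq_gen (sc q) (sc (inverse q)) (\<phi> i)"
  unfolding uq_family_def by blast
lemma family_commute: "uq_family sc q n \<phi> \<Longrightarrow> i \<in> {1..n} \<Longrightarrow> j \<in> {1..n} \<Longrightarrow> i \<noteq> j \<Longrightarrow> commutes (\<phi> i x) (\<phi> j y)"
  unfolding uq_family_def by blast

lemma fps_X_commutes: "commutes x fps_X" by (simp add: fps_mult_fps_X_commute)

lemma uq_gen_const: "uq_gen q p \<theta> \<Longrightarrow> uq_gen (fps_const q) (fps_const p) (\<lambda>x. fps_const (\<theta> x))"
  unfolding uq_quad_def by simp

lemma (in uq_scalars) strand_const:
  assumes "uq_gen (sc q) (sc (inverse q)) \<theta>"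
  shows "strand (fps_scal sc q) (fps_scal sc (inverse q)) (fps_const (\<theta> K)) (fps_const (\<theta> Ki)) (fps_X * fps_const (\<theta> F))"
proof -
  interpret B: uq_scalars "fps_scal sc" q by (rule uq_scalars_fps)
  have "\<theta> K * \<theta> F = sc (inverse q) * sc (inverse q) * \<theta> F * \<theta> K"
    using assms by (simp add: uq_quad_def)
  then have "fps_const (\<theta> K) * (fps_X * fps_const (\<theta> F)) =
      fps_const (sc (inverse q)) * fps_const (sc (inverse q)) * (fps_X * fps_const (\<theta> F)) * fps_const (\<theta> K)"
    by (intro fps_ext) (simp add: mult.assoc)
  then show ?thesis using assms by unfold_locales (auto simp: uq_quad_def)
qed

lemma coprod_val_rec: "m = Suc n \<Longrightarrow> coprod_val \<phi> m = delta_quad (coprod_val \<phi> n) (\<phi> m)"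
  by simp

lemma (in uq_scalars) tau_pass:
  fixes \<phi> :: "nat \<Rightarrow> gen \<Rightarrow> 'a"
  assumes fam: "uq_family sc q (Suc m) \<phi>" and m: "1 \<le> m"
  defines "cf \<equiv> \<lambda>i x. fps_const (\<phi> i x)"
  obtains v where
    "pass_inv (fps_scal sc q) (fps_scal sc (inverse q)) (cf (Suc m) E) (cf (Suc m) F) (cf (Suc m) K) (cf (Suc m) Ki)
      (cf m K) (cf m Ki) (fps_X * cf m F) v"
    "pass_e (fps_scal sc q) (fps_scal sc (inverse q)) (cf (Suc m) E) (cf (Suc m) F) (cf (Suc m) K) (cf (Suc m) Ki)
      (cf m K) (cf m Ki) (fps_X * cf m F) (cf m E) fps_X"
proof -
  interpret B: uq_scalars "fps_scal sc" q by (rule uq_scalars_fps)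
  have q1: "uq_gen (sc q) (sc (inverse q)) (\<phi> m)" and q2: "uq_gen (sc q) (sc (inverse q)) (\<phi> (Suc m))"
    using family_quad[OF fam] m by auto
  have comm: "commutes (cf (Suc m) x) (cf m y)" for x y
    using family_commute[OF fam, of "Suc m" m x y] m by (simp add: cf_def)
  have cX: "commutes (cf (Suc m) x) (fps_X * cf m y)" for x y
    using comm[of x y] by (metis commute_mult fps_X_commutes)
  interpret st: strand "fps_scal sc q" "fps_scal sc (inverse q)" "cf m K" "cf m Ki" "fps_X * cf m F"
    unfolding cf_def by (rule strand_const) (rule q1)
  have pa: "pass (fps_scal sc q) (fps_scal sc (inverse q)) (cf (Suc m) E) (cf (Suc m) F) (cf (Suc m) K) (cf (Suc m) Ki)
      (cf m K) (cf m Ki) (fps_X * cf m F)"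
    using comm cX uq_gen_const[OF q2] by unfold_locales (simp_all add: cf_def)
  let ?u = "1 - fps_scal sc (inverse q) * (fps_X * cf m F) * cf (Suc m) E" let ?v = "fps_right_inverse ?u 1"
  have "fps_nth ?u 0 = 1" by simp
  then have "?u * ?v = 1" "?v * ?u = 1"
    by (auto intro: fps_right_inverse fps_left_inverse')
  with pa have 1: "pass_inv (fps_scal sc q) (fps_scal sc (inverse q)) (cf (Suc m) E) (cf (Suc m) F) (cf (Suc m) K) (cf (Suc m) Ki)
      (cf m K) (cf m Ki) (fps_X * cf m F) ?v"
    by (simp add: pass_inv_def pass_inv_axioms_def)
  have "\<phi> m F * \<phi> m E = \<phi> m E * \<phi> m F - (sc q - sc (inverse q)) * (\<phi> m K - \<phi> m Ki)"
    and "\<phi> m K * \<phi> m E = sc q * sc q * \<phi> m E * \<phi> m K"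
    using q1 unfolding uq_quad_def by (auto simp: algebra_simps)
  then have "pass_e_axioms (fps_scal sc q) (fps_scal sc (inverse q)) (cf (Suc m) E) (cf (Suc m) F) (cf (Suc m) K) (cf (Suc m) Ki)
      (cf m K) (cf m Ki) (fps_X * cf m F) (cf m E) fps_X"
    using comm unfolding pass_e_axioms_def
    by (auto simp: fps_X_commutes cf_def mult.assoc intro!: fps_ext)
  with pa have 2: "pass_e (fps_scal sc q) (fps_scal sc (inverse q)) (cf (Suc m) E) (cf (Suc m) F) (cf (Suc m) K) (cf (Suc m) Ki)
      (cf m K) (cf m Ki) (fps_X * cf m F) (cf m E) fps_X"
    by (simp add: pass_e_def)
  show ?thesis by (rule that[OF 1 2])
qed

text \<open>After the exchange the conjugated factor occupies position \<open>m\<close> and the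
  strand is left out, which gives a family of \<open>m\<close> members over power series.\<close>

lemma (in uq_scalars) pass_family:
  assumes fam: "uq_family sc q (Suc m) \<phi>" and m: "1 \<le> m"
    and pi: "pass_inv (fps_scal sc q) (fps_scal sc (inverse q)) (fps_const (\<phi> (Suc m) E)) (fps_const (\<phi> (Suc m) F))
      (fps_const (\<phi> (Suc m) K)) (fps_const (\<phi> (Suc m) Ki)) (fps_const (\<phi> m K)) (fps_const (\<phi> m Ki)) (fps_X * fps_const (\<phi> m F)) v"
  defines "\<theta>' \<equiv> quad_fun (pass_inv.e' (fps_const (\<phi> (Suc m) E)) (fps_const (\<phi> m Ki)) v)
      (pass.f' (fps_scal sc q) (fps_scal sc (inverse q)) (fps_const (\<phi> (Suc m) E)) (fps_const (\<phi> (Suc m) F))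
      (fps_const (\<phi> (Suc m) K)) (fps_const (\<phi> (Suc m) Ki)) (fps_const (\<phi> m K)) (fps_X * fps_const (\<phi> m F)))
      (pass_inv.k' (fps_const (\<phi> (Suc m) K)) v)
      (pass.l' (fps_scal sc (inverse q)) (fps_const (\<phi> (Suc m) E)) (fps_const (\<phi> (Suc m) Ki)) (fps_X * fps_const (\<phi> m F)))"
  shows "uq_family (fps_scal sc) q m ((\<lambda>i x. fps_const (\<phi> i x))(m := \<theta>'))"
    "tup (fps_scal sc) q \<theta>' = tau_tup (fps_scal sc (inverse q)) (fps_const (\<phi> m K)) (fps_const (\<phi> m Ki)) (fps_X * fps_const (\<phi> m F))
       (tup (fps_scal sc) q (\<lambda>x. fps_const (\<phi> (Suc m) x)))"
proof -
  let ?cf = "\<lambda>i x. fps_const (\<phi> i x)"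
  interpret pass_inv "fps_scal sc q" "fps_scal sc (inverse q)" "?cf (Suc m) E" "?cf (Suc m) F" "?cf (Suc m) K" "?cf (Suc m) Ki"
    "?cf m K" "?cf m Ki" "fps_X * ?cf m F" v by (rule pi)
  have th: "\<theta>' = quad_fun e' f' k' l'" by (simp add: \<theta>'_def)
  show "tup (fps_scal sc) q \<theta>' = tau_tup (fps_scal sc (inverse q)) (?cf m K) (?cf m Ki) (fps_X * ?cf m F)
       (tup (fps_scal sc) q (\<lambda>x. ?cf (Suc m) x))"
    unfolding tup_def th quad_fun.simps by (rule tup_pass)
  have cc: "commutes (?cf i x) (?cf j y)" if "i \<in> {1..Suc m}" "j \<in> {1..Suc m}" "i \<noteq> j" for i j x y
    using family_commute[OF fam that, of x y] by simp
  have c: "commutes (\<theta>' x) (?cf j y)" if "j \<in> {1..m}" "j \<noteq> m" for j x y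
    unfolding th using that cc m
    by (intro commutant) (auto intro!: commute_mult[OF fps_X_commutes[symmetric]] simp del: fps_const_mult)
  have "commutes ((?cf(m := \<theta>')) i x) ((?cf(m := \<theta>')) j y)" if "i \<in> {1..m}" "j \<in> {1..m}" "i \<noteq> j" for i j x y
    using cc[of i j x y] c[of j x y] c[of i y x] that by (auto simp del: fps_const_mult)
  moreover have "uq_gen (fps_scal sc q) (fps_scal sc (inverse q)) ((?cf(m := \<theta>')) i)" if "i \<in> {1..m}" for i
    using uq_gen_const[OF family_quad[OF fam, of i]] quad' that by (auto simp: th)
  ultimately show "uq_family (fps_scal sc) q m (?cf(m := \<theta>'))" unfolding uq_family_def by blast
qed

text \<open>The value \<open>z\<close> is a chain in the conjugated family, so by hypothesis it
  commutes with the coproduct of that family. It also commutes with the strand conjugates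
  \<open>g'\<close>, \<open>h'\<close>, \<open>s'\<close>, \<open>S\<close>, which commute with all
  its letters. Intertwining writes each generator of the coproduct of \<open>m + 1\<close> factors
  as the value at \<open>t = 1\<close> of a polynomial in these.\<close>

lemma centralizer_tau:
  assumes u: "uq_scalars sc q" and fam: "uq_family sc q (Suc m) \<phi>" and m: "1 \<le> m"
    and IH: "\<And>g. alg_eq (uq_rels q m) (Mul (chain_expr q B m) (coprod m g)) (Mul (coprod m g) (chain_expr q B m))"
    and mB: "m \<notin> B"
  shows "commutes (irev sc q \<phi> (tup sc q (\<phi> (Suc m))) (chain q B (Suc m))) (coprod_val \<phi> (Suc m) x)"
proof -
  interpret uq_scalars sc q by (rule u)
  interpret B: uq_scalars "fps_scal sc" q by (rule uq_scalars_fps)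
  let ?S = "fps_scal sc"
  let ?cf = "\<lambda>i x. fps_const (\<phi> i x)"
  obtain v where pi: "pass_inv (?S q) (?S (inverse q)) (?cf (Suc m) E) (?cf (Suc m) F) (?cf (Suc m) K) (?cf (Suc m) Ki)
      (?cf m K) (?cf m Ki) (fps_X * ?cf m F) v"
    and pe: "pass_e (?S q) (?S (inverse q)) (?cf (Suc m) E) (?cf (Suc m) F) (?cf (Suc m) K) (?cf (Suc m) Ki)
      (?cf m K) (?cf m Ki) (fps_X * ?cf m F) (?cf m E) fps_X"
    using tau_pass[OF fam m] by blast
  interpret pass_inv "?S q" "?S (inverse q)" "?cf (Suc m) E" "?cf (Suc m) F" "?cf (Suc m) K" "?cf (Suc m) Ki"
    "?cf m K" "?cf m Ki" "fps_X * ?cf m F" v by (rule pi)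
  interpret pass_e "?S q" "?S (inverse q)" "?cf (Suc m) E" "?cf (Suc m) F" "?cf (Suc m) K" "?cf (Suc m) Ki"
    "?cf m K" "?cf m Ki" "fps_X * ?cf m F" "?cf m E" fps_X by (rule pe)
  obtain n where n: "m = Suc n" using m by (cases m) auto
  let ?\<theta> = "quad_fun e' f' k' l'"
  let ?\<psi> = "?cf(m := ?\<theta>)"
  have fam': "uq_family ?S q m ?\<psi>"
    and tp: "tup ?S q ?\<theta> = tau_tup (?S (inverse q)) (?cf m K) (?cf m Ki) (fps_X * ?cf m F) (tup ?S q (?cf (Suc m)))"
    using pass_family[OF fam m pi] by auto
  define R where "R = coprod_val ?cf n"
  have RD: "coprod_val ?\<psi> m = delta_quad R ?\<theta>"
  proof -
    have "coprod_val ?\<psi> n = R" unfolding R_def by (rule coprod_val_cong) (simp add: n)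
    then show ?thesis using coprod_val_rec[OF n, of ?\<psi>] by simp
  qed
  define z where "z = irev ?S q ?\<psi> (tup ?S q ?\<theta>) (chain q B m)"
  have zD: "commutes z (delta_quad R ?\<theta> i)" for i
    using B.centralizer_sound[OF IH fam'] by (simp add: z_def RD)
  have cc: "commutes (?cf i x) (?cf j y)" if "i \<in> {1..Suc m}" "j \<in> {1..Suc m}" "i \<noteq> j" for i j x y
    using family_commute[OF fam that, of x y] by simp
  have cX: "commutes (fps_X * ?cf i x) y" if "commutes (?cf i x) y" for i x y
    by (rule commute_mult[OF fps_X_commutes[symmetric] that])
  have z_commute: "commutes z y" if y: "\<And>i x. 1 \<le> i \<Longrightarrow> i \<le> n \<Longrightarrow> commutes (?cf i x) y" and t: "\<And>x. commutes (?\<theta> x) y" for y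
  proof -
    have w: "commutes (?\<theta> E * ?\<theta> F + ?S (inverse q) * ?\<theta> K + ?S q * ?\<theta> Ki) y"
      using B.p_central[of y] B.q_central[of y] by (intro commute_add commute_mult t) auto
    show ?thesis unfolding z_def tup_def
      by (rule B.irev_commute) (use y n t w in \<open>auto intro!: commute_mult t simp del: quad_fun.simps\<close>)
  qed
  have low: "commutes (?\<theta> i) (?cf j x) \<and> commutes g' (?cf j x) \<and> commutes h' (?cf j x) \<and> commutes s' (?cf j x) \<and> commutes S (?cf j x)"
    if "1 \<le> j" "j \<le> n" for i j x
  proof -
    have a: "commutes (?cf (Suc m) a) (?cf j x)" "commutes (?cf m a) (?cf j x)" for a
      by (rule cc; use that n in auto)+
    have b: "commutes (fps_X * ?cf m F) (?cf j x)" by (rule cX) (rule a)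
    show ?thesis
      using commutant[OF a(1) a(1) a(1) a(1) a(2) a(2) b] S_commute[OF a(2) a(1) a(1) a(2) a(2) b] by blast
  qed
  have zc: "commutes z y" if "\<And>j x. 1 \<le> j \<Longrightarrow> j \<le> n \<Longrightarrow> commutes (?cf j x) y"
    "commutes e' y" "commutes f' y" "commutes k' y" "commutes l' y" for y
  proof (rule z_commute)
    show "commutes (?\<theta> x) y" for x by (cases x) (simp_all only: quad_fun.simps that)
  qed (rule that)
  have low': "commutes (?cf j x) g'" "commutes (?cf j x) h'" "commutes (?cf j x) s'" "commutes (?cf j x) S"
    if "1 \<le> j" "j \<le> n" for j x
    using low[OF that, of undefined x] by (simp_all only:)
  have zg: "commutes z g'" "commutes z h'" "commutes z s'"
    by (rule zc[OF low'(1)], assumption+, (rule g'_cross)+)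
      (rule zc[OF low'(2)], assumption+, (rule h'_cross)+,
       rule zc[OF low'(3)], assumption+, (rule s'_cross)+)
  have Sl: "commutes S l'" "commutes S f'" "commutes S k'" "commutes S e'"
  proof -
    show "commutes S l'" "commutes S f'" by (rule Sl' Sf')+
    show k: "commutes S k'" using commute_inverse[OF l'k' Sl'[symmetric]] by simp
    show "commutes S e'" unfolding e'_eq by (rule commute_mult[OF Sx'[symmetric] k[symmetric], symmetric])
  qed
  have zS: "commutes z S"
    by (rule zc[OF low'(4)], assumption+, (rule Sl[symmetric])+)
  have RS: "commutes (R i) S" for i
    unfolding R_def by (rule coprod_val_commute) (rule low'(4))
  have at_R: "at_one (R i) (coprod_val \<phi> n i)" for i
    unfolding R_def by (rule at_one_coprod_val) (rule at_one_const)
  have at_z: "at_one z (irev sc q \<phi> (tup sc q (\<phi> (Suc m))) (chain q B (Suc m)))"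
  proof -
    have "at_one_tup (tup ?S q ?\<theta>) (tau_act sc q (\<phi> m) (tup sc q (\<phi> (Suc m))))"
      unfolding tp by (intro at_one_tau_tup at_one_tup at_one_const)
        (use at_one_mult[OF at_one_X at_one_const[of "\<phi> m F"]] in simp)
    then have "at_one z (irev sc q \<phi> (tau_act sc q (\<phi> m) (tup sc q (\<phi> (Suc m)))) (chain q B m))"
      unfolding z_def by (intro at_one_irev) (auto intro: at_one_const)
    then show ?thesis using mB m by (subst irev_chain) auto
  qed
  have conclude: ?thesis if "commutes z w" "at_one w (coprod_val \<phi> (Suc m) x)" for w
    by (rule at_one_unique[OF at_one_mult[OF at_z that(2)]]) (use at_one_mult[OF that(2) at_z] that(1) in simp)
  \<comment> \<open>The two factors \<open>1\<close> in the formula for E mark where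
    \<open>t\<close> stands over power series, so that the rules for \<open>at_one\<close> match
    term by term.\<close>
  have D: "coprod_val \<phi> (Suc m) K = coprod_val \<phi> n K * (\<phi> m K * \<phi> (Suc m) K)"
    "coprod_val \<phi> (Suc m) Ki = coprod_val \<phi> n Ki * (\<phi> m Ki * \<phi> (Suc m) Ki)"
    "coprod_val \<phi> (Suc m) F = coprod_val \<phi> n F * (\<phi> m Ki * \<phi> (Suc m) Ki) + (\<phi> (Suc m) F + \<phi> m F * \<phi> (Suc m) Ki)"
    "coprod_val \<phi> (Suc m) E = 1 * coprod_val \<phi> n E + coprod_val \<phi> n K * (\<phi> m E + 1 * (\<phi> m K * \<phi> (Suc m) E))"
    by (simp_all add: n delta_quad_def algebra_simps)
  have zD': "commutes z (R E + R K * e')" "commutes z (R F * l' + f')" "commutes z (R K * k')" "commutes z (R Ki * l')"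
    using zD[of E] zD[of F] zD[of K] zD[of Ki] by (simp_all add: delta_quad_def)
  have at_s: "at_one (fps_X * ?cf m F) (\<phi> m F)" using at_one_mult[OF at_one_X at_one_const[of "\<phi> m F"]] by simp
  note at = at_one_add at_one_mult at_one_const at_R at_s
  have zmul: "commutes z (a * b)" "commutes z (a + b)" if "commutes z a" "commutes z b" for a b
    using commute_mult[of a z b] commute_add(1)[of a z b] that by simp_all
  show ?thesis
  proof (cases x)
    case K
    have "R K * k' * g' = R K * (?cf m K * ?cf (Suc m) K)"
      using k'g' cross(7) by (simp add: mult.assoc del: fps_const_mult)
    moreover have "commutes z (R K * k' * g')" by (intro zmul zD' zg)
    moreover have "at_one (R K * (?cf m K * ?cf (Suc m) K)) (coprod_val \<phi> n K * (\<phi> m K * \<phi> (Suc m) K))" by (intro at)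
    ultimately show ?thesis
      by (intro conclude[of "R K * k' * g'"]) (simp_all only: K D)
  next
    case Ki
    have "R Ki * l' * h' = R Ki * (?cf m Ki * ?cf (Suc m) Ki)"
      using l'h' by (simp add: mult.assoc del: fps_const_mult)
    moreover have "commutes z (R Ki * l' * h')" by (intro zmul zD' zg)
    moreover have "at_one (R Ki * (?cf m Ki * ?cf (Suc m) Ki)) (coprod_val \<phi> n Ki * (\<phi> m Ki * \<phi> (Suc m) Ki))" by (intro at)
    ultimately show ?thesis
      by (intro conclude[of "R Ki * l' * h'"]) (simp_all only: Ki D)
  next
    case F
    have "(R F * l' + f') * h' + s' = R F * (?cf m Ki * ?cf (Suc m) Ki) + (?cf (Suc m) F + fps_X * ?cf m F * ?cf (Suc m) Ki)"
      using l'h' coproduct_F_pass by (simp add: mult.assoc distrib_right del: fps_const_mult)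
    moreover have "commutes z ((R F * l' + f') * h' + s')" by (intro zmul zD' zg)
    moreover have "at_one (R F * (?cf m Ki * ?cf (Suc m) Ki) + (?cf (Suc m) F + fps_X * ?cf m F * ?cf (Suc m) Ki))
       (coprod_val \<phi> n F * (\<phi> m Ki * \<phi> (Suc m) Ki) + (\<phi> (Suc m) F + \<phi> m F * \<phi> (Suc m) Ki))" by (intro at)
    ultimately show ?thesis
      by (intro conclude[of "(R F * l' + f') * h' + s'"])
        (simp_all only: F D)
  next
    case E
    have Sk: "S * k' = ?cf m E + fps_X * ?cf m K * ?cf (Suc m) E - fps_X * e'"
    proof -
      have "S * k' = ?cf m E * (l' * k') + fps_X * ?cf m K * ?cf (Suc m) E * (l' * k') - fps_X * (x' * k')"
        unfolding S_eq by (simp add: algebra_simps del: fps_const_mult)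
      then show ?thesis by (simp add: l'k' e'_eq)
    qed
    have "fps_X * (R E + R K * e') + R K * (S * k') = fps_X * R E + R K * (?cf m E + fps_X * (?cf m K * ?cf (Suc m) E))"
      unfolding Sk by (simp add: algebra_simps del: fps_const_mult) (metis fps_X_commutes mult.assoc)
    moreover have "commutes z (fps_X * (R E + R K * e') + R K * (S * k'))"
    proof -
      have "R K * (S * k') = S * (R K * k')"
        using arg_cong[OF RS[of K], of "\<lambda>y. y * k'"] by (simp only: mult.assoc)
      then show ?thesis by (simp only:) (intro zmul zD' zS fps_X_commutes)
    qed
    moreover have "at_one (fps_X * R E + R K * (?cf m E + fps_X * (?cf m K * ?cf (Suc m) E)))
       (1 * coprod_val \<phi> n E + coprod_val \<phi> n K * (\<phi> m E + 1 * (\<phi> m K * \<phi> (Suc m) E)))" by (intro at at_one_X)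
    ultimately show ?thesis
      by (intro conclude[of "fps_X * (R E + R K * e') + R K * (S * k')"])
        (simp_all only: E D)
  qed
qed

text \<open>Induction on the number of factors, from the centrality of the Casimir element. If
  \<open>m \<in> B\<close>, the last two factors are merged, and coassociativity identifies the
  coproducts; otherwise factor \<open>m + 1\<close> passes strand \<open>m\<close>.\<close>

theorem centralizer:
  assumes q0: "q \<noteq> 0" and q2: "q * q \<noteq> 1" and m: "1 \<le> m"
  shows "alg_eq (uq_rels q m) (Mul (chain_expr q B m) (coprod m g)) (Mul (coprod m g) (chain_expr q B m))"
  using m
proof (induction m arbitrary: g rule: dec_induct)
  interpret uq_scalars alg_scal q using q0 q2 by unfold_locales
  have conclude: "alg_eq (uq_rels q m) (Mul (chain_expr q B m) (coprod m g)) (Mul (coprod m g) (chain_expr q B m))"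
    if "commutes (irev alg_scal q (generic_family q m) (tup alg_scal q (generic_family q m m)) (chain q B m)) (coprod_val (generic_family q m) m g)"
    for m g
    by (rule generic_complete[OF q0 q2]) (use that in \<open>simp add: ev_chain_expr ev_coprod commutes_scaled\<close>)
  case base
  let ?\<phi> = "generic_family q 1"
  have "uq_gen (alg_scal q) (alg_scal (inverse q)) (?\<phi> 1)"
    by (rule family_quad[OF generic_family[OF q0 q2]]) simp
  then interpret Q: quad "alg_scal q" "alg_scal (inverse q)" "?\<phi> 1 E" "?\<phi> 1 F" "?\<phi> 1 K" "?\<phi> 1 Ki"
    by unfold_locales
  have "commutes Q.cas (coprod_val ?\<phi> 1 g)"
    using Q.cas_commute by (cases g) (simp_all add: delta_quad_def)
  moreover have "irev alg_scal q ?\<phi> (tup alg_scal q (?\<phi> 1)) (chain q B 1) = Q.cas"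
    by (simp add: tup_def Q.cas_def[unfolded One_nat_def])
  ultimately show ?case by (intro conclude) (simp only:)
next
  interpret uq_scalars alg_scal q using q0 q2 by unfold_locales
  have conclude: "alg_eq (uq_rels q m) (Mul (chain_expr q B m) (coprod m g)) (Mul (coprod m g) (chain_expr q B m))"
    if "commutes (irev alg_scal q (generic_family q m) (tup alg_scal q (generic_family q m m)) (chain q B m)) (coprod_val (generic_family q m) m g)"
    for m g
    by (rule generic_complete[OF q0 q2]) (use that in \<open>simp add: ev_chain_expr ev_coprod commutes_scaled\<close>)
  case (step m)
  let ?\<phi> = "generic_family q (Suc m)"
  have fam: "uq_family alg_scal q (Suc m) ?\<phi>" by (rule generic_family[OF q0 q2])
  have u: "uq_scalars alg_scal q" by unfold_locales
  show ?case
  proof (cases "m \<in> B")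
    case True
    let ?d = "delta_quad (?\<phi> m) (?\<phi> (Suc m))" let ?\<psi> = "?\<phi>(m := ?d)"
    note M = uq_family_merge[OF u fam step(1)]
    have "commutes (irev alg_scal q ?\<psi> (tup alg_scal q (?\<psi> m)) (chain q B m)) (coprod_val ?\<psi> m g)"
      by (rule centralizer_sound[OF step.IH M(1)])
    moreover have "coprod_val ?\<psi> m = coprod_val ?\<phi> (Suc m)"
    proof -
      obtain n where n: "m = Suc n" using step(1) by (cases m) auto
      have "coprod_val ?\<psi> n = coprod_val ?\<phi> n" by (rule coprod_val_cong) (simp add: n)
      then show ?thesis by (simp add: n delta_quad_assoc)
    qed
    moreover have "irev alg_scal q ?\<psi> (tup alg_scal q (?\<psi> m)) (chain q B m)
      = irev alg_scal q ?\<phi> (tup alg_scal q (?\<phi> (Suc m))) (chain q B (Suc m))"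
    proof -
      have "irev alg_scal q ?\<psi> (tup alg_scal q ?d) (chain q B m) = irev alg_scal q ?\<phi> (tup alg_scal q ?d) (chain q B m)"
        by (rule irev_cong) simp
      then show ?thesis using step(1) True by (subst irev_chain) (simp_all only: M(2) if_True fun_upd_same)
    qed
    ultimately show ?thesis by (intro conclude) simp
  next
    case False
    show ?thesis by (rule conclude) (rule centralizer_tau[OF u fam step(1) step.IH False])
  qed
qed

section \<open>Commutation of chains\<close>

definition commute_stmt :: "'k::field \<Rightarrow> nat \<Rightarrow> nat set \<Rightarrow> nat \<Rightarrow> nat set \<Rightarrow> bool" where
  "commute_stmt q m A m' B \<longleftrightarrow>
     alg_eq (uq_rels q m) (Mul (chain_expr q A m) (chain_expr q B m')) (Mul (chain_expr q B m') (chain_expr q A m))"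

lemma (in uq_scalars) commute_sound:
  assumes "commute_stmt q m A m' B" "uq_family sc q m \<phi>"
  shows "commutes (irev sc q \<phi> (tup sc q (\<phi> m)) (chain q A m)) (irev sc q \<phi> (tup sc q (\<phi> m')) (chain q B m'))"
  using family_sound[OF assms(2) assms(1)[unfolded commute_stmt_def]] by (simp add: ev_chain_expr)

lemma commute_complete:
  assumes q: "q \<noteq> 0" "q * q \<noteq> 1"
    and comm: "commutes (irev alg_scal q (generic_family q m) (tup alg_scal q (generic_family q m m)) (chain q A m))
      (irev alg_scal q (generic_family q m) (tup alg_scal q (generic_family q m m')) (chain q B m'))"
  shows "commute_stmt q m A m' B"
proof -
  interpret uq_scalars alg_scal q using q by unfold_locales
  show ?thesis unfolding commute_stmt_def
    by (rule generic_complete[OF q]) (use comm in \<open>simp add: ev_chain_expr\<close>)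
qed

lemma family_mono: "uq_family sc q n \<phi> \<Longrightarrow> m \<le> n \<Longrightarrow> uq_family sc q m \<phi>"
  unfolding uq_family_def by (meson atLeastatMost_subset_iff order_refl subsetD)

text \<open>Without gaps every matrix is a coproduct matrix. Merging the last two members repeatedly
  leaves the Casimir element of the iterated coproduct.\<close>

lemma interval_chain:
  assumes "uq_scalars sc q" "uq_family sc q m \<phi>" "1 \<le> m" "\<And>i. 1 \<le> i \<Longrightarrow> i < m \<Longrightarrow> i \<in> A"
  shows "irev sc q \<phi> (tup sc q (\<phi> m)) (chain q A m) = snd (snd (snd (tup sc q (coprod_val \<phi> m))))"
  using assms(3,2,4)
proof (induction m arbitrary: \<phi> rule: dec_induct)
  case base
  interpret uq_scalars sc q by (rule assms)
  show ?case by (simp add: tup_def delta_quad_def)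
next
  case (step m)
  interpret uq_scalars sc q by (rule assms)
  note M = uq_family_merge[OF assms(1) step.prems(1) step(1)]
  let ?d = "delta_quad (\<phi> m) (\<phi> (Suc m))" let ?\<psi> = "\<phi>(m := ?d)"
  have "irev sc q \<phi> (tup sc q (\<phi> (Suc m))) (chain q A (Suc m)) = irev sc q \<phi> (tup sc q ?d) (chain q A m)"
    using step.prems(2)[of m] step(1) by (subst irev_chain) (simp_all only: M(2) if_True lessI)
  also have "\<dots> = irev sc q ?\<psi> (tup sc q (?\<psi> m)) (chain q A m)"
    unfolding fun_upd_same by (rule irev_cong) simp
  also have "\<dots> = snd (snd (snd (tup sc q (coprod_val ?\<psi> m))))"
    by (rule step.IH[OF M(1)]) (use step.prems(2) in auto)
  also have "coprod_val ?\<psi> m = coprod_val \<phi> (Suc m)"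
  proof -
    obtain n where n: "m = Suc n" using step(1) by (cases m) auto
    have "coprod_val ?\<psi> n = coprod_val \<phi> n" by (rule coprod_val_cong) (simp add: n)
    then show ?thesis by (simp add: n delta_quad_assoc)
  qed
  finally show ?case .
qed

text \<open>A chain ending at \<open>m'\<close> is controlled by the coproduct of \<open>m'\<close>
  factors; further factors enter the longer coproduct only through letters that commute with
  it.\<close>

lemma coprod_val_commute_later:
  assumes fam: "uq_family sc q m \<phi>" and m: "1 \<le> m'" "m' \<le> m"
    and base: "\<And>g. commutes z (coprod_val \<phi> m' g)"
    and z: "\<And>i x. m' < i \<Longrightarrow> i \<le> m \<Longrightarrow> commutes z (\<phi> i x)"
  shows "commutes z (coprod_val \<phi> m g)"
  using m(2) z
proof (induction m arbitrary: g rule: dec_induct)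
  case base then show ?case using assms(4) by blast
next
  case (step n)
  have "commutes z (coprod_val \<phi> n g)" for g using step by auto
  note a = this[symmetric]
  have "commutes z (\<phi> (Suc n) g)" for g using step by auto
  note b = this[symmetric]
  show ?case
    by (rule HOL.sym, cases g) (simp_all only: coprod_val.simps delta_quad_def quad_fun.simps; intro commute_add commute_mult a b)+
qed

lemma irev_del_low:
  assumes "\<And>j. j < g \<Longrightarrow> \<psi> j = \<phi> j" "i < g"
  shows "irev sc q \<phi> (tup sc q (\<phi> i)) (chain q A i) = irev sc q \<psi> (tup sc q (\<psi> i)) (chain q (del g A) i)"
proof -
  have "chain q A i = chain q (del g A) i"
    by (rule chain_cong) (use assms(2) in \<open>auto simp: del_def\<close>)
  moreover have "irev sc q \<phi> T (chain q A i) = irev sc q \<psi> T (chain q A i)" for T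
    by (rule irev_cong) (use assms in auto)
  ultimately show ?thesis using assms by simp
qed

lemma tup_cas: "snd (snd (snd (tup sc q \<theta>))) = \<theta> E * \<theta> F + sc (inverse q) * \<theta> K + sc q * \<theta> Ki"
  by (simp add: tup_def)

lemma commute_interval:
  assumes q: "q \<noteq> 0" "q * q \<noteq> 1" and m: "1 \<le> m" "1 \<le> m'" "m' \<le> m"
    and A: "\<And>i. 1 \<le> i \<Longrightarrow> i < m \<Longrightarrow> i \<in> A"
  shows "commute_stmt q m A m' B"
proof (rule commute_complete[OF q])
  interpret uq_scalars alg_scal q using q by unfold_locales
  have u: "uq_scalars alg_scal q" by unfold_locales
  let ?\<phi> = "generic_family q m"
  have fam: "uq_family alg_scal q m ?\<phi>" by (rule generic_family[OF q])
  let ?z = "irev alg_scal q ?\<phi> (tup alg_scal q (?\<phi> m')) (chain q B m')"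
  have z: "commutes ?z (coprod_val ?\<phi> m g)" for g
  proof (rule coprod_val_commute_later[OF fam m(2,3)])
    show "commutes ?z (coprod_val ?\<phi> m' g)" for g
      by (rule centralizer_sound[OF centralizer[OF q m(2)] family_mono[OF fam m(3)]])
    fix i x assume i: "m' < i" "i \<le> m"
    have c: "commutes (?\<phi> j y) (?\<phi> i x)" if "1 \<le> j" "j \<le> m'" for j y
      by (rule family_commute[OF fam]) (use i that in auto)
    have p: "commutes (alg_scal a) (?\<phi> i x)" for a by (rule alg.sc_central)
    show "commutes ?z (?\<phi> i x)"
      unfolding tup_def by (rule alg.irev_commute; intro commute_add commute_mult c p; use m in linarith)
  qed
  have "commutes (snd (snd (snd (tup alg_scal q (coprod_val ?\<phi> m))))) ?z"
    unfolding tup_cas by (intro commute_add commute_mult z[symmetric] alg.sc_central)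
  then show "commutes (irev alg_scal q ?\<phi> (tup alg_scal q (?\<phi> m)) (chain q A m)) ?z"
    by (simp only: interval_chain[OF u fam m(1) A])
qed

text \<open>Both values are rewritten in one and the same conjugated family of \<open>m - 1\<close>
  members, where the hypothesis applies, and \<open>t\<close> is then set to 1. The condition
  \<open>m' = m \<or> m' \<in> A\<close> keeps \<open>m'\<close> away from the removed strand
  \<open>g\<close>.\<close>

lemma commute_gap:
  assumes q: "q \<noteq> 0" "q * q \<noteq> 1" and m: "1 \<le> m" "1 \<le> m'" "m' \<le> m" "m' = m \<or> m' \<in> A"
    and g: "1 \<le> g" "g < m" "g \<notin> A" "g \<notin> B"
    and IH: "commute_stmt q (m - 1) (del g A) (if m' < g then m' else m' - 1) (del g B)"
  shows "commute_stmt q m A m' B"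
proof (rule commute_complete[OF q])
  interpret uq_scalars alg_scal q using q by unfold_locales
  interpret U: uq_scalars "fps_scal alg_scal" q by (rule uq_scalars_fps)
  interpret U: uq_scalars_fps "fps_scal alg_scal" q by unfold_locales
  let ?\<phi> = "generic_family q m" let ?S = "fps_scal alg_scal"
  have fam: "uq_family alg_scal q m ?\<phi>" by (rule generic_family[OF q])
  define \<Phi> where "\<Phi> = (\<lambda>i x. if i = g \<and> x = F then fps_X * fps_const (?\<phi> i x) else fps_const (?\<phi> i x))"
  have at: "at_one (\<Phi> i x) (?\<phi> i x)" for i x
    using at_one_mult[OF at_one_X at_one_const] by (auto simp: \<Phi>_def intro: at_one_const)
  have "\<exists>\<psi> \<kappa> \<kappa>i s. gap_inv ?S q m g \<Phi> (Suc m) \<psi> \<kappa> \<kappa>i s"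
  proof (rule U.gap_exists)
    show "uq_gen (?S q) (?S (inverse q)) (\<Phi> i)" if "i \<in> {1..m}" "i \<noteq> g" for i
      using uq_gen_const[OF family_quad[OF fam that(1)]] that(2) by (simp add: \<Phi>_def)
    show "commutes (\<Phi> i x) (\<Phi> i' y)" if "i \<in> {1..m}" "i' \<in> {1..m}" "i \<noteq> i'" for i i' x y
    proof -
      have c: "commutes (fps_const (?\<phi> i x)) (fps_const (?\<phi> i' y))"
        using family_commute[OF fam that, of x y] by simp
      have "commutes (fps_X * fps_const (?\<phi> i x)) (fps_const (?\<phi> i' y))"
        by (rule commute_mult[OF fps_X_commutes[symmetric] c])
      moreover have "commutes (fps_X * fps_const (?\<phi> i' y)) (fps_const (?\<phi> i x))"
        by (rule commute_mult[OF fps_X_commutes[symmetric] c[symmetric]])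
      ultimately show ?thesis using c that(3) unfolding \<Phi>_def by (auto simp del: fps_const_mult)
    qed
    show "strand (?S q) (?S (inverse q)) (\<Phi> g K) (\<Phi> g Ki) (\<Phi> g F)"
      using strand_const[OF family_quad[OF fam, of g]] g by (simp add: \<Phi>_def)
  qed (use g in \<open>auto simp: \<Phi>_def\<close>)
  then obtain \<psi> \<kappa> \<kappa>i s where I: "gap_inv ?S q m g \<Phi> (Suc m) \<psi> \<kappa> \<kappa>i s" by blast
  note I = I[unfolded gap_inv_def]
  have fam': "uq_family ?S q (m - 1) \<psi>"
  proof -
    have set: "{1..<Suc m - 1} = {1..m - 1}" using m by auto
    show ?thesis
      unfolding uq_family_def set[symmetric] using I by (elim conjE) (intro conjI)
  qed
  have low: "\<psi> j = \<Phi> j" if "j < g" for j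
    using I[THEN conjunct1] that by blast
  have high: "irev ?S q \<Phi> (tup ?S q (\<Phi> i)) (chain q A i) = irev ?S q \<psi> (tup ?S q (\<psi> (i - 1))) (chain q (del g A) (i - 1))"
    if "g \<notin> A" "g < i" "i \<le> m" for i A
  proof -
    have "\<forall>A i. g \<notin> A \<longrightarrow> g < i \<longrightarrow> i < Suc m \<longrightarrow> irev ?S q \<Phi> (tup ?S q (\<Phi> i)) (chain q A i) =
        irev ?S q \<psi> (tup ?S q (\<psi> (i - 1))) (chain q (del g A) (i - 1))"
      using I by (elim conjE)
    from this[rule_format, OF that(1,2) le_imp_less_Suc[OF that(3)]] show ?thesis .
  qed
  let ?V = "\<lambda>A i. irev ?S q \<Phi> (tup ?S q (\<Phi> i)) (chain q A i)"
  have m': "m' \<noteq> g" using m g by auto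
  have "commutes (?V A m) (?V B m')"
  proof (cases "m' < g")
    case True
    have "?V B m' = irev ?S q \<psi> (tup ?S q (\<psi> m')) (chain q (del g B) m')"
      by (rule irev_del_low) (use low True in auto)
    then show ?thesis using U.commute_sound[OF IH fam'] high[of A m] True g by simp
  next
    case False
    then show ?thesis using U.commute_sound[OF IH fam'] high[of A m] high[of B m'] m' m g by simp
  qed
  moreover have at_V: "at_one (?V A i) (irev alg_scal q ?\<phi> (tup alg_scal q (?\<phi> i)) (chain q A i))" for A i
    by (intro at_one_irev at_one_tup at)
  ultimately show "commutes (irev alg_scal q ?\<phi> (tup alg_scal q (?\<phi> m)) (chain q A m))
      (irev alg_scal q ?\<phi> (tup alg_scal q (?\<phi> m')) (chain q B m'))"
    by (intro at_one_unique[OF at_one_mult[OF at_V at_V]]) (simp only: at_one_mult[OF at_V at_V])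
qed

theorem commute_chain:
  assumes q: "q \<noteq> 0" "q * q \<noteq> 1"
  shows "1 \<le> m' \<Longrightarrow> m' \<le> m \<Longrightarrow> m' = m \<or> m' \<in> A \<Longrightarrow> (\<And>i. 1 \<le> i \<Longrightarrow> i < m' \<Longrightarrow> i \<in> B \<Longrightarrow> i \<in> A)
    \<Longrightarrow> commute_stmt q m A m' B"
proof (induction m arbitrary: m' A B)
  case (Suc m)
  show ?case
  proof (cases "\<forall>i. 1 \<le> i \<and> i < Suc m \<longrightarrow> i \<in> A")
    case True
    then show ?thesis using Suc.prems by (intro commute_interval[OF q]) auto
  next
    case False
    then obtain g where g: "1 \<le> g" "g < Suc m" "g \<notin> A" by blast
    \<comment> \<open>\<open>B\<close> can contain \<open>g\<close> only at or beyond
      \<open>m'\<close>, which the chain ending at \<open>m'\<close> does not see.\<close>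
    have "chain q B m' = chain q (B - {g}) m'"
      by (rule chain_cong) (use Suc.prems(4) g in auto)
    moreover have "commute_stmt q (Suc m) A m' (B - {g})"
    proof (rule commute_gap[OF q, where g = g])
      show "commute_stmt q (Suc m - 1) (del g A) (if m' < g then m' else m' - 1) (del g (B - {g}))"
        unfolding diff_Suc_1
      proof (cases "m' < g")
        case True
        show "commute_stmt q m (del g A) (if m' < g then m' else m' - 1) (del g (B - {g}))"
          by (rule Suc.IH) (use True Suc.prems g in \<open>auto simp: del_def\<close>)
      next
        case False
        then have gm: "g < m'" using Suc.prems g by (cases "m' = g") auto
        show "commute_stmt q m (del g A) (if m' < g then m' else m' - 1) (del g (B - {g}))"
        proof (rule Suc.IH)
          fix i assume i: "1 \<le> i" "i < (if m' < g then m' else m' - 1)" "i \<in> del g (B - {g})"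
          then have "i < m'" "Suc i < m'" using gm by auto
          then show "i \<in> del g A" using i Suc.prems(4) gm by (auto simp: del_def)
        qed (use gm Suc.prems g in \<open>auto simp: del_def\<close>)
      qed
    qed (use Suc.prems g in auto)
    ultimately show ?thesis by (simp add: commute_stmt_def chain_expr_def)
  qed
qed simp

section \<open>Comparison with the definition of the Casimir elements\<close>

lemma subst_tau_letter:
  assumes "below p x"
  shows "subst (tau_letter q p) x = subst (ir_eval q (Suc p)) (subst (tau_lift q p) x)"
  unfolding subst_subst
proof (rule subst_cong)
  fix l assume l: "l \<in> letters x"
  show "tau_letter q p l = subst (ir_eval q (Suc p)) (tau_lift q p l)"
  proof (cases l)
    case (Inl m)
    then obtain j h where m: "l = Inl (j, h)" by (cases m) auto
    then have "j < p" using assms l unfolding below_def by blast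
    then show ?thesis using m by simp
  next
    case (Inr i)
    then show ?thesis by (cases i) (simp_all add: sub_def smul_def)
  qed
qed

lemma uq_family_cong:
  assumes "uq_family sc q n \<phi>" "\<And>i. 1 \<le> i \<Longrightarrow> i \<le> n \<Longrightarrow> \<psi> i = \<phi> i"
  shows "uq_family sc q n \<psi>"
proof -
  have e: "\<psi> i = \<phi> i" if "i \<in> {1..n}" for i using that assms(2) by simp
  show ?thesis unfolding uq_family_def
  proof (intro conjI ballI impI allI)
    fix i assume i: "i \<in> {1..n}"
    show "uq_gen (sc q) (sc (inverse q)) (\<psi> i)" unfolding e[OF i] by (rule family_quad[OF assms(1) i])
    fix j x y assume j: "j \<in> {1..n}" "i \<noteq> j"
    show "commutes (\<psi> i x) (\<psi> j y)" unfolding e[OF i] e[OF j(1)] by (rule family_commute[OF assms(1) i j])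
  qed
qed

context
  fixes q :: "'k::field"
  assumes q0: "q \<noteq> 0" and q2: "q * q \<noteq> 1"
begin

interpretation uq_scalars alg_scal q using q0 q2 by unfold_locales

text \<open>Two polynomials for the same element of \<open>p\<close> factors have equal values at
  the conjugated family, because that family satisfies all relations. At \<open>t = 1\<close> these
  values are the two substituted images.\<close>

lemma tau_well_defined:
  assumes p: "1 \<le> p" and b: "below p x" "below p y"
    and xy: "alg_eq (uq_rels q p) (subst (ir_eval q p) x) (subst (ir_eval q p) y)"
  shows "alg_eq (uq_rels q (Suc p)) (subst (tau_letter q p) x) (subst (tau_letter q p) y)"
proof (rule generic_complete[OF q0 q2])
  interpret U: uq_scalars "fps_scal alg_scal" q by (rule uq_scalars_fps)
  let ?\<phi> = "generic_family q (Suc p)" let ?S = "fps_scal alg_scal"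
  let ?cf = "\<lambda>i x. fps_const (?\<phi> i x)"
  have fam: "uq_family alg_scal q (Suc p) ?\<phi>" by (rule generic_family[OF q0 q2])
  obtain v where pi: "pass_inv (?S q) (?S (inverse q)) (?cf (Suc p) E) (?cf (Suc p) F) (?cf (Suc p) K) (?cf (Suc p) Ki)
      (?cf p K) (?cf p Ki) (fps_X * ?cf p F) v"
    using tau_pass[OF fam p] by blast
  obtain \<theta> where fam': "uq_family ?S q p (?cf(p := \<theta>))"
    and tp: "tup ?S q \<theta> = tau_tup (?S (inverse q)) (?cf p K) (?cf p Ki) (fps_X * ?cf p F) (tup ?S q (?cf (Suc p)))"
    using pass_family[OF fam p pi] by blast
  have "at_one_tup (tup ?S q \<theta>) (tau_act alg_scal q (?\<phi> p) (tup alg_scal q (?\<phi> (Suc p))))"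
    unfolding tp by (intro at_one_tau_tup at_one_tup at_one_const)
      (use at_one_mult[OF at_one_X at_one_const[of "?\<phi> p F"]] in simp)
  then have at: "at_one (irev ?S q (?cf(p := \<theta>)) (tup ?S q \<theta>) z)
      (irev alg_scal q ?\<phi> (tau_act alg_scal q (?\<phi> p) (tup alg_scal q (?\<phi> (Suc p)))) z)" if "below p z" for z
    by (intro at_one_irev_below[OF that]) (auto intro: at_one_const)
  have "irev ?S q (?cf(p := \<theta>)) (tup ?S q \<theta>) x = irev ?S q (?cf(p := \<theta>)) (tup ?S q \<theta>) y"
    using U.family_sound[OF fam' xy] by (simp add: U.ev_ir_eval)
  then have "irev alg_scal q ?\<phi> (tau_act alg_scal q (?\<phi> p) (tup alg_scal q (?\<phi> (Suc p)))) x
    = irev alg_scal q ?\<phi> (tau_act alg_scal q (?\<phi> p) (tup alg_scal q (?\<phi> (Suc p)))) y"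
    using at_one_unique at[OF b(1)] at[OF b(2)] by simp
  then show "ev alg_scal (unscale alg_scal q ?\<phi>) (subst (tau_letter q p) x)
    = ev alg_scal (unscale alg_scal q ?\<phi>) (subst (tau_letter q p) y)"
    by (simp add: subst_tau_letter[OF b(1)] subst_tau_letter[OF b(2)] ev_ir_eval irev_tau)
qed

text \<open>The polynomial \<open>x\<close> witnesses that the choice in \<open>tau_at\<close> is
  possible, and by \<open>tau_well_defined\<close> any other choice gives a congruent
  result.\<close>

lemma tau_at_eq:
  assumes p: "1 \<le> p" and b: "below p x" and xy: "alg_eq (uq_rels q p) (subst (ir_eval q p) x) y"
  shows "alg_eq (uq_rels q (Suc p)) (subst (ir_eval q (Suc p)) (subst (tau_lift q p) x)) (tau_at q p p y)"
proof -
  let ?P = "\<lambda>y'. \<exists>e. (\<forall>l \<in> letters e. case l of Inl (i, g) \<Rightarrow> i \<in> {1..p} \<and> i \<noteq> p | Inr _ \<Rightarrow> True)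
      \<and> alg_eq (uq_rels q p) (subst (ir_eval q p) e) y \<and> y' = subst (tau_letter q p) e"
  have "?P (subst (tau_letter q p) x)"
  proof (intro exI conjI)
    show "\<forall>l \<in> letters x. case l of Inl (i, g) \<Rightarrow> i \<in> {1..p} \<and> i \<noteq> p | Inr _ \<Rightarrow> True"
    proof
      fix l assume "l \<in> letters x"
      then show "case l of Inl (i, g) \<Rightarrow> i \<in> {1..p} \<and> i \<noteq> p | Inr _ \<Rightarrow> True"
        using b unfolding below_def by (cases l) fastforce+
    qed
  qed (rule xy HOL.refl)+
  then have "?P (tau_at q p p y)" unfolding tau_at_def by (rule someI)
  then obtain e where e: "\<forall>l \<in> letters e. case l of Inl (i, g) \<Rightarrow> i \<in> {1..p} \<and> i \<noteq> p | Inr _ \<Rightarrow> True"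
    "alg_eq (uq_rels q p) (subst (ir_eval q p) e) y" "tau_at q p p y = subst (tau_letter q p) e" by blast
  have "below p e" unfolding below_def
  proof (intro allI impI)
    fix j h assume "Inl (j, h) \<in> letters e"
    then have "j \<in> {1..p} \<and> j \<noteq> p" using e(1) by fastforce
    then show "1 \<le> j \<and> j < p" by auto
  qed
  moreover have "alg_eq (uq_rels q p) (subst (ir_eval q p) x) (subst (ir_eval q p) e)"
    using xy e(2) alg_eq.trans alg_eq.sym by blast
  ultimately have "alg_eq (uq_rels q (Suc p)) (subst (tau_letter q p) x) (subst (tau_letter q p) e)"
    by (intro tau_well_defined p b)
  then show ?thesis by (simp add: e(3) subst_tau_letter[OF b])
qed

text \<open>The map \<open>Delta_at\<close> is evaluation at the family whose member
  \<open>p\<close> is the coproduct of members \<open>p\<close> and \<open>p + 1\<close>; that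
  family satisfies the relations for \<open>p\<close> factors.\<close>

lemma Delta_at_eq:
  assumes p: "1 \<le> p" and b: "below p x" and xy: "alg_eq (uq_rels q p) (subst (ir_eval q p) x) y"
  shows "alg_eq (uq_rels q (Suc p)) (subst (ir_eval q (Suc p)) (subst (delta_lift q p) x)) (Delta_at p y)"
proof (rule generic_complete[OF q0 q2])
  let ?\<phi> = "generic_family q (Suc p)" let ?d = "delta_quad (?\<phi> p) (?\<phi> (Suc p))"
  have fam: "uq_family alg_scal q (Suc p) ?\<phi>" by (rule generic_family[OF q0 q2])
  have "uq_scalars alg_scal q" by unfold_locales
  note M = uq_family_merge[OF this fam p]
  define \<psi> where "\<psi> = (\<lambda>i. if i < p then ?\<phi> i else if i = p then ?d else ?\<phi> (Suc i))"
  have fam': "uq_family alg_scal q p \<psi>"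
    using M(1) by (rule uq_family_cong) (simp add: \<psi>_def)
  have "ev alg_scal (unscale alg_scal q ?\<phi>) (delta_letter p l) = unscale alg_scal q \<psi> l" for l
    by (cases "(p, l)" rule: delta_letter.cases)
      (auto simp: \<psi>_def unscale_def delta_quad_def distrib_left c_move split: gen.splits)
  then have "ev alg_scal (unscale alg_scal q ?\<phi>) (Delta_at p y) = ev alg_scal (unscale alg_scal q \<psi>) y"
    by (simp add: Delta_at_def ev_subst)
  also have "\<dots> = irev alg_scal q \<psi> (tup alg_scal q (\<psi> p)) x"
    using family_sound[OF fam' xy] by (simp add: ev_ir_eval)
  also have "\<dots> = irev alg_scal q ?\<phi> (tup alg_scal q ?d) x"
    unfolding \<psi>_def by (subst irev_below_cong[OF b, of _ ?\<phi>]) auto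
  also have "\<dots> = ev alg_scal (unscale alg_scal q ?\<phi>) (subst (ir_eval q (Suc p)) (subst (delta_lift q p) x))"
    by (simp add: ev_ir_eval irev_delta M(2))
  finally show "ev alg_scal (unscale alg_scal q ?\<phi>) (subst (ir_eval q (Suc p)) (subst (delta_lift q p) x))
     = ev alg_scal (unscale alg_scal q ?\<phi>) (Delta_at p y)" ..
qed

section \<open>Unfolding the recursive definition of \<open>Lam\<close>\<close>

lemma taus_eq:
  assumes "1 \<le> p" "alg_eq (uq_rels q p) (chain_expr q A p) x" "\<And>i. p \<le> i \<Longrightarrow> i < p + j \<Longrightarrow> i \<notin> A"
  shows "alg_eq (uq_rels q (p + j)) (chain_expr q A (p + j)) (taus q p j x)"
  using assms
proof (induction j arbitrary: p x)
  case (Suc j)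
  have "alg_eq (uq_rels q (Suc p)) (chain_expr q A (Suc p)) (tau_at q p p x)"
    using tau_at_eq[OF Suc.prems(1) below_chain Suc.prems(2)[unfolded chain_expr_def]] Suc.prems(1,3)
    by (simp add: chain_expr_def)
  then show ?case using Suc.IH[of "Suc p" "tau_at q p p x"] Suc.prems by simp
qed simp

text \<open>The list holds original positions, whereas \<open>k\<close> and \<open>A\<close> are
  already shifted down by \<open>s\<close>, so that \<open>k = prev - s\<close> is the current
  number of factors. Gaps between list entries are steps of \<open>\<tau>_R\<close>, the entry at
  \<open>k\<close> a coproduct.\<close>

lemma lam_go_eq:
  assumes "1 \<le> k" "alg_eq (uq_rels q k) (chain_expr q A k) x" "prev = k + s" "sorted_wrt (<) (prev # bs)"
    "k \<in> A" "\<And>i. k < i \<Longrightarrow> i \<in> A \<longleftrightarrow> i + s \<in> set bs"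
  shows "alg_eq (uq_rels q (last (prev # bs) - s)) (chain_expr q A (last (prev # bs) - s)) (lam_go q k prev bs x)"
  using assms
proof (induction bs arbitrary: k prev x)
  case (Cons b bs)
  let ?y = "taus q (k + 1) (b - prev - 1) (Delta_at k x)" let ?k = "k + (b - prev)"
  have b: "prev < b" using Cons.prems by simp
  have "alg_eq (uq_rels q (Suc k)) (chain_expr q A (Suc k)) (Delta_at k x)"
    using Delta_at_eq[OF Cons.prems(1) below_chain Cons.prems(2)[unfolded chain_expr_def]] Cons.prems(1,5)
    by (simp add: chain_expr_def)
  moreover have "i \<notin> A" if "Suc k \<le> i" "i < Suc k + (b - prev - 1)" for i
    using Cons.prems(3,4) Cons.prems(6)[of i] that by fastforce
  ultimately have "alg_eq (uq_rels q (Suc k + (b - prev - 1))) (chain_expr q A (Suc k + (b - prev - 1))) (taus q (Suc k) (b - prev - 1) (Delta_at k x))"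
    by (intro taus_eq) auto
  moreover have eq: "Suc k + (b - prev - 1) = ?k" using b by simp
  ultimately have y: "alg_eq (uq_rels q ?k) (chain_expr q A ?k) ?y"
    unfolding eq by (simp only: Suc_eq_plus1)
  have "alg_eq (uq_rels q (last (b # bs) - s)) (chain_expr q A (last (b # bs) - s)) (lam_go q ?k b bs ?y)"
  proof (rule Cons.IH[OF _ y])
    show "b = ?k + s" using b Cons.prems(3) by simp
    show "?k \<in> A" using Cons.prems(3) Cons.prems(6)[of ?k] b by simp
    show "i \<in> A \<longleftrightarrow> i + s \<in> set bs" if "?k < i" for i
      using Cons.prems(6)[of i] that b Cons.prems(3) by auto
  qed (use Cons.prems in auto)
  then show ?case by simp
qed simp

text \<open>No position up to \<open>s\<close> lies in \<open>A\<close>, so the matrices there are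
  those of \<open>\<tau>_R\<close>, which fix the Casimir component. A chain started at 1 therefore
  agrees with one started at \<open>s + 1\<close>.\<close>

lemma irev_shift:
  assumes "1 \<le> p" "\<And>i. 1 \<le> i \<Longrightarrow> i \<in> A' \<longleftrightarrow> i + s \<in> A" "\<And>i. i \<in> A \<Longrightarrow> s < i"
  shows "irev alg_scal q (\<lambda>i. \<phi> (i + s)) T (chain q A' p) = irev alg_scal q \<phi> T (chain q A (p + s))"
  using assms(1)
proof (induction p arbitrary: T rule: dec_induct)
  case base
  have "irev alg_scal q \<phi> T (chain q A (Suc i)) = snd (snd (snd T))" if "i \<le> s" for i T
    using that
  proof (induction i arbitrary: T)
    case (Suc i)
    then have "Suc i \<notin> A" using assms(3)[of "Suc i"] by auto
    moreover have "snd (snd (snd (tau_act alg_scal q \<theta> T))) = snd (snd (snd T))" for \<theta> by (cases T) simp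
    ultimately show ?case using Suc by (subst irev_chain) simp_all
  qed (simp add: irev_chain_1[unfolded One_nat_def] del: chain.simps)
  from this[of s] show ?case by (cases T) simp
next
  case (step p)
  then show ?case using assms(2)[of p]
    by (simp only: add_Suc irev_chain[OF step(1)] irev_chain[of "p + s", OF trans_le_add1[OF step(1)]])
qed

lemma ev_Lam:
  assumes fam: "uq_family alg_scal q n \<phi>" and A: "A \<subseteq> {1..n}" "A \<noteq> {}"
  shows "ev alg_scal (unscale alg_scal q \<phi>) (Lam q A) = irev alg_scal q \<phi> (tup alg_scal q (\<phi> (Max A))) (chain q A (Max A))"
proof -
  have fin: "finite A" using A(1) finite_subset by blast
  define s where "s = Min A - 1"
  define A' where "A' = {i. i + s \<in> A}"
  have min: "Min A \<in> A" "1 \<le> Min A" using fin A by (auto simp: subset_iff)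
  have max: "Max A \<in> A" "Max A \<le> n" "Min A \<le> Max A" using fin A by (auto simp: subset_iff)
  have sl: "sorted_list_of_set A = Min A # tl (sorted_list_of_set A)"
    using sorted_list_of_set_nonempty[OF fin A(2)] by simp
  let ?bs = "tl (sorted_list_of_set A)"
  have set: "set (Min A # ?bs) = A" unfolding sl[symmetric] using fin by simp
  have sorted: "sorted_wrt (<) (Min A # ?bs)" unfolding sl[symmetric] by simp
  have last: "last (Min A # ?bs) = Max A"
  proof (rule Max_eqI[OF fin, symmetric])
    show "last (Min A # ?bs) \<in> A" using set last_in_set[of "Min A # ?bs"] by blast
    fix y assume "y \<in> A"
    define xs where "xs = Min A # ?bs"
    have xs: "xs = butlast xs @ [last xs]" by (simp add: xs_def)
    then have "\<forall>x\<in>set (butlast xs). x < last xs"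
      using sorted unfolding xs_def[symmetric] by (metis list.set_intros(1) sorted_wrt_append)
    moreover have "y \<in> set (butlast xs) \<or> y = last xs"
      using \<open>y \<in> A\<close> set xs unfolding xs_def[symmetric] by (metis Un_iff empty_iff list.set(1) set_ConsD set_append)
    ultimately show "y \<le> last (Min A # ?bs)" unfolding xs_def[symmetric] by auto
  qed
  have "alg_eq (uq_rels q (Max A - s)) (chain_expr q A' (Max A - s)) (lam_go q 1 (Min A) ?bs (Cas q 1))"
    unfolding last[symmetric]
  proof (rule lam_go_eq)
    show "alg_eq (uq_rels q 1) (chain_expr q A' 1) (Cas q 1)" by (simp add: chain_expr_def alg_eq.refl)
    show "Min A = 1 + s" using min by (simp add: s_def)
    then show "1 \<in> A'" using min by (simp add: A'_def)
    show "i \<in> A' \<longleftrightarrow> i + s \<in> set ?bs" if "1 < i" for i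
    proof -
      have "i + s \<noteq> Min A" using that min by (simp add: s_def)
      moreover have "i + s \<in> A \<longleftrightarrow> i + s \<in> set (Min A # ?bs)" unfolding set ..
      ultimately show ?thesis by (simp add: A'_def)
    qed
  qed (use sorted in auto)
  note go = this
  have sM: "Max A - s + s = Max A" using max by (simp add: s_def)
  have fs: "uq_family alg_scal q (Max A - s) (\<lambda>i. \<phi> (i + s))"
    unfolding uq_family_def
  proof (intro conjI ballI impI allI)
    have r: "i + s \<in> {1..n}" if "i \<in> {1..Max A - s}" for i using that max sM by auto
    fix i assume i: "i \<in> {1..Max A - s}"
    show "uq_gen (alg_scal q) (alg_scal (inverse q)) (\<phi> (i + s))" by (rule family_quad[OF fam r[OF i]])
    fix j x y assume j: "j \<in> {1..Max A - s}" "i \<noteq> j"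
    show "commutes (\<phi> (i + s) x) (\<phi> (j + s) y)"
      by (rule family_commute[OF fam r[OF i] r[OF j(1)]]) (use j(2) in simp)
  qed
  have "ev alg_scal (unscale alg_scal q (\<lambda>i. \<phi> (i + s))) (lam_go q 1 (Min A) ?bs (Cas q 1)) =
    irev alg_scal q (\<lambda>i. \<phi> (i + s)) (tup alg_scal q (\<phi> (Max A - s + s))) (chain q A' (Max A - s))"
    using family_sound[OF fs go] unfolding ev_chain_expr by (rule HOL.sym)
  also have "\<dots> = irev alg_scal q \<phi> (tup alg_scal q (\<phi> (Max A - s + s))) (chain q A (Max A - s + s))"
  proof (rule irev_shift)
    show "s < i" if "i \<in> A" for i using min(2) Min_le[OF fin that] unfolding s_def by linarith
  qed (use min max in \<open>auto simp: A'_def s_def\<close>)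
  also note sM
  finally have "ev alg_scal (unscale alg_scal q (\<lambda>i. \<phi> (i + s))) (lam_go q 1 (Min A) ?bs (Cas q 1)) =
    irev alg_scal q \<phi> (tup alg_scal q (\<phi> (Max A))) (chain q A (Max A))" .
  moreover have "ev alg_scal (unscale alg_scal q \<phi>) (shift s y) = ev alg_scal (unscale alg_scal q (\<lambda>i. \<phi> (i + s))) y" for y
    unfolding shift_def ev_subst by (rule ev_cong) (auto simp: unscale_def)
  ultimately show ?thesis using A(2) by (simp add: Lam_def s_def)
qed

end

theorem theorem3p1:
  fixes q :: "'k::field" and n :: nat and A B :: "nat set"
  assumes "q \<noteq> 0" and "\<forall>m::nat. m > 0 \<longrightarrow> q ^ m \<noteq> 1"
    and "n \<ge> 1" and "A \<subseteq> {1..n}" and "B \<subseteq> A"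
  shows "alg_eq (uq_rels q n) (Mul (Lam q A) (Lam q B)) (Mul (Lam q B) (Lam q A))"
proof (cases "B = {}")
  case True
  then show ?thesis by (simp add: Lam_def alg_eq.sym[OF alg_eq.scal_central])
next
  case False
  have q: "q \<noteq> 0" "q * q \<noteq> 1"
    using assms(1) assms(2)[rule_format, of 2] by (auto simp: power2_eq_square)
  interpret uq_scalars alg_scal q using q by unfold_locales
  have A: "A \<subseteq> {1..n}" "A \<noteq> {}" and B: "B \<subseteq> {1..n}" "B \<noteq> {}" using assms False by auto
  have fin: "finite A" "finite B" using A B finite_subset by blast+
  have max: "Max B \<in> A" "Max B \<le> Max A" "1 \<le> Max B" "Max A \<le> n"
    using subsetD[OF assms(5) Max_in[OF fin(2) B(2)]] subsetD[OF B(1) Max_in[OF fin(2) B(2)]]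
      subsetD[OF A(1) Max_in[OF fin(1) A(2)]] Max_mono[OF assms(5) B(2) fin(1)] by simp_all
  have fam: "uq_family alg_scal q n (generic_family q n)" by (rule generic_family[OF q])
  have "commute_stmt q (Max A) A (Max B) B"
    by (rule commute_chain[OF q]) (use max assms(5) in auto)
  from commute_sound[OF this family_mono[OF fam max(4)]] show ?thesis
    by (intro generic_complete[OF q]) (simp add: ev_Lam[OF q fam A] ev_Lam[OF q fam B])
qed

end
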